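(* (i) Let $\underset{1}{G}{}_{(j)k}^{(a)}$ be the components of a temporal semispray $\underset{1}{G}$ on $E^{*}=J^{1*}(\mathcal{T},M)$ and let $\varphi_{ij}(x)$ be a semi-Riemannian metric on the spatial manifold $M$, with inverse $\varphi^{ij}$. Then the local components $$\underset{1}{N}{}_{(r)b}^{(a)}=\varphi^{jk}\,\frac{\partial \underset{1}{G}{}_{(j)k}^{(a)}}{\partial p_i^b}\,\varphi_{ir}$$ are the temporal components of a nonlinear connection $N_G$ on $E^{*}$. (ii) Conversely, if $\underset{1}{N}{}_{(i)b}^{(a)}$ are the temporal components of a nonlinear connection $N$ on $E^{*}$, then the local components $$\underset{1}{G}{}_{(i)j}^{(a)}=\frac12\,\underset{1}{N}{}_{(i)b}^{(a)}\,p_j^b$$ are the components of a temporal semispray $\underset{1}{G}{}_N$ on $E^{*}$.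
   Context: Everything is $C^\infty$ and repeated indices are summed. $\mathcal{T}$ and $M$ are smooth real manifolds of dimensions $m$ and $n$, with local coordinates $(t^a)_{a=1}^m$ and $(x^i)_{i=1}^n$. $E^{*}=J^{1*}(\mathcal{T},M)\to\mathcal{T}\times M$ is the dual of the first jet vector bundle $J^1(\mathcal{T},M)\to\mathcal{T}\times M$ (whose fibre at $(t,x)$ is the vector space of $1$-jets at $t$ of maps sending $t$ to $x$, with fibre coordinates $x^i_a=\partial x^i/\partial t^a$). It has induced coordinates $(t^a,x^i,p_i^a)$, and coordinate changes on $\mathcal{T}\times M$ of the form $\tilde t^a=\tilde t^a(t^b)$, $\tilde x^i=\tilde x^i(x^j)$ induce on $E^{*}$ the change with $$\tilde p_i^a=\frac{\partial x^j}{\partial\tilde x^i}\frac{\partial\tilde t^a}{\partial t^b}p_j^b .$$ Local functions on $E^{*}$ below are given in every such induced chart. Partial derivatives such as $\partial\tilde p_j^b/\partial t^a$, $\partial\tilde p_j^b/\partial x^i$ are taken in the coordinates $(t,x,p)$. A temporal semispray on $E^{*}$ is a global tensor field on $E^{*}$ locally of the form $$\underset{1}{G}=p_i^a\,dx^i\otimes\frac{\partial}{\partial t^a}-2\,\underset{1}{G}{}_{(j)i}^{(b)}\,dx^i\otimes\frac{\partial}{\partial p_j^b};$$ the functions $\underset{1}{G}{}_{(j)i}^{(b)}$ are its components. A nonlinear connection on $E^{*}$ is a pair of families of local functions $N=(\underset{1}{N}{}_{(k)a}^{(c)},\underset{2}{N}{}_{(k)i}^{(c)})$ (temporal and spatial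 components respectively) which transform by $$\underset{1}{\widetilde N}{}_{(j)d}^{(b)}=\underset{1}{N}{}_{(k)a}^{(c)}\frac{\partial\tilde t^b}{\partial t^c}\frac{\partial x^k}{\partial\tilde x^j}\frac{\partial t^a}{\partial\tilde t^d}-\frac{\partial t^a}{\partial\tilde t^d}\frac{\partial\tilde p_j^b}{\partial t^a},\qquad \underset{2}{\widetilde N}{}_{(j)r}^{(b)}=\underset{2}{N}{}_{(k)i}^{(c)}\frac{\partial\tilde t^b}{\partial t^c}\frac{\partial x^k}{\partial\tilde x^j}\frac{\partial x^i}{\partial\tilde x^r}-\frac{\partial x^i}{\partial\tilde x^r}\frac{\partial\tilde p_j^b}{\partial x^i}.$$ A family is said to be the temporal components of a nonlinear connection if it satisfies the first of these rules. *)

theory Defs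
  imports "HOL-Analysis.Analysis"
begin

section \<open>Smooth functions between Euclidean spaces\<close>

text \<open>To be used for open sets only: the derivatives are taken in the whole space.\<close>

primrec Ck_on :: "nat \<Rightarrow> 'a::euclidean_space set \<Rightarrow> ('a \<Rightarrow> 'b::real_normed_vector) \<Rightarrow> bool" where
  "Ck_on 0 S f \<longleftrightarrow> continuous_on S f"
| "Ck_on (Suc k) S f \<longleftrightarrow>
     (\<forall>x\<in>S. f differentiable (at x)) \<and> (\<forall>v. Ck_on k S (\<lambda>x. frechet_derivative f (at x) v))"

definition smooth_on :: "'a::euclidean_space set \<Rightarrow> ('a \<Rightarrow> 'b::real_normed_vector) \<Rightarrow> bool" where
  "smooth_on S f \<longleftrightarrow> (\<forall>k. Ck_on k S f)"

section \<open>Manifolds\<close>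

text \<open>A chart is a pair of its domain and its coordinate map. Only the values of the
  coordinate map on the domain matter.\<close>

type_synonym ('a, 'e) chart = "'a set \<times> ('a \<Rightarrow> 'e)"

abbreviation cdom :: "('a, 'e) chart \<Rightarrow> 'a set" where
  "cdom \<equiv> fst"

abbreviation crd :: "('a, 'e) chart \<Rightarrow> 'a \<Rightarrow> 'e" where
  "crd \<equiv> snd"

definition cimg :: "('a, 'e) chart \<Rightarrow> 'e set" where
  "cimg c = crd c ` cdom c"

definition cinv :: "('a, 'e) chart \<Rightarrow> 'e \<Rightarrow> 'a" where
  "cinv c = inv_into (cdom c) (crd c)"

definition chart_on :: "'a topology \<Rightarrow> ('a, 'e::euclidean_space) chart \<Rightarrow> bool" where
  "chart_on X c \<longleftrightarrow> openin X (cdom c) \<and> open (cimg c) \<and>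
     homeomorphic_map (subtopology X (cdom c)) (top_of_set (cimg c)) (crd c)"

definition compatible :: "('a, 'e::euclidean_space) chart \<Rightarrow> ('a, 'e) chart \<Rightarrow> bool" where
  "compatible c d \<longleftrightarrow>
     smooth_on (crd c ` (cdom c \<inter> cdom d)) (crd d \<circ> cinv c) \<and>
     smooth_on (crd d ` (cdom c \<inter> cdom d)) (crd c \<circ> cinv d)"

text \<open>A smooth manifold is a Hausdorff second countable space with a maximal smooth atlas.\<close>

definition smooth_manifold :: "'a topology \<Rightarrow> ('a, 'e::euclidean_space) chart set \<Rightarrow> bool" where
  "smooth_manifold X A \<longleftrightarrow>
     Hausdorff_space X \<and> second_countable X \<and>
     (\<Union>c\<in>A. cdom c) = topspace X \<and>
     (\<forall>c\<in>A. chart_on X c) \<and>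
     (\<forall>c\<in>A. \<forall>d\<in>A. compatible c d) \<and>
     (\<forall>d. chart_on X d \<and> (\<forall>c\<in>A. compatible c d) \<longrightarrow> d \<in> A)"

definition carrier_of :: "('a, 'e) chart set \<Rightarrow> 'a set" where
  "carrier_of A = (\<Union>c\<in>A. cdom c)"

text \<open>Directional derivative, along \<open>w\<close> in the coordinates \<open>c\<close>, of a function given near the
  point \<open>x\<close> of the manifold; for \<open>w\<close> a basis vector this is a partial derivative.\<close>

definition pd :: "('a, 'e::euclidean_space) chart \<Rightarrow> ('a \<Rightarrow> 'b::real_normed_vector) \<Rightarrow> 'a \<Rightarrow> 'e \<Rightarrow> 'b" where
  "pd c f x w = frechet_derivative (f \<circ> cinv c) (at (crd c x)) w"

definition smooth_in :: "('a, 'e::euclidean_space) chart \<Rightarrow> ('a \<Rightarrow> 'b::real_normed_vector) \<Rightarrow> bool" where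
  "smooth_in c f \<longleftrightarrow> smooth_on (cimg c) (f \<circ> cinv c)"

section \<open>Tangent vectors and tensor fields\<close>

text \<open>A tangent vector at \<open>x\<close> is a family of coordinate vectors, one for each chart around \<open>x\<close>,
  related by the differentials of the coordinate changes; the vector space operations are
  pointwise. The entries for the remaining indices are set to \<open>0\<close>.\<close>

type_synonym ('a, 'e) tangent = "('a, 'e) chart \<Rightarrow> 'e"

definition tangent_space ::
  "('a, 'e::euclidean_space) chart set \<Rightarrow> 'a \<Rightarrow> ('a, 'e) tangent set" where
  "tangent_space A x = {v.
     (\<forall>c\<in>A. \<forall>d\<in>A. x \<in> cdom c \<and> x \<in> cdom d \<longrightarrow> v d = pd c (crd d) x (v c)) \<and>
     (\<forall>c. \<not> (c \<in> A \<and> x \<in> cdom c) \<longrightarrow> v c = 0)}"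

text \<open>The tangent vector at \<open>x\<close> with coordinate vector \<open>w\<close> in the chart \<open>c\<close>. For a basis vector
  \<open>w\<close> this is the corresponding coordinate vector field at \<open>x\<close>.\<close>

definition coord_vec ::
  "('a, 'e::euclidean_space) chart set \<Rightarrow> ('a, 'e) chart \<Rightarrow> 'a \<Rightarrow> 'e \<Rightarrow> ('a, 'e) tangent" where
  "coord_vec A c x w = (\<lambda>d. if d \<in> A \<and> x \<in> cdom d then pd c (crd d) x w else 0)"

text \<open>Smooth tensor fields of type (1,1), read as fields of endomorphisms of the tangent spaces:
  the tensor product of a covector \<open>\<alpha>\<close> and a vector \<open>X\<close> is the map \<open>v \<mapsto> \<alpha>(v) X\<close>.\<close>

definition tensor_field_11 ::
  "('a, 'e::euclidean_space) chart set \<Rightarrow> ('a \<Rightarrow> ('a, 'e) tangent \<Rightarrow> ('a, 'e) tangent) \<Rightarrow> bool" where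
  "tensor_field_11 A G \<longleftrightarrow>
     (\<forall>x\<in>carrier_of A.
        (\<forall>v\<in>tangent_space A x. G x v \<in> tangent_space A x) \<and>
        (\<forall>u\<in>tangent_space A x. \<forall>v\<in>tangent_space A x. \<forall>a b.
           G x (\<lambda>c. a *\<^sub>R u c + b *\<^sub>R v c) = (\<lambda>c. a *\<^sub>R G x u c + b *\<^sub>R G x v c))) \<and>
     (\<forall>c\<in>A. \<forall>w. smooth_in c (\<lambda>x. G x (coord_vec A c x w) c))"

text \<open>Smooth tensor fields of type (0,2), as fields of bilinear forms.\<close>

definition tensor_field_02 ::
  "('a, 'e::euclidean_space) chart set \<Rightarrow> ('a \<Rightarrow> ('a, 'e) tangent \<Rightarrow> ('a, 'e) tangent \<Rightarrow> real) \<Rightarrow> bool" where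
  "tensor_field_02 A \<phi> \<longleftrightarrow>
     (\<forall>x\<in>carrier_of A. \<forall>u\<in>tangent_space A x. \<forall>v\<in>tangent_space A x. \<forall>w\<in>tangent_space A x. \<forall>a b.
        \<phi> x (\<lambda>c. a *\<^sub>R u c + b *\<^sub>R v c) w = a * \<phi> x u w + b * \<phi> x v w \<and>
        \<phi> x w (\<lambda>c. a *\<^sub>R u c + b *\<^sub>R v c) = a * \<phi> x w u + b * \<phi> x w v) \<and>
     (\<forall>c\<in>A. \<forall>v w. smooth_in c (\<lambda>x. \<phi> x (coord_vec A c x v) (coord_vec A c x w)))"

definition form_index :: "('e::euclidean_space \<Rightarrow> 'e \<Rightarrow> real) \<Rightarrow> nat" where
  "form_index B = Max {dim W | W. subspace W \<and> (\<forall>w\<in>W. w \<noteq> 0 \<longrightarrow> B w w < 0)}"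

definition semi_riemannian_metric ::
  "('a, 'e::euclidean_space) chart set \<Rightarrow> ('a \<Rightarrow> ('a, 'e) tangent \<Rightarrow> ('a, 'e) tangent \<Rightarrow> real) \<Rightarrow> bool" where
  "semi_riemannian_metric A \<phi> \<longleftrightarrow>
     tensor_field_02 A \<phi> \<and>
     (\<forall>x\<in>carrier_of A.
        (\<forall>u\<in>tangent_space A x. \<forall>v\<in>tangent_space A x. \<phi> x u v = \<phi> x v u) \<and>
        (\<forall>u\<in>tangent_space A x. (\<forall>v\<in>tangent_space A x. \<phi> x u v = 0) \<longrightarrow> u = (\<lambda>_. 0))) \<and>
     (\<exists>\<nu>. \<forall>c\<in>A. \<forall>x\<in>cdom c.
        form_index (\<lambda>v w. \<phi> x (coord_vec A c x v) (coord_vec A c x w)) = \<nu>)"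

definition metric_comp ::
  "('a, real^'n) chart set \<Rightarrow> ('a \<Rightarrow> ('a, real^'n) tangent \<Rightarrow> ('a, real^'n) tangent \<Rightarrow> real)
     \<Rightarrow> ('a, real^'n) chart \<Rightarrow> 'a \<Rightarrow> real^'n^'n" where
  "metric_comp A \<phi> c x =
     (\<chi> i j. \<phi> x (coord_vec A c x (axis i 1)) (coord_vec A c x (axis j 1)))"

section \<open>The first jet bundle and its dual\<close>

text \<open>In this section \<open>A\<close> and \<open>B\<close> are the atlases of the temporal manifold and of the spatial
  manifold, with coordinates \<open>t\<close> and \<open>x\<close>. Maps defined near a point are represented by total
  functions whose values elsewhere are irrelevant.\<close>

definition smooth_near ::
  "('t, real^'m) chart set \<Rightarrow> ('x, real^'n) chart set \<Rightarrow> 't \<Rightarrow> ('t \<Rightarrow> 'x) \<Rightarrow> bool" where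
  "smooth_near A B t f \<longleftrightarrow>
     (\<exists>c\<in>A. \<exists>d\<in>B. \<exists>W. t \<in> cdom c \<and> open W \<and> crd c t \<in> W \<and> W \<subseteq> cimg c \<and>
        f ` cinv c ` W \<subseteq> cdom d \<and> smooth_on W (crd d \<circ> f \<circ> cinv c))"

text \<open>The matrix of the first derivatives of \<open>x\<^sup>i \<circ> f\<close> by \<open>t\<^sup>a\<close>: row \<open>i\<close>, column \<open>a\<close>.\<close>

definition map_jac ::
  "('t, real^'m) chart \<Rightarrow> ('x, real^'n) chart \<Rightarrow> 't \<Rightarrow> ('t \<Rightarrow> 'x) \<Rightarrow> real^'m^'n" where
  "map_jac c d t f = (\<chi> i a. pd c (\<lambda>s. crd d (f s) $ i) t (axis a 1))"

definition jet1 ::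
  "('t, real^'m) chart set \<Rightarrow> ('x, real^'n) chart set \<Rightarrow> 't \<Rightarrow> ('t \<Rightarrow> 'x) \<Rightarrow> ('t \<Rightarrow> 'x) set" where
  "jet1 A B t f = {g. smooth_near A B t g \<and> g t = f t \<and>
     (\<forall>c\<in>A. \<forall>d\<in>B. t \<in> cdom c \<and> f t \<in> cdom d \<longrightarrow> map_jac c d t g = map_jac c d t f)}"

definition jet_fibre ::
  "('t, real^'m) chart set \<Rightarrow> ('x, real^'n) chart set \<Rightarrow> 't \<Rightarrow> 'x \<Rightarrow> ('t \<Rightarrow> 'x) set set" where
  "jet_fibre A B t x = {jet1 A B t f | f. smooth_near A B t f \<and> f t = x}"

definition jet_coord ::
  "('t, real^'m) chart \<Rightarrow> ('x, real^'n) chart \<Rightarrow> 't \<Rightarrow> ('t \<Rightarrow> 'x) set \<Rightarrow> real^'m^'n" where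
  "jet_coord c d t j = map_jac c d t (SOME f. f \<in> j)"

text \<open>The vector space structure of a fibre is the one for which the fibre coordinates are
  linear: \<open>l\<close> is the linear combination \<open>a j + b k\<close>.\<close>

definition jet_lincomb ::
  "('t, real^'m) chart set \<Rightarrow> ('x, real^'n) chart set \<Rightarrow> 't \<Rightarrow> 'x
     \<Rightarrow> real \<Rightarrow> ('t \<Rightarrow> 'x) set \<Rightarrow> real \<Rightarrow> ('t \<Rightarrow> 'x) set \<Rightarrow> ('t \<Rightarrow> 'x) set \<Rightarrow> bool" where
  "jet_lincomb A B t x a j b k l \<longleftrightarrow>
     (\<forall>c\<in>A. \<forall>d\<in>B. t \<in> cdom c \<and> x \<in> cdom d \<longrightarrow>
        jet_coord c d t l = a *\<^sub>R jet_coord c d t j + b *\<^sub>R jet_coord c d t k)"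

text \<open>The dual space of a fibre; a functional is set to \<open>undefined\<close> off the fibre.\<close>

definition dual_fibre ::
  "('t, real^'m) chart set \<Rightarrow> ('x, real^'n) chart set \<Rightarrow> 't \<Rightarrow> 'x \<Rightarrow> (('t \<Rightarrow> 'x) set \<Rightarrow> real) set" where
  "dual_fibre A B t x = {\<omega>. \<omega> \<in> extensional (jet_fibre A B t x) \<and>
     (\<forall>j\<in>jet_fibre A B t x. \<forall>k\<in>jet_fibre A B t x. \<forall>l\<in>jet_fibre A B t x. \<forall>a b.
        jet_lincomb A B t x a j b k l \<longrightarrow> \<omega> l = a * \<omega> j + b * \<omega> k)}"

type_synonym ('t, 'x) covjet = "'t \<times> 'x \<times> (('t \<Rightarrow> 'x) set \<Rightarrow> real)"

definition dual_jet_bundle ::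
  "('t, real^'m) chart set \<Rightarrow> ('x, real^'n) chart set \<Rightarrow> ('t, 'x) covjet set" where
  "dual_jet_bundle A B =
     {(t, x, \<omega>). t \<in> carrier_of A \<and> x \<in> carrier_of B \<and> \<omega> \<in> dual_fibre A B t x}"

text \<open>The coordinates \<open>p\<close> dual to the fibre coordinates of the jet bundle; \<open>p $ i $ a\<close> is the
  coordinate with lower index \<open>i\<close> and upper index \<open>a\<close>.\<close>

definition p_coord ::
  "('t, real^'m) chart set \<Rightarrow> ('x, real^'n) chart set \<Rightarrow> ('t, real^'m) chart \<Rightarrow> ('x, real^'n) chart
     \<Rightarrow> ('t, 'x) covjet \<Rightarrow> real^'m^'n" where
  "p_coord A B c d = (\<lambda>(t, x, \<omega>). THE p. \<forall>j\<in>jet_fibre A B t x.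
     \<omega> j = (\<Sum>i\<in>UNIV. \<Sum>a\<in>UNIV. p $ i $ a * jet_coord c d t j $ i $ a))"

type_synonym ('m, 'n) txp = "(real^'m) \<times> (real^'n) \<times> (real^'m^'n)"

definition induced_chart ::
  "('t, real^'m) chart set \<Rightarrow> ('x, real^'n) chart set \<Rightarrow> ('t, real^'m) chart \<Rightarrow> ('x, real^'n) chart
     \<Rightarrow> (('t, 'x) covjet, ('m, 'n) txp) chart" where
  "induced_chart A B c d =
     ({e \<in> dual_jet_bundle A B. fst e \<in> cdom c \<and> fst (snd e) \<in> cdom d},
      \<lambda>e. (crd c (fst e), crd d (fst (snd e)), p_coord A B c d e))"

definition induced_atlas ::
  "('t, real^'m) chart set \<Rightarrow> ('x, real^'n) chart set \<Rightarrow> (('t, 'x) covjet, ('m, 'n) txp) chart set" where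
  "induced_atlas A B = {induced_chart A B c d | c d. c \<in> A \<and> d \<in> B}"

abbreviation t_dir :: "'m \<Rightarrow> ('m::finite, 'n::finite) txp" where
  "t_dir a \<equiv> (axis a 1, 0, 0)"

abbreviation x_dir :: "'n \<Rightarrow> ('m::finite, 'n::finite) txp" where
  "x_dir i \<equiv> (0, axis i 1, 0)"

abbreviation p_dir :: "'n \<Rightarrow> 'm \<Rightarrow> ('m::finite, 'n::finite) txp" where
  "p_dir i a \<equiv> (0, 0, axis i (axis a 1))"

section \<open>Temporal semisprays and nonlinear connections\<close>

text \<open>A family of local functions on the dual jet bundle, one for each induced chart, carrying one
  upper index and two lower indices, the first of which is paired with the upper one as in
  \<open>p\<close>. The arguments are the two charts, the upper index, the paired lower index, the other lower
  index (spatial for \<open>G\<close>, temporal for the temporal part of a nonlinear connection) and the point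
  of the bundle.\<close>

type_synonym ('t, 'x, 'm, 'n, 'k) local_family =
  "('t, real^'m) chart \<Rightarrow> ('x, real^'n) chart \<Rightarrow> 'm \<Rightarrow> 'n \<Rightarrow> 'k \<Rightarrow> ('t, 'x) covjet \<Rightarrow> real"

text \<open>\<open>GG\<close> is a temporal semispray with components \<open>G\<close>. The tangent vector \<open>v\<close> at \<open>e\<close> has, in the
  coordinates of \<open>C\<close>, the spatial part \<open>fst (snd (v C))\<close>, whose entries are the values on \<open>v\<close> of the
  differentials of the coordinates \<open>x\<close>.\<close>

definition temporal_semispray ::
  "('t, real^'m) chart set \<Rightarrow> ('x, real^'n) chart set
     \<Rightarrow> (('t, 'x) covjet \<Rightarrow> (('t, 'x) covjet, ('m, 'n) txp) tangent \<Rightarrow> (('t, 'x) covjet, ('m, 'n) txp) tangent)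
     \<Rightarrow> ('t, 'x, 'm, 'n, 'n) local_family \<Rightarrow> bool" where
  "temporal_semispray A B GG G \<longleftrightarrow>
     tensor_field_11 (induced_atlas A B) GG \<and>
     (\<forall>c\<in>A. \<forall>d\<in>B. let C = induced_chart A B c d; E = induced_atlas A B in
        \<forall>e\<in>cdom C. \<forall>v\<in>tangent_space E e.
          let dx = (\<lambda>i. fst (snd (v C)) $ i); p = p_coord A B c d e in
          GG e v = (\<lambda>D.
            (\<Sum>i\<in>UNIV. \<Sum>a\<in>UNIV. (p $ i $ a * dx i) *\<^sub>R coord_vec E C e (t_dir a) D) -
            2 *\<^sub>R (\<Sum>i\<in>UNIV. \<Sum>j\<in>UNIV. \<Sum>b\<in>UNIV.
                    (G c d b j i e * dx i) *\<^sub>R coord_vec E C e (p_dir j b) D)))"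

text \<open>In the transformation rule the primed charts are the new coordinates (with a tilde).\<close>

definition temporal_components ::
  "('t, real^'m) chart set \<Rightarrow> ('x, real^'n) chart set \<Rightarrow> ('t, 'x, 'm, 'n, 'm) local_family \<Rightarrow> bool" where
  "temporal_components A B N \<longleftrightarrow>
     (\<forall>c\<in>A. \<forall>d\<in>B. \<forall>b j a. smooth_in (induced_chart A B c d) (N c d b j a)) \<and>
     (\<forall>c\<in>A. \<forall>d\<in>B. \<forall>c'\<in>A. \<forall>d'\<in>B.
        \<forall>e\<in>cdom (induced_chart A B c d) \<inter> cdom (induced_chart A B c' d'). \<forall>b j r.
          let t = fst e; x = fst (snd e);
              dt'_dt = (\<lambda>b a. pd c (\<lambda>s. crd c' s $ b) t (axis a 1));
              dt_dt' = (\<lambda>a b. pd c' (\<lambda>s. crd c s $ a) t (axis b 1));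
              dx_dx' = (\<lambda>k j. pd d' (\<lambda>y. crd d y $ k) x (axis j 1));
              dp'_dt = (\<lambda>j b a. pd (induced_chart A B c d) (\<lambda>e. p_coord A B c' d' e $ j $ b) e (t_dir a))
          in N c' d' b j r e =
               (\<Sum>k\<in>UNIV. \<Sum>a\<in>UNIV. \<Sum>f\<in>UNIV. N c d f k a e * dt'_dt b f * dx_dx' k j * dt_dt' a r) -
               (\<Sum>a\<in>UNIV. dt_dt' a r * dp'_dt j b a))"

end

theory Submission
  imports Defs
begin

text \<open>Everything reduces to one transformation law. In two pairs of charts write \<open>X = \<partial>x/\<partial>x'\<close>, \<open>S = \<partial>t'/\<partial>t\<close> and
  \<open>H\<^sup>b\<^sub>a\<^sub>f = \<partial>\<^sup>2t'\<^sup>b/\<partial>t\<^sup>a\<partial>t\<^sup>f\<close>. Since \<open>p'\<^sub>j\<^sup>b = X\<^sup>k\<^sub>j S\<^sup>b\<^sub>f p\<^sub>k\<^sup>f\<close> (\<open>p_coord_change\<close>), the vector field \<open>\<partial>/\<partial>t\<^sup>a\<close> has the components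
  \<open>X\<^sup>k\<^sub>j H\<^sup>b\<^sub>a\<^sub>f p\<^sub>k\<^sup>f\<close> along \<open>\<partial>/\<partial>p'\<^sub>j\<^sup>b\<close>, and comparing the two local forms of a semispray gives

  \<open>G'\<^sub>j\<^sub>r\<^sup>b = X\<^sup>k\<^sub>j X\<^sup>i\<^sub>r (S\<^sup>b\<^sub>f G\<^sub>k\<^sub>i\<^sup>f - (1/2) H\<^sup>b\<^sub>a\<^sub>f p\<^sub>k\<^sup>f p\<^sub>i\<^sup>a)\<close>

  (\<open>spray_eq_iff\<close>, \<open>semispray_law\<close>).

  A connection gives a semispray because contracting the temporal rule with \<open>p'\<close> produces exactly this law
  (\<open>connection_spray_invariant\<close>); the local expressions then agree on overlaps and glue to a global field.

  Conversely, contracting the law with the inverse metric removes the spatial Jacobian matrices and leaves a correction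
  that is quadratic in \<open>p\<close>. The metric and the second derivatives of the time change are symmetric, so this correction is the
  diagonal of a symmetric bilinear form, and its derivative by \<open>p\<close>, contracted with the metric, is the
  inhomogeneous term \<open>(\<partial>t/\<partial>t') (\<partial>p'/\<partial>t)\<close> of the temporal rule (\<open>spray_conn_law\<close>).

  The rest justifies these formulas for the bundle of functionals on jets: there is a jet with any given coordinates
  (\<open>exists_map_with_jacobian\<close>), so the coordinates \<open>p\<close> exist, are unique and take all values; hence
  the induced charts have open overlaps and differentiable coordinate changes (\<open>atl_E\<close>), and the calculus of tangent vectors on a
  manifold carries over to the bundle.\<close>

section \<open>Calculus of smooth functions\<close>

lemma Ck_on_cong:
  assumes "open S" "\<And>x. x \<in> S \<Longrightarrow> f x = g x"
  shows "Ck_on k S f = Ck_on k S g"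
  using assms(2)
proof (induction k arbitrary: f g)
  case 0
  then show ?case by (simp cong: continuous_on_cong)
next
  case (Suc k)
  have 1: "(f has_derivative D) (at x) \<longleftrightarrow> (g has_derivative D) (at x)" if "x \<in> S" for D x
    using that Suc.prems assms(1) has_derivative_transform_within_open[of f D x UNIV S g]
      has_derivative_transform_within_open[of g D x UNIV S f] by auto
  have 2: "frechet_derivative f (at x) = frechet_derivative g (at x)" if "x \<in> S" for x
    using 1[OF that] unfolding frechet_derivative_def by simp
  have "Ck_on k S (\<lambda>x. frechet_derivative f (at x) v) = Ck_on k S (\<lambda>x. frechet_derivative g (at x) v)" for v
    by (rule Suc.IH) (simp add: 2)
  moreover have "(\<forall>x\<in>S. f differentiable (at x)) = (\<forall>x\<in>S. g differentiable (at x))"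
    using 1 unfolding differentiable_def by blast
  ultimately show ?case by simp
qed

text \<open>Lets a proof name the derivative instead of handling \<open>frechet_derivative\<close>; openness of \<open>S\<close> makes the
  two interchangeable.\<close>

lemma Ck_on_SucI:
  assumes "open S" "\<And>x. x \<in> S \<Longrightarrow> (f has_derivative D x) (at x)" "\<And>v. Ck_on k S (\<lambda>x. D x v)"
  shows "Ck_on (Suc k) S f"
proof -
  have "frechet_derivative f (at x) = D x" if "x \<in> S" for x
    using assms(2)[OF that] frechet_derivative_at by force
  then have "Ck_on k S (\<lambda>x. frechet_derivative f (at x) v)" for v
    using assms(3)[of v] Ck_on_cong[OF assms(1), of "\<lambda>x. frechet_derivative f (at x) v" "\<lambda>x. D x v"] by simp
  then show ?thesis using assms(2) by (auto simp: differentiable_def)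
qed

lemma Ck_on_has_derivative:
  "Ck_on (Suc k) S f \<Longrightarrow> x \<in> S \<Longrightarrow> (f has_derivative frechet_derivative f (at x)) (at x)"
  by (simp flip: frechet_derivative_works)

lemma Ck_on_SucD: "Ck_on (Suc k) S f \<Longrightarrow> Ck_on k S f"
proof (induction k arbitrary: f)
  case 0
  then show ?case
    by (auto simp: continuous_on_eq_continuous_within intro: differentiable_imp_continuous_within
        differentiable_at_withinI)
next
  case (Suc k)
  then show ?case by (metis Ck_on.simps(2))
qed

lemma Ck_on_const: "Ck_on k S (\<lambda>x. c)"
  by (induction k arbitrary: c) auto

lemma Ck_on_bounded_linear:
  assumes "open S" "bounded_linear L"
  shows "Ck_on k S f \<Longrightarrow> Ck_on k S (\<lambda>x. L (f x))"
proof (induction k arbitrary: f)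
  case 0
  then show ?case using assms(2) by (auto intro: bounded_linear.continuous_on)
next
  case (Suc k)
  show ?case
  proof (rule Ck_on_SucI[OF assms(1)])
    show "((\<lambda>x. L (f x)) has_derivative (\<lambda>v. L (frechet_derivative f (at x) v))) (at x)" if "x \<in> S" for x
      by (rule bounded_linear.has_derivative[OF assms(2) Ck_on_has_derivative[OF Suc.prems that]])
    show "Ck_on k S (\<lambda>x. L (frechet_derivative f (at x) v))" for v
      by (rule Suc.IH) (use Suc.prems in simp)
  qed
qed

lemma Ck_on_id: "open S \<Longrightarrow> Ck_on k S (\<lambda>x. x)"
  by (cases k) (auto intro!: Ck_on_SucI[where D = "\<lambda>x v. v"] Ck_on_const)

lemma Ck_on_add:
  assumes "open S"
  shows "Ck_on k S f \<Longrightarrow> Ck_on k S g \<Longrightarrow> Ck_on k S (\<lambda>x. f x + g x)"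
proof (induction k arbitrary: f g)
  case 0
  then show ?case by (auto intro: continuous_on_add)
next
  case (Suc k)
  show ?case
  proof (rule Ck_on_SucI[OF assms(1)])
    show "((\<lambda>x. f x + g x) has_derivative
        (\<lambda>v. frechet_derivative f (at x) v + frechet_derivative g (at x) v)) (at x)" if "x \<in> S" for x
      by (rule has_derivative_add[OF Suc.prems(1)[THEN Ck_on_has_derivative, OF that]
            Suc.prems(2)[THEN Ck_on_has_derivative, OF that]])
    show "Ck_on k S (\<lambda>x. frechet_derivative f (at x) v + frechet_derivative g (at x) v)" for v
      by (rule Suc.IH) (use Suc.prems in simp_all)
  qed
qed

text \<open>One induction covers every product: the Leibniz rule expresses the derivative by products of
  functions of class \<open>C\<^sup>k\<close>.\<close>

lemma Ck_on_bilinear: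
  assumes "open S" "bounded_bilinear prd"
  shows "Ck_on k S f \<Longrightarrow> Ck_on k S g \<Longrightarrow> Ck_on k S (\<lambda>x. prd (f x) (g x))"
proof (induction k arbitrary: f g)
  case 0
  then show ?case using assms(2) by (auto intro: bounded_bilinear.continuous_on)
next
  case (Suc k)
  show ?case
  proof (rule Ck_on_SucI[OF assms(1)])
    show "((\<lambda>x. prd (f x) (g x)) has_derivative
        (\<lambda>v. prd (f x) (frechet_derivative g (at x) v) + prd (frechet_derivative f (at x) v) (g x))) (at x)"
      if "x \<in> S" for x
      by (rule bounded_bilinear.FDERIV[OF assms(2) Suc.prems(1)[THEN Ck_on_has_derivative, OF that]
            Suc.prems(2)[THEN Ck_on_has_derivative, OF that]])
    show "Ck_on k S (\<lambda>x. prd (f x) (frechet_derivative g (at x) v) + prd (frechet_derivative f (at x) v) (g x))" for v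
      using Suc.prems Ck_on_SucD[OF Suc.prems(1)] Ck_on_SucD[OF Suc.prems(2)]
      by (intro Ck_on_add[OF assms(1)] Suc.IH) simp_all
  qed
qed

lemma Ck_on_sum:
  assumes "open S" "\<And>i. i \<in> I \<Longrightarrow> Ck_on k S (f i)"
  shows "Ck_on k S (\<lambda>x. \<Sum>i\<in>I. f i x)"
  using assms(2)
  by (induction I rule: infinite_finite_induct) (auto intro: Ck_on_const Ck_on_add[OF assms(1)])

lemma Ck_on_prod:
  fixes f :: "'i \<Rightarrow> 'a::euclidean_space \<Rightarrow> real"
  assumes "open S" "\<And>i. i \<in> I \<Longrightarrow> Ck_on k S (f i)"
  shows "Ck_on k S (\<lambda>x. \<Prod>i\<in>I. f i x)"
  using assms(2)
  by (induction I rule: infinite_finite_induct)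
    (auto intro: Ck_on_const Ck_on_bilinear[OF assms(1) bounded_bilinear_mult])

text \<open>The derivative of \<open>1/f\<close> is \<open>- f' / f\<^sup>2\<close>, in which \<open>1/f\<close> is of class \<open>C\<^sup>k\<close> by the induction hypothesis.\<close>

lemma Ck_on_inverse:
  fixes f :: "'a::euclidean_space \<Rightarrow> real"
  assumes "open S" "\<And>x. x \<in> S \<Longrightarrow> f x \<noteq> 0"
  shows "Ck_on k S f \<Longrightarrow> Ck_on k S (\<lambda>x. inverse (f x))"
proof (induction k)
  case 0
  then show ?case using assms(2) by (auto intro: continuous_on_inverse)
next
  case (Suc k)
  show ?case
  proof (rule Ck_on_SucI[OF assms(1)])
    show "((\<lambda>x. inverse (f x)) has_derivative
        (\<lambda>v. - (inverse (f x) * frechet_derivative f (at x) v * inverse (f x)))) (at x)"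
      if "x \<in> S" for x
      by (rule Deriv.has_derivative_inverse[OF assms(2)[OF that] Ck_on_has_derivative[OF Suc.prems that]])
    have inv: "Ck_on k S (\<lambda>x. inverse (f x))" by (rule Suc.IH[OF Ck_on_SucD[OF Suc.prems]])
    have "Ck_on k S (\<lambda>x. frechet_derivative f (at x) v)" for v using Suc.prems by simp
    then show "Ck_on k S (\<lambda>x. - (inverse (f x) * frechet_derivative f (at x) v * inverse (f x)))" for v
      by (intro Ck_on_bounded_linear[OF assms(1) bounded_linear_minus[OF bounded_linear_ident]]
          Ck_on_bilinear[OF assms(1) bounded_bilinear_mult] inv)
  qed
qed

text \<open>Expanding the inner derivative in a basis writes the derivative of the composite as a sum of
  products of a component of \<open>Df\<close> and a fixed directional derivative of \<open>g\<close> composed with \<open>f\<close>; the induction hypothesis,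
  applied to that directional derivative, and the product rule conclude.\<close>

lemma Ck_on_compose:
  fixes f :: "'a::euclidean_space \<Rightarrow> 'b::euclidean_space"
  assumes "open S" "open U" "f ` S \<subseteq> U"
  shows "Ck_on k S f \<Longrightarrow> Ck_on k U g \<Longrightarrow> Ck_on k S (\<lambda>x. g (f x))"
proof (induction k arbitrary: g)
  case 0
  then show ?case using assms(3) by (auto intro: continuous_on_compose2)
next
  case (Suc k)
  let ?D = "\<lambda>x v. \<Sum>b\<in>Basis. (frechet_derivative f (at x) v \<bullet> b) *\<^sub>R frechet_derivative g (at (f x)) b"
  show ?case
  proof (rule Ck_on_SucI[OF assms(1)])
    show "((\<lambda>x. g (f x)) has_derivative ?D x) (at x)" if "x \<in> S" for x
    proof -
      have f: "(f has_derivative frechet_derivative f (at x)) (at x)"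
        using Ck_on_has_derivative[OF Suc.prems(1) that] .
      have g: "(g has_derivative frechet_derivative g (at (f x))) (at (f x))"
        using Ck_on_has_derivative[OF Suc.prems(2)] that assms(3) by blast
      have lin: "linear (frechet_derivative g (at (f x)))" using g has_derivative_linear by blast
      have expand: "frechet_derivative g (at (f x)) w = (\<Sum>b\<in>Basis. (w \<bullet> b) *\<^sub>R frechet_derivative g (at (f x)) b)" for w
        using linear_sum[OF lin, of "\<lambda>b. (w \<bullet> b) *\<^sub>R b" Basis]
        by (simp add: euclidean_representation linear_scale[OF lin])
      have "frechet_derivative g (at (f x)) \<circ> frechet_derivative f (at x) = ?D x"
        by (rule ext) (simp only: o_def expand[of "frechet_derivative f (at x) _"])
      then show ?thesis using diff_chain_at[OF f g] by (simp only: o_def)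
    qed
    show "Ck_on k S (\<lambda>x. ?D x v)" for v
    proof (intro Ck_on_sum[OF assms(1)] Ck_on_bilinear[OF assms(1) bounded_bilinear_scaleR])
      fix b :: 'b
      show "Ck_on k S (\<lambda>x. frechet_derivative f (at x) v \<bullet> b)"
        by (rule Ck_on_bounded_linear[OF assms(1) bounded_linear_inner_left]) (use Suc.prems in auto)
      show "Ck_on k S (\<lambda>x. frechet_derivative g (at (f x)) b)"
        using Suc.IH[of "\<lambda>y. frechet_derivative g (at y) b"] Suc.prems Ck_on_SucD[OF Suc.prems(1)] by simp
    qed
  qed
qed

lemma smooth_on_cong:
  assumes "open S" "\<And>x. x \<in> S \<Longrightarrow> f x = g x"
  shows "smooth_on S f = smooth_on S g"
  using Ck_on_cong[OF assms] by (simp add: smooth_on_def)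

lemma smooth_on_const: "smooth_on S (\<lambda>x. c)"
  by (simp add: smooth_on_def Ck_on_const)

lemma smooth_on_linear_fun:
  assumes "open S" "bounded_linear L"
  shows "smooth_on S L"
  using Ck_on_bounded_linear[OF assms Ck_on_id[OF assms(1)]] by (simp add: smooth_on_def)

lemma smooth_on_bounded_linear:
  "open S \<Longrightarrow> bounded_linear L \<Longrightarrow> smooth_on S f \<Longrightarrow> smooth_on S (\<lambda>x. L (f x))"
  by (simp add: smooth_on_def Ck_on_bounded_linear)

lemma smooth_on_add:
  "open S \<Longrightarrow> smooth_on S f \<Longrightarrow> smooth_on S g \<Longrightarrow> smooth_on S (\<lambda>x. f x + g x)"
  by (simp add: smooth_on_def Ck_on_add)

lemma smooth_on_mult:
  fixes f g :: "'a::euclidean_space \<Rightarrow> real"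
  shows "open S \<Longrightarrow> smooth_on S f \<Longrightarrow> smooth_on S g \<Longrightarrow> smooth_on S (\<lambda>x. f x * g x)"
  by (simp add: smooth_on_def Ck_on_bilinear[OF _ bounded_bilinear_mult])

lemma smooth_on_scaleR:
  fixes f :: "'a::euclidean_space \<Rightarrow> real"
  shows "open S \<Longrightarrow> smooth_on S f \<Longrightarrow> smooth_on S g \<Longrightarrow> smooth_on S (\<lambda>x. f x *\<^sub>R g x)"
  by (simp add: smooth_on_def Ck_on_bilinear[OF _ bounded_bilinear_scaleR])

lemma smooth_on_sum:
  "open S \<Longrightarrow> (\<And>i. i \<in> I \<Longrightarrow> smooth_on S (f i)) \<Longrightarrow> smooth_on S (\<lambda>x. \<Sum>i\<in>I. f i x)"
  by (simp add: smooth_on_def Ck_on_sum)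

lemma smooth_on_prod:
  fixes f :: "'i \<Rightarrow> 'a::euclidean_space \<Rightarrow> real"
  shows "open S \<Longrightarrow> (\<And>i. i \<in> I \<Longrightarrow> smooth_on S (f i)) \<Longrightarrow> smooth_on S (\<lambda>x. \<Prod>i\<in>I. f i x)"
  by (simp add: smooth_on_def Ck_on_prod)

lemma smooth_on_inverse:
  fixes f :: "'a::euclidean_space \<Rightarrow> real"
  shows "open S \<Longrightarrow> (\<And>x. x \<in> S \<Longrightarrow> f x \<noteq> 0) \<Longrightarrow> smooth_on S f \<Longrightarrow> smooth_on S (\<lambda>x. inverse (f x))"
  by (simp add: smooth_on_def Ck_on_inverse)

lemma smooth_on_compose:
  fixes f :: "'a::euclidean_space \<Rightarrow> 'b::euclidean_space"
  shows "open S \<Longrightarrow> open U \<Longrightarrow> f ` S \<subseteq> U \<Longrightarrow> smooth_on S f \<Longrightarrow> smooth_on U g \<Longrightarrow> smooth_on S (\<lambda>x. g (f x))"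
  unfolding smooth_on_def using Ck_on_compose by blast

lemma smooth_on_differentiable: "smooth_on S f \<Longrightarrow> x \<in> S \<Longrightarrow> f differentiable (at x)"
  unfolding smooth_on_def by (metis Ck_on.simps(2))

lemma smooth_on_frechet: "smooth_on S f \<Longrightarrow> smooth_on S (\<lambda>x. frechet_derivative f (at x) v)"
  unfolding smooth_on_def by (metis Ck_on.simps(2))

lemma smooth_on_continuous: "smooth_on S f \<Longrightarrow> continuous_on S f"
  unfolding smooth_on_def by (metis Ck_on.simps(1))

text \<open>The mean value theorem, once in the direction \<open>u\<close> and once in the direction \<open>v\<close>, turns the second
  difference over a parallelogram of side \<open>h\<close> into a second derivative at a point of the parallelogram.\<close>

lemma second_difference_mvt:
  fixes f :: "'a::euclidean_space \<Rightarrow> real"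
  assumes f: "smooth_on S f" and h: "0 < h"
    and box: "\<And>s t. 0 \<le> s \<Longrightarrow> s \<le> h \<Longrightarrow> 0 \<le> t \<Longrightarrow> t \<le> h \<Longrightarrow> x + s *\<^sub>R u + t *\<^sub>R v \<in> S"
  shows "\<exists>s t. 0 < s \<and> s < h \<and> 0 < t \<and> t < h \<and>
    f (x + h *\<^sub>R u + h *\<^sub>R v) - f (x + h *\<^sub>R u) - f (x + h *\<^sub>R v) + f x =
    h * h * frechet_derivative (\<lambda>y. frechet_derivative f (at y) u) (at (x + s *\<^sub>R u + t *\<^sub>R v)) v"
proof -
  define F where "F = (\<lambda>s. f (x + s *\<^sub>R u + h *\<^sub>R v) - f (x + s *\<^sub>R u))"
  define D where "D = (\<lambda>y. frechet_derivative f (at y) u)"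
  have lin: "frechet_derivative f (at y) (r *\<^sub>R u) = r * D y" if "y \<in> S" for y r
    using linear_scale[OF linear_frechet_derivative[OF smooth_on_differentiable[OF f that]]]
    by (simp add: D_def)
  have df: "(f has_derivative frechet_derivative f (at y)) (at y)" if "y \<in> S" for y
    using smooth_on_differentiable[OF f that] frechet_derivative_works by blast
  have 1: "((\<lambda>s. f (x + s *\<^sub>R u + t *\<^sub>R v)) has_real_derivative D (x + s *\<^sub>R u + t *\<^sub>R v)) (at s)"
    if "0 \<le> s" "s \<le> h" "0 \<le> t" "t \<le> h" for s t
  proof -
    have "((\<lambda>s. x + s *\<^sub>R u + t *\<^sub>R v) has_derivative (\<lambda>r. r *\<^sub>R u)) (at s)"
      by (auto intro!: derivative_eq_intros)
    from diff_chain_at[OF this df[OF box[OF that]]]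
    show ?thesis unfolding has_field_derivative_def
      by (simp add: o_def lin[OF box[OF that]] mult_commute_abs)
  qed
  have 2: "((\<lambda>t. D (x + s *\<^sub>R u + t *\<^sub>R v)) has_real_derivative
      frechet_derivative D (at (x + s *\<^sub>R u + t *\<^sub>R v)) v) (at t)"
    if "0 \<le> s" "s \<le> h" "0 \<le> t" "t \<le> h" for s t
  proof -
    have dD: "D differentiable (at (x + s *\<^sub>R u + t *\<^sub>R v))"
      unfolding D_def by (rule smooth_on_differentiable[OF smooth_on_frechet[OF f] box[OF that]])
    have "((\<lambda>t. x + s *\<^sub>R u + t *\<^sub>R v) has_derivative (\<lambda>r. r *\<^sub>R v)) (at t)"
      by (auto intro!: derivative_eq_intros)
    from diff_chain_at[OF this dD[unfolded frechet_derivative_works]]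
    show ?thesis unfolding has_field_derivative_def
      by (simp add: o_def linear_scale[OF linear_frechet_derivative[OF dD]] mult_commute_abs)
  qed
  have "\<exists>s. 0 < s \<and> s < h \<and> F h - F 0 = (h - 0) * (D (x + s *\<^sub>R u + h *\<^sub>R v) - D (x + s *\<^sub>R u))"
    unfolding F_def
    by (rule MVT2[OF h]) (use 1[of _ h] 1[of _ 0] h in \<open>auto intro: DERIV_diff\<close>)
  then obtain s where s: "0 < s" "s < h" "F h - F 0 = h * (D (x + s *\<^sub>R u + h *\<^sub>R v) - D (x + s *\<^sub>R u))"
    by auto
  have "\<exists>t. 0 < t \<and> t < h \<and> D (x + s *\<^sub>R u + h *\<^sub>R v) - D (x + s *\<^sub>R u + 0 *\<^sub>R v) =
      (h - 0) * frechet_derivative D (at (x + s *\<^sub>R u + t *\<^sub>R v)) v"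
    by (rule MVT2[OF h]) (use 2[of s] s h in auto)
  then obtain t where "0 < t" "t < h" "D (x + s *\<^sub>R u + h *\<^sub>R v) - D (x + s *\<^sub>R u) =
      h * frechet_derivative D (at (x + s *\<^sub>R u + t *\<^sub>R v)) v" by auto
  then show ?thesis using s unfolding F_def D_def
    by (intro exI[of _ s] exI[of _ t]) (simp add: algebra_simps)
qed

text \<open>Schwarz's theorem. The second difference is symmetric in the two directions, so both mixed second
  derivatives take a common value arbitrarily near \<open>x\<close>; they are continuous.\<close>

lemma second_derivative_symmetric:
  fixes f :: "'a::euclidean_space \<Rightarrow> real"
  assumes S: "open S" and f: "smooth_on S f" and x: "x \<in> S"
  shows "frechet_derivative (\<lambda>y. frechet_derivative f (at y) u) (at x) v =
         frechet_derivative (\<lambda>y. frechet_derivative f (at y) v) (at x) u"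
proof -
  define P where "P = (\<lambda>u v y. frechet_derivative (\<lambda>y. frechet_derivative f (at y) u) (at y) v)"
  have cont: "isCont (P u v) x" for u v
    using smooth_on_continuous[OF smooth_on_frechet[OF smooth_on_frechet[OF f]], of u v] S x
    unfolding P_def by (simp add: continuous_on_eq_continuous_at)
  have small: "\<exists>y z. P u v y = P v u z \<and> dist y x < e \<and> dist z x < e" if "0 < e" for e
  proof -
    obtain d where d: "0 < d" "ball x d \<subseteq> S" using S x open_contains_ball by blast
    \<comment> \<open>The summand \<open>1\<close> only keeps \<open>K\<close> positive when both directions vanish.\<close>
    define K where "K = norm u + norm v + 1"
    have K: "K > 0" unfolding K_def by (smt (verit) norm_ge_zero)
    define h where "h = min d e / (2 * K)"
    have h: "0 < h" using d that K unfolding h_def by simp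
    have hK: "h * K < min d e" using d that K unfolding h_def by (simp add: field_simps min_def)
    have near: "dist (x + s *\<^sub>R a + t *\<^sub>R b) x < min d e"
      if "0 \<le> s" "s \<le> h" "0 \<le> t" "t \<le> h" "norm a + norm b + 1 = K" for s t a b
    proof -
      have "dist (x + s *\<^sub>R a + t *\<^sub>R b) x \<le> norm (s *\<^sub>R a) + norm (t *\<^sub>R b)"
        unfolding dist_norm using norm_triangle_ineq[of "s *\<^sub>R a" "t *\<^sub>R b"] by (simp add: algebra_simps)
      also have "\<dots> \<le> h * norm a + h * norm b"
        using that by (intro add_mono) (auto intro: mult_right_mono)
      also have "\<dots> \<le> h * K" using that(5) h by (simp add: distrib_left[symmetric])
      finally show ?thesis using hK by simp
    qed
    have inS: "x + s *\<^sub>R a + t *\<^sub>R b \<in> S"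
      if "0 \<le> s" "s \<le> h" "0 \<le> t" "t \<le> h" "norm a + norm b + 1 = K" for s t a b
      using near[OF that] d(2) by (auto simp: dist_commute)
    have Kuv: "norm u + norm v + 1 = K" "norm v + norm u + 1 = K" by (auto simp: K_def)
    obtain s t where st: "0 < s" "s < h" "0 < t" "t < h"
      "f (x + h *\<^sub>R u + h *\<^sub>R v) - f (x + h *\<^sub>R u) - f (x + h *\<^sub>R v) + f x = h * h * P u v (x + s *\<^sub>R u + t *\<^sub>R v)"
      using second_difference_mvt[OF f h inS[OF _ _ _ _ Kuv(1)]] unfolding P_def by blast
    obtain s' t' where st': "0 < s'" "s' < h" "0 < t'" "t' < h"
      "f (x + h *\<^sub>R v + h *\<^sub>R u) - f (x + h *\<^sub>R v) - f (x + h *\<^sub>R u) + f x = h * h * P v u (x + s' *\<^sub>R v + t' *\<^sub>R u)"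
      using second_difference_mvt[OF f h inS[OF _ _ _ _ Kuv(2)]] unfolding P_def by blast
    have swap: "x + h *\<^sub>R v + h *\<^sub>R u = x + h *\<^sub>R u + h *\<^sub>R v" by (simp add: algebra_simps)
    have "h * h * P u v (x + s *\<^sub>R u + t *\<^sub>R v) = h * h * P v u (x + s' *\<^sub>R v + t' *\<^sub>R u)"
      using st(5) st'(5)[unfolded swap] by linarith
    then have "P u v (x + s *\<^sub>R u + t *\<^sub>R v) = P v u (x + s' *\<^sub>R v + t' *\<^sub>R u)" using h by simp
    moreover have "dist (x + s *\<^sub>R u + t *\<^sub>R v) x < e" using near[of s t u v] st Kuv by simp
    moreover have "dist (x + s' *\<^sub>R v + t' *\<^sub>R u) x < e" using near[of s' t' v u] st' Kuv by simp
    ultimately show ?thesis by blast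
  qed
  have "\<bar>P u v x - P v u x\<bar> < e" if e: "0 < e" for e
  proof -
    obtain d1 where d1: "0 < d1" "\<And>y. dist y x < d1 \<Longrightarrow> dist (P u v y) (P u v x) < e / 2"
      using cont[of u v] e unfolding continuous_at_eps_delta by (meson half_gt_zero)
    obtain d2 where d2: "0 < d2" "\<And>y. dist y x < d2 \<Longrightarrow> dist (P v u y) (P v u x) < e / 2"
      using cont[of v u] e unfolding continuous_at_eps_delta by (meson half_gt_zero)
    obtain y z where yz: "P u v y = P v u z" "dist y x < min d1 d2" "dist z x < min d1 d2"
      using small[of "min d1 d2"] d1(1) d2(1) by auto
    have "\<bar>P u v y - P u v x\<bar> < e / 2" "\<bar>P v u z - P v u x\<bar> < e / 2"
      using d1(2)[of y] d2(2)[of z] yz by (auto simp: dist_real_def)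
    then show ?thesis using yz(1) by linarith
  qed
  then have "P u v x = P v u x" by (metis abs_le_zero_iff less_irrefl not_less right_minus_eq)
  then show ?thesis unfolding P_def .
qed

section \<open>Matrices and linear maps\<close>

lemma matrix_inv_inverse:
  fixes m :: "real^'n^'n"
  assumes "invertible m"
  shows "m ** matrix_inv m = mat 1" "matrix_inv m ** m = mat 1"
  using assms someI_ex[of "\<lambda>m'. m ** m' = mat 1 \<and> m' ** m = mat 1"]
  unfolding invertible_def matrix_inv_def by blast+

text \<open>By Cramer's rule an entry of the inverse is a quotient of two determinants, which are polynomials in
  the entries.\<close>

lemma smooth_on_matrix_inv:
  fixes g :: "'a::euclidean_space \<Rightarrow> real^'n^'n"
  assumes S: "open S" and inv: "\<And>x. x \<in> S \<Longrightarrow> invertible (g x)"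
    and g: "\<And>i j. smooth_on S (\<lambda>x. g x $ i $ j)"
  shows "smooth_on S (\<lambda>x. matrix_inv (g x) $ j $ k)"
proof -
  have smooth_det: "smooth_on S (\<lambda>x. det (m x :: real^'n^'n))" if "\<And>i j. smooth_on S (\<lambda>x. m x $ i $ j)" for m
    unfolding det_def
    by (intro smooth_on_sum smooth_on_mult smooth_on_prod S smooth_on_const that)
  let ?m = "\<lambda>x. \<chi> p q. if q = j then axis k 1 $ p else g x $ p $ q"
  have eq: "matrix_inv (g x) $ j $ k = det (?m x) * inverse (det (g x))" if "x \<in> S" for x
  proof -
    have d: "det (g x) \<noteq> 0" using inv[OF that] invertible_det_nz by blast
    have "g x *v (matrix_inv (g x) *v axis k 1) = axis k 1"
      using matrix_inv_inverse[OF inv[OF that]] by (simp add: matrix_vector_mul_assoc)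
    then have "matrix_inv (g x) *v axis k 1 = (\<chi> l. det (\<chi> p q. if q = l then axis k 1 $ p else g x $ p $ q) / det (g x))"
      using cramer[OF d] by blast
    then have "(matrix_inv (g x) *v axis k 1) $ j = det (?m x) / det (g x)" by simp
    then show ?thesis by (simp add: matrix_vector_mult_basis column_def divide_inverse)
  qed
  have "smooth_on S (\<lambda>x. det (?m x) * inverse (det (g x)))"
  proof (intro smooth_on_mult[OF S] smooth_det smooth_on_inverse[OF S] g)
    show "smooth_on S (\<lambda>x. ?m x $ p $ q)" for p q
      using g[of p q] by (cases "q = j") (simp_all add: smooth_on_const)
    show "det (g x) \<noteq> 0" if "x \<in> S" for x using inv[OF that] invertible_det_nz by blast
  qed
  then show ?thesis by (subst smooth_on_cong[OF S eq])
qed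

lemma matrix_inv_unique_left:
  fixes m k :: "real^'n^'n"
  assumes "m ** k = mat 1"
  shows "matrix_inv m = k"
proof -
  have "k ** m = mat 1" using assms matrix_left_right_inverse by blast
  then have "invertible m" using assms unfolding invertible_def by blast
  then have "matrix_inv m ** m = mat 1" by (rule matrix_inv_inverse)
  then have "matrix_inv m ** (m ** k) = k" by (simp add: matrix_mul_assoc)
  then show ?thesis using assms by simp
qed

lemma transpose_inverse:
  fixes X Y :: "real^'n^'n"
  assumes "X ** Y = mat 1"
  shows "transpose Y ** transpose X = mat 1"
  using arg_cong[OF assms, of transpose] by (simp add: matrix_transpose_mul transpose_mat)

lemma matrix_entry: "m $ i $ j = axis i 1 \<bullet> (m *v axis j (1::real))"
  by (simp add: inner_axis' matrix_vector_mult_basis column_def)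

lemma transpose_mult_component:
  fixes X :: "real^'k^'n" and Z :: "real^'m^'n"
  shows "(transpose X ** Z) $ j $ l = (\<Sum>k\<in>UNIV. X $ k $ j * Z $ k $ l)"
  by (simp add: matrix_matrix_mult_def transpose_def)

lemma matrix_mult_lincomb:
  fixes Y :: "real^'k^'n" and J K :: "real^'m^'k" and Z :: "real^'l^'m"
  shows "Y ** (a *\<^sub>R J + b *\<^sub>R K) ** Z = a *\<^sub>R (Y ** J ** Z) + b *\<^sub>R (Y ** K ** Z)"
proof -
  have "Y ** (a *\<^sub>R J + b *\<^sub>R K) = a *\<^sub>R (Y ** J) + b *\<^sub>R (Y ** K)"
    by (simp add: vec_eq_iff matrix_matrix_mult_def sum.distrib sum_distrib_left algebra_simps)
  moreover have "(a *\<^sub>R P + b *\<^sub>R Q) ** Z = a *\<^sub>R (P ** Z) + b *\<^sub>R (Q ** Z)" for P Q :: "real^'m^'n"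
    by (simp add: vec_eq_iff matrix_matrix_mult_def sum.distrib sum_distrib_left algebra_simps)
  ultimately show ?thesis by simp
qed

text \<open>The transformation of the coordinates \<open>p\<close> has this two-sided form; the lemma moves between the
  matrix form and sums over indices.\<close>

lemma sandwich_component:
  fixes X :: "real^'n^'n" and p :: "real^'m^'n" and S :: "real^'m^'m"
  shows "(transpose X ** p ** transpose S) $ j $ b = (\<Sum>k\<in>UNIV. \<Sum>f\<in>UNIV. X $ k $ j * p $ k $ f * S $ b $ f)"
proof -
  have "(transpose X ** p ** transpose S) $ j $ b =
      (\<Sum>f\<in>UNIV. \<Sum>k\<in>UNIV. X $ k $ j * p $ k $ f * S $ b $ f)"
    by (simp add: matrix_matrix_mult_def transpose_def sum_distrib_right)
  also have "\<dots> = (\<Sum>k\<in>UNIV. \<Sum>f\<in>UNIV. X $ k $ j * p $ k $ f * S $ b $ f)" by (rule sum.swap)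
  finally show ?thesis .
qed

lemma linear_axis_expansion:
  fixes u :: "real^'m"
  assumes "linear D"
  shows "D u = (\<Sum>a\<in>UNIV. u $ a *\<^sub>R D (axis a 1))"
proof -
  have "D u = D (\<Sum>a\<in>UNIV. u $ a *\<^sub>R axis a 1)"
    by (simp add: basis_expansion flip: scalar_mult_eq_scaleR)
  also have "\<dots> = (\<Sum>a\<in>UNIV. u $ a *\<^sub>R D (axis a 1))"
    by (simp add: linear_sum[OF assms] linear_scale[OF assms])
  finally show ?thesis .
qed

lemma has_derivative_matrixI:
  fixes f :: "'a::real_normed_vector \<Rightarrow> real^'m^'n"
  assumes "\<And>i j. ((\<lambda>x. f x $ i $ j) has_derivative (\<lambda>h. D h $ i $ j)) (at x)"
  shows "(f has_derivative D) (at x)"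
proof (subst has_derivative_componentwise_within, rule ballI)
  fix b :: "real^'m^'n" assume "b \<in> Basis"
  then obtain i j where "b = axis i (axis j 1)" by (auto simp: Basis_vec_def)
  then show "((\<lambda>x. f x \<bullet> b) has_derivative (\<lambda>x. D x \<bullet> b)) (at x)"
    using assms[of i j] by (simp add: inner_axis)
qed

text \<open>The inner product of matrices is the pairing of \<open>p\<close> with jet coordinates, so this lemma and the next
  one compute how a change of the jet coordinates acts on \<open>p\<close>.\<close>

lemma inner_matrix_mult_left:
  fixes p :: "real^'m^'n" and Y :: "real^'k^'n" and J :: "real^'m^'k"
  shows "p \<bullet> (Y ** J) = (transpose Y ** p) \<bullet> J"
proof -
  have "p \<bullet> (Y ** J) = (\<Sum>i\<in>UNIV. \<Sum>a\<in>UNIV. \<Sum>k\<in>UNIV. p $ i $ a * (Y $ i $ k * J $ k $ a))"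
    by (simp add: inner_vec_def matrix_matrix_mult_def sum_distrib_left)
  also have "\<dots> = (\<Sum>i\<in>UNIV. \<Sum>k\<in>UNIV. \<Sum>a\<in>UNIV. p $ i $ a * (Y $ i $ k * J $ k $ a))"
    by (intro sum.cong refl sum.swap)
  also have "\<dots> = (\<Sum>k\<in>UNIV. \<Sum>i\<in>UNIV. \<Sum>a\<in>UNIV. p $ i $ a * (Y $ i $ k * J $ k $ a))"
    by (rule sum.swap)
  also have "\<dots> = (\<Sum>k\<in>UNIV. \<Sum>a\<in>UNIV. \<Sum>i\<in>UNIV. p $ i $ a * (Y $ i $ k * J $ k $ a))"
    by (intro sum.cong refl sum.swap)
  also have "\<dots> = (transpose Y ** p) \<bullet> J"
    by (simp add: inner_vec_def matrix_matrix_mult_def sum_distrib_left sum_distrib_right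
        transpose_def mult_ac)
  finally show ?thesis .
qed

lemma inner_matrix_mult_right:
  fixes p :: "real^'m^'n" and T :: "real^'m^'k" and J :: "real^'k^'n"
  shows "p \<bullet> (J ** T) = (p ** transpose T) \<bullet> J"
proof -
  have "p \<bullet> (J ** T) = (\<Sum>i\<in>UNIV. \<Sum>a\<in>UNIV. \<Sum>k\<in>UNIV. p $ i $ a * (J $ i $ k * T $ k $ a))"
    by (simp add: inner_vec_def matrix_matrix_mult_def sum_distrib_left)
  also have "\<dots> = (\<Sum>i\<in>UNIV. \<Sum>k\<in>UNIV. \<Sum>a\<in>UNIV. p $ i $ a * (J $ i $ k * T $ k $ a))"
    by (intro sum.cong refl sum.swap)
  also have "\<dots> = (p ** transpose T) \<bullet> J"
    by (simp add: inner_vec_def matrix_matrix_mult_def sum_distrib_left sum_distrib_right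
        transpose_def mult_ac)
  finally show ?thesis .
qed

text \<open>Contracting a matrix of type (0,2) with one of type (2,0) does not depend on the coordinates.\<close>

lemma inner_congruence:
  fixes h P :: "real^'n^'n"
  shows "(Y ** h ** transpose Y) \<bullet> P = h \<bullet> (transpose Y ** P ** Y)"
proof -
  have "(Y ** h ** transpose Y) \<bullet> P = P \<bullet> ((Y ** h) ** transpose Y)" by (rule inner_commute)
  also have "\<dots> = (P ** Y) \<bullet> (Y ** h)" by (simp add: inner_matrix_mult_right transpose_transpose)
  also have "\<dots> = (transpose Y ** (P ** Y)) \<bullet> h" by (rule inner_matrix_mult_left)
  finally show ?thesis by (simp add: inner_commute matrix_mul_assoc)
qed

text \<open>This is where the symmetry of the metric and the symmetry of the second derivatives enter: together
  they make the quadratic correction term the diagonal of a symmetric bilinear form, so that differentiating it produces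
  a factor \<open>2\<close>.\<close>

lemma trace_form_symmetric:
  fixes h :: "real^'n^'n" and H :: "real^'m^'m" and p w :: "real^'m^'n"
  assumes "transpose h = h" "transpose H = H"
  shows "h \<bullet> (p ** H ** transpose w) = h \<bullet> (w ** H ** transpose p)"
proof -
  have tr: "transpose a \<bullet> transpose b = a \<bullet> b" for a b :: "real^'n^'n"
    unfolding inner_vec_def transpose_def by (simp, rule sum.swap)
  have "transpose (p ** H ** transpose w) = w ** H ** transpose p"
    by (simp add: matrix_transpose_mul transpose_transpose assms(2) matrix_mul_assoc)
  then show ?thesis using tr[of h "p ** H ** transpose w"] assms(1) by simp
qed

text \<open>Column \<open>r\<close> of \<open>g\<close>, placed in column \<open>a\<close>: the direction \<open>g\<^sub>i\<^sub>r \<partial>/\<partial>p\<^sub>i\<^sup>a\<close>, in which the contracted semispray is differentiated to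
  give the connection.\<close>

definition column_matrix :: "real^'n^'n \<Rightarrow> 'n \<Rightarrow> 'm \<Rightarrow> real^'m^'n" where
  "column_matrix g r a = (\<chi> l f. g $ l $ r * axis a 1 $ f)"

text \<open>The preimage of the new direction under the coordinate change of \<open>p\<close> is the matrix \<open>W\<close>, which is the
  combination of the old directions expected of a tensor.\<close>

lemma column_matrix_change:
  fixes g X g' :: "real^'n^'n" and R S :: "real^'m^'m" and r :: 'n and q :: 'm
  assumes "g' = transpose X ** g ** X" "S ** R = mat 1"
  defines "W \<equiv> (\<chi> l a. (g ** X) $ l $ r * R $ a $ q)"
  shows "transpose X ** W ** transpose S = column_matrix g' r q"
    and "W = (\<Sum>k\<in>UNIV. \<Sum>a\<in>UNIV. (X $ k $ r * R $ a $ q) *\<^sub>R column_matrix g k a)"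
proof -
  have "(transpose X ** W ** transpose S) $ j $ b = column_matrix g' r q $ j $ b" for j b
  proof -
    have "(transpose X ** W ** transpose S) $ j $ b =
        (\<Sum>k\<in>UNIV. \<Sum>f\<in>UNIV. (X $ k $ j * (g ** X) $ k $ r) * (S $ b $ f * R $ f $ q))"
      unfolding sandwich_component by (simp add: W_def mult_ac)
    also have "\<dots> = (\<Sum>k\<in>UNIV. X $ k $ j * (g ** X) $ k $ r) * (\<Sum>f\<in>UNIV. S $ b $ f * R $ f $ q)"
      by (rule sum_product[symmetric])
    also have "(\<Sum>k\<in>UNIV. X $ k $ j * (g ** X) $ k $ r) = g' $ j $ r"
      unfolding assms(1) matrix_mul_assoc[symmetric]
      by (rule transpose_mult_component[symmetric])
    also have "(\<Sum>f\<in>UNIV. S $ b $ f * R $ f $ q) = (S ** R) $ b $ q"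
      by (simp add: matrix_matrix_mult_def)
    finally show ?thesis by (simp add: assms(2) column_matrix_def mat_def axis_def)
  qed
  then show "transpose X ** W ** transpose S = column_matrix g' r q" by (simp add: vec_eq_iff)
  have "W $ l $ f = (\<Sum>k\<in>UNIV. \<Sum>a\<in>UNIV. (X $ k $ r * R $ a $ q) * column_matrix g k a $ l $ f)" for l f
  proof -
    have "(\<Sum>a\<in>UNIV. (X $ k $ r * R $ a $ q) * column_matrix g k a $ l $ f) = g $ l $ k * X $ k $ r * R $ f $ q" for k
      by (simp add: column_matrix_def axis_def mult_delta_right)
    then show ?thesis
      by (simp add: W_def matrix_matrix_mult_def sum_distrib_right)
  qed
  then show "W = (\<Sum>k\<in>UNIV. \<Sum>a\<in>UNIV. (X $ k $ r * R $ a $ q) *\<^sub>R column_matrix g k a)"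
    by (simp add: vec_eq_iff)
qed

section \<open>Charts and tangent vectors\<close>

text \<open>What the calculus of tangent vectors needs. The charts of a manifold satisfy it, and so do the induced
  charts of the dual jet bundle, for which no topology is given.\<close>

definition diff_atlas :: "('a, 'e::euclidean_space) chart set \<Rightarrow> bool" where
  "diff_atlas E \<longleftrightarrow> (\<forall>c\<in>E. inj_on (crd c) (cdom c)) \<and>
     (\<forall>c\<in>E. \<forall>d\<in>E. open (crd c ` (cdom c \<inter> cdom d)) \<and>
        (\<forall>x\<in>cdom c \<inter> cdom d. (crd d \<circ> cinv c) differentiable (at (crd c x))))"

lemma cinv_crd: "inj_on (crd c) (cdom c) \<Longrightarrow> x \<in> cdom c \<Longrightarrow> cinv c (crd c x) = x"
  by (simp add: cinv_def)

lemma crd_cinv: "y \<in> cimg c \<Longrightarrow> crd c (cinv c y) = y"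
  by (simp add: cinv_def cimg_def f_inv_into_f)

lemma cinv_in_cdom: "y \<in> cimg c \<Longrightarrow> cinv c y \<in> cdom c"
  by (simp add: cinv_def cimg_def inv_into_into)

lemma crd_in_cimg: "x \<in> cdom c \<Longrightarrow> crd c x \<in> cimg c"
  by (simp add: cimg_def)

lemma diff_atlas_inj: "diff_atlas E \<Longrightarrow> c \<in> E \<Longrightarrow> inj_on (crd c) (cdom c)"
  by (simp add: diff_atlas_def)

lemma diff_atlas_cinv: "diff_atlas E \<Longrightarrow> c \<in> E \<Longrightarrow> x \<in> cdom c \<Longrightarrow> cinv c (crd c x) = x"
  by (simp add: diff_atlas_inj cinv_crd)

lemma transition_has_derivative:
  assumes "diff_atlas E" "c \<in> E" "d \<in> E" "x \<in> cdom c" "x \<in> cdom d"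
  shows "((crd d \<circ> cinv c) has_derivative pd c (crd d) x) (at (crd c x))"
  using assms frechet_derivative_works unfolding diff_atlas_def pd_def by blast

lemma pd_eqI: "(f \<circ> cinv c has_derivative D) (at (crd c x)) \<Longrightarrow> pd c f x = D"
  unfolding pd_def using frechet_derivative_at by metis

text \<open>The chain rule for \<open>f \<circ> cinv c = (f \<circ> cinv d) \<circ> (crd d \<circ> cinv c)\<close>, an identity that holds on the overlap
  only, which is why the overlap has to be open in coordinates.\<close>

lemma change_chart_has_derivative:
  assumes E: "diff_atlas E" "c \<in> E" "d \<in> E" "x \<in> cdom c" "x \<in> cdom d"
    and f: "(f \<circ> cinv d) differentiable (at (crd d x))"
  shows "((f \<circ> cinv c) has_derivative (\<lambda>w. pd d f x (pd c (crd d) x w))) (at (crd c x))"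
proof -
  have xx: "(crd d \<circ> cinv c) (crd c x) = crd d x"
    using diff_atlas_cinv[OF E(1,2,4)] by simp
  have "((f \<circ> cinv d) has_derivative pd d f x) (at ((crd d \<circ> cinv c) (crd c x)))"
    unfolding xx using f frechet_derivative_works unfolding pd_def by blast
  from diff_chain_at[OF transition_has_derivative[OF E] this]
  have "((f \<circ> cinv d) \<circ> (crd d \<circ> cinv c) has_derivative (\<lambda>w. pd d f x (pd c (crd d) x w))) (at (crd c x))"
    by (simp only: o_def)
  then show ?thesis
  proof (rule has_derivative_transform_within_open)
    show "open (crd c ` (cdom c \<inter> cdom d))" using E unfolding diff_atlas_def by blast
    show "crd c x \<in> crd c ` (cdom c \<inter> cdom d)" using E by blast
    show "(f \<circ> cinv d \<circ> (crd d \<circ> cinv c)) y = (f \<circ> cinv c) y"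
      if "y \<in> crd c ` (cdom c \<inter> cdom d)" for y
      using that by (auto simp: diff_atlas_cinv[OF E(1,2)] diff_atlas_cinv[OF E(1,3)])
  qed
qed

lemma pd_change_chart:
  assumes "diff_atlas E" "c \<in> E" "d \<in> E" "x \<in> cdom c" "x \<in> cdom d"
    and "(f \<circ> cinv d) differentiable (at (crd d x))"
  shows "pd c f x w = pd d f x (pd c (crd d) x w)"
  using pd_eqI[OF change_chart_has_derivative[OF assms]] by simp

lemma transition_differentiable:
  assumes "diff_atlas E" "c \<in> E" "d \<in> E" "x \<in> cdom c" "x \<in> cdom d"
  shows "(crd d \<circ> cinv c) differentiable (at (crd c x))"
  using transition_has_derivative[OF assms] differentiable_def by blast

lemma transition_linear:
  assumes "diff_atlas E" "c \<in> E" "d \<in> E" "x \<in> cdom c" "x \<in> cdom d"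
  shows "linear (pd c (crd d) x)"
  using transition_has_derivative[OF assms] has_derivative_linear by blast

lemma transition_cocycle:
  assumes E: "diff_atlas E" "c \<in> E" "d \<in> E" "e \<in> E" and x: "x \<in> cdom c" "x \<in> cdom d" "x \<in> cdom e"
  shows "pd c (crd e) x w = pd d (crd e) x (pd c (crd d) x w)"
  by (rule pd_change_chart[OF E(1-3) x(1,2) transition_differentiable[OF E(1,3,4) x(2,3)]])

lemma transition_self:
  assumes E: "diff_atlas E" "c \<in> E" "x \<in> cdom c"
  shows "pd c (crd c) x w = w"
proof -
  have "(crd c \<circ> cinv c has_derivative (\<lambda>w. w)) (at (crd c x))"
  proof (rule has_derivative_transform_within_open[OF has_derivative_ident])
    show "open (crd c ` (cdom c \<inter> cdom c))" using E unfolding diff_atlas_def by blast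
    show "crd c x \<in> crd c ` (cdom c \<inter> cdom c)" using E by blast
  qed (use diff_atlas_cinv[OF E(1,2)] in auto)
  then show ?thesis using pd_eqI by metis
qed

lemma coord_vec_at:
  assumes E: "diff_atlas E" "c \<in> E" "x \<in> cdom c"
  shows "coord_vec E c x w c = w"
  using transition_self[OF E, of w] E(2,3) by (simp only: coord_vec_def simp_thms if_True)

text \<open>The compatibility of the entries of a coordinate vector is the cocycle identity.\<close>

lemma coord_vec_tangent:
  assumes E: "diff_atlas E" "c \<in> E" "x \<in> cdom c"
  shows "coord_vec E c x w \<in> tangent_space E x"
proof -
  have val: "coord_vec E c x w d = pd c (crd d) x w" if "d \<in> E" "x \<in> cdom d" for d
    using that by (simp add: coord_vec_def)
  have change: "coord_vec E c x w e = pd d (crd e) x (coord_vec E c x w d)"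
    if "d \<in> E" "e \<in> E" "x \<in> cdom d" "x \<in> cdom e" for d e
    unfolding val[OF that(1,3)] val[OF that(2,4)]
    by (rule transition_cocycle[OF E(1,2) that(1,2) E(3) that(3,4)])
  show ?thesis unfolding tangent_space_def
  proof (intro CollectI conjI ballI allI impI; (elim conjE)?)
    show "coord_vec E c x w e = pd d (crd e) x (coord_vec E c x w d)"
      if "d \<in> E" "e \<in> E" "x \<in> cdom d" "x \<in> cdom e" for d e by (rule change[OF that])
    show "coord_vec E c x w d = 0" if "\<not> (d \<in> E \<and> x \<in> cdom d)" for d
      unfolding coord_vec_def by (rule if_not_P[OF that])
  qed
qed

lemma tangent_eq_coord_vec:
  assumes "v \<in> tangent_space E x" "c \<in> E" "x \<in> cdom c"
  shows "v = coord_vec E c x (v c)"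
proof
  fix d
  show "v d = coord_vec E c x (v c) d"
  proof (cases "d \<in> E \<and> x \<in> cdom d")
    case True
    then have "v d = pd c (crd d) x (v c)" using assms unfolding tangent_space_def by blast
    then show ?thesis unfolding coord_vec_def if_P[OF True] .
  next
    case False
    then have "v d = 0" using assms(1) unfolding tangent_space_def by blast
    then show ?thesis unfolding coord_vec_def if_not_P[OF False] .
  qed
qed

lemma coord_vec_change:
  assumes E: "diff_atlas E" "c \<in> E" "d \<in> E" "x \<in> cdom c" "x \<in> cdom d"
  shows "coord_vec E c x w = coord_vec E d x (pd c (crd d) x w)"
proof -
  have "coord_vec E c x w d = pd c (crd d) x w" using E by (simp add: coord_vec_def)
  from arg_cong[OF this, of "coord_vec E d x"] show ?thesis
    by (rule trans[OF tangent_eq_coord_vec[OF coord_vec_tangent[OF E(1,2,4)] E(3,5)]])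
qed

lemma coord_vec_linear:
  assumes E: "diff_atlas E" "c \<in> E" "x \<in> cdom c"
  shows "linear (\<lambda>w. coord_vec E c x w D)"
proof (cases "D \<in> E \<and> x \<in> cdom D")
  case True
  then have "linear (pd c (crd D) x)" by (intro transition_linear[OF E(1,2) _ E(3)]) simp_all
  then show ?thesis unfolding coord_vec_def if_P[OF True] .
next
  case False
  show ?thesis unfolding coord_vec_def if_not_P[OF False] by (simp add: linear_iff)
qed

section \<open>Atlases of smooth manifolds\<close>

lemma smooth_manifold_chart: "smooth_manifold X A \<Longrightarrow> c \<in> A \<Longrightarrow> chart_on X c"
  by (simp add: smooth_manifold_def)

lemma chart_on_inj: "chart_on X c \<Longrightarrow> inj_on (crd c) (cdom c)"
  unfolding chart_on_def
  by (metis homeomorphic_imp_injective_map openin_subset topspace_subtopology_subset)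

lemma chart_on_open_image:
  assumes "chart_on X c" "openin X W"
  shows "open (crd c ` (cdom c \<inter> W))"
proof -
  have "openin (subtopology X (cdom c)) (cdom c \<inter> W)"
    using assms(2) by (simp add: openin_subtopology_Int2)
  then have "openin (top_of_set (cimg c)) (crd c ` (cdom c \<inter> W))"
    using assms(1) homeomorphic_imp_open_map unfolding chart_on_def open_map_def by blast
  then show ?thesis using assms(1) unfolding chart_on_def by (simp add: openin_open_eq)
qed

lemma chart_overlap_open:
  "smooth_manifold X A \<Longrightarrow> c \<in> A \<Longrightarrow> d \<in> A \<Longrightarrow> open (crd c ` (cdom c \<inter> cdom d))"
  by (meson chart_on_def chart_on_open_image smooth_manifold_chart)

lemma cimg_open: "smooth_manifold X A \<Longrightarrow> c \<in> A \<Longrightarrow> open (cimg c)"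
  using smooth_manifold_chart chart_on_def by blast

lemma transition_smooth:
  "smooth_manifold X A \<Longrightarrow> c \<in> A \<Longrightarrow> d \<in> A \<Longrightarrow>
   smooth_on (crd c ` (cdom c \<inter> cdom d)) (crd d \<circ> cinv c)"
  unfolding smooth_manifold_def compatible_def by blast

lemma smooth_manifold_diff_atlas:
  assumes "smooth_manifold X A"
  shows "diff_atlas A"
  unfolding diff_atlas_def
proof (intro conjI ballI)
  show "inj_on (crd c) (cdom c)" if "c \<in> A" for c
    using chart_on_inj smooth_manifold_chart[OF assms that] by blast
  fix c d assume cd: "c \<in> A" "d \<in> A"
  show "open (crd c ` (cdom c \<inter> cdom d))" by (rule chart_overlap_open[OF assms cd])
  show "crd d \<circ> cinv c differentiable at (crd c x)" if "x \<in> cdom c \<inter> cdom d" for x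
    using smooth_on_differentiable[OF transition_smooth[OF assms cd]] that by blast
qed

subsection \<open>Jacobian matrices of the coordinate changes\<close>

definition cjac :: "('a, real^'n) chart \<Rightarrow> ('a, real^'n) chart \<Rightarrow> 'a \<Rightarrow> real^'n^'n" where
  "cjac c d x = matrix (pd c (crd d) x)"

lemma cjac_works:
  assumes "diff_atlas A" "c \<in> A" "d \<in> A" "x \<in> cdom c" "x \<in> cdom d"
  shows "cjac c d x *v w = pd c (crd d) x w"
  unfolding cjac_def using transition_linear[OF assms] by (simp add: matrix_works)

lemma cjac_mult:
  assumes "diff_atlas A" "c \<in> A" "d \<in> A" "e \<in> A" "x \<in> cdom c" "x \<in> cdom d" "x \<in> cdom e"
  shows "cjac d e x ** cjac c d x = cjac c e x"
proof -
  have "(cjac d e x ** cjac c d x) *v w = cjac c e x *v w" for w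
    unfolding matrix_vector_mul_assoc[symmetric] cjac_works[OF assms(1-3,5,6)]
      cjac_works[OF assms(1,3,4,6,7)] cjac_works[OF assms(1,2,4,5,7)] transition_cocycle[OF assms] ..
  then show ?thesis by (simp add: matrix_eq)
qed

lemma cjac_inverse:
  assumes "diff_atlas A" "c \<in> A" "d \<in> A" "x \<in> cdom c" "x \<in> cdom d"
  shows "cjac d c x ** cjac c d x = mat 1"
proof -
  have "cjac c c x *v w = w" for w
    using assms by (simp add: cjac_works[of A] transition_self)
  then have "cjac c c x = mat 1" by (simp add: matrix_eq)
  then show ?thesis using cjac_mult[of A c d c x] assms by simp
qed

lemma pd_component:
  fixes f :: "'a \<Rightarrow> real^'n"
  assumes "(f \<circ> cinv c) differentiable (at (crd c x))"
  shows "pd c (\<lambda>s. f s $ i) x w = pd c f x w $ i"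
proof -
  have "((f \<circ> cinv c) has_derivative pd c f x) (at (crd c x))"
    using assms frechet_derivative_works unfolding pd_def by blast
  then have "((\<lambda>y. (f \<circ> cinv c) y $ i) has_derivative (\<lambda>w. pd c f x w $ i)) (at (crd c x))"
    by (rule bounded_linear.has_derivative[OF bounded_linear_vec_nth])
  then have "((\<lambda>s. f s $ i) \<circ> cinv c has_derivative (\<lambda>w. pd c f x w $ i)) (at (crd c x))"
    by (simp only: o_def)
  from pd_eqI[OF this] show ?thesis by simp
qed

lemma cjac_component:
  assumes "diff_atlas A" "c \<in> A" "d \<in> A" "x \<in> cdom c" "x \<in> cdom d"
  shows "pd c (\<lambda>s. crd d s $ i) x (axis j 1) = cjac c d x $ i $ j"
  using pd_component[OF transition_differentiable[OF assms]]
  by (simp add: cjac_def matrix_def)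

subsection \<open>Second derivatives of the coordinate changes\<close>

text \<open>The second derivative by \<open>t\<^sup>a\<close> and \<open>t\<^sup>f\<close> of the new coordinate with index \<open>b\<close>.\<close>

definition hess :: "('a, real^'m) chart \<Rightarrow> ('a, real^'m) chart \<Rightarrow> 'a \<Rightarrow> 'm \<Rightarrow> 'm \<Rightarrow> 'm \<Rightarrow> real" where
  "hess c c' x b a f = frechet_derivative
     (\<lambda>y. frechet_derivative (\<lambda>y. crd c' (cinv c y) $ b) (at y) (axis f 1)) (at (crd c x)) (axis a 1)"

lemma transition_component_smooth:
  assumes "smooth_manifold X A" "c \<in> A" "c' \<in> A"
  shows "smooth_on (crd c ` (cdom c \<inter> cdom c')) (\<lambda>y. crd c' (cinv c y) $ b)"
  using smooth_on_bounded_linear[OF chart_overlap_open[OF assms] bounded_linear_vec_nth transition_smooth[OF assms]]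
  by (simp add: o_def)

lemma hess_sym:
  assumes "smooth_manifold X A" "c \<in> A" "c' \<in> A" "x \<in> cdom c" "x \<in> cdom c'"
  shows "hess c c' x b a f = hess c c' x b f a"
  unfolding hess_def
  by (rule second_derivative_symmetric[OF chart_overlap_open[OF assms(1-3)]
        transition_component_smooth[OF assms(1-3)]]) (use assms(4,5) in blast)

lemma cjac_in_chart:
  assumes "smooth_manifold X A" "c \<in> A" "c' \<in> A" "y \<in> crd c ` (cdom c \<inter> cdom c')"
  shows "cjac c c' (cinv c y) $ b $ f = frechet_derivative (\<lambda>y. crd c' (cinv c y) $ b) (at y) (axis f 1)"
proof -
  note atl = smooth_manifold_diff_atlas[OF assms(1)]
  obtain x where x: "x \<in> cdom c" "x \<in> cdom c'" "y = crd c x" using assms(4) by blast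
  have "cinv c y = x" unfolding x(3) by (rule diff_atlas_cinv[OF atl assms(2) x(1)])
  then show ?thesis
    using cjac_component[OF atl assms(2,3) x(1,2), of b f] unfolding pd_def x(3) by (simp add: o_def)
qed

lemma cjac_has_derivative:
  assumes X: "smooth_manifold X A" "c \<in> A" "c' \<in> A" and x: "x \<in> cdom c" "x \<in> cdom c'"
  shows "((\<lambda>y. cjac c c' (cinv c y) $ b $ f) has_derivative (\<lambda>u. \<Sum>a\<in>UNIV. hess c c' x b a f * u $ a))
    (at (crd c x))"
proof -
  define G where "G = (\<lambda>y. frechet_derivative (\<lambda>y. crd c' (cinv c y) $ b) (at y) (axis f 1))"
  let ?S = "crd c ` (cdom c \<inter> cdom c')"
  have xS: "crd c x \<in> ?S" using x by blast
  have dG: "G differentiable (at (crd c x))" unfolding G_def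
    by (rule smooth_on_differentiable[OF smooth_on_frechet[OF transition_component_smooth[OF X]] xS])
  have "(G has_derivative frechet_derivative G (at (crd c x))) (at (crd c x))"
    using dG frechet_derivative_works by blast
  moreover have "frechet_derivative G (at (crd c x)) = (\<lambda>u. \<Sum>a\<in>UNIV. hess c c' x b a f * u $ a)"
  proof
    fix u
    have "hess c c' x b a f = frechet_derivative G (at (crd c x)) (axis a 1)" for a
      by (simp only: hess_def G_def)
    then show "frechet_derivative G (at (crd c x)) u = (\<Sum>a\<in>UNIV. hess c c' x b a f * u $ a)"
      by (subst linear_axis_expansion[OF linear_frechet_derivative[OF dG]]) (simp add: mult.commute)
  qed
  ultimately have "(G has_derivative (\<lambda>u. \<Sum>a\<in>UNIV. hess c c' x b a f * u $ a)) (at (crd c x))" by simp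
  then show ?thesis
    by (rule has_derivative_transform_within_open[OF _ chart_overlap_open[OF X] xS])
      (simp add: G_def cjac_in_chart[OF X])
qed

text \<open>The factor \<open>\<partial>x/\<partial>x'\<close> is a function of the new coordinates; in the old ones it is a
  composite with the coordinate change.\<close>

lemma inverse_cjac_differentiable:
  assumes X: "smooth_manifold X A" "c \<in> A" "c' \<in> A" and x: "x \<in> cdom c" "x \<in> cdom c'"
  shows "(\<lambda>y. cjac c' c (cinv c y) $ b $ f) differentiable (at (crd c x))"
proof -
  note atl = smooth_manifold_diff_atlas[OF X(1)]
  have xx: "(crd c' \<circ> cinv c) (crd c x) = crd c' x"
    using diff_atlas_cinv[OF atl X(2) x(1)] by simp
  have "(\<lambda>y. cjac c' c (cinv c' y) $ b $ f) differentiable (at ((crd c' \<circ> cinv c) (crd c x)))"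
    unfolding xx using cjac_has_derivative[OF X(1,3,2) x(2,1)] differentiable_def by blast
  from differentiable_chain_at[OF transition_differentiable[OF atl X(2,3) x] this]
  obtain D where "((\<lambda>y. cjac c' c (cinv c' y) $ b $ f) \<circ> (crd c' \<circ> cinv c) has_derivative D) (at (crd c x))"
    unfolding differentiable_def by blast
  then have "((\<lambda>y. cjac c' c (cinv c y) $ b $ f) has_derivative D) (at (crd c x))"
  proof (rule has_derivative_transform_within_open[OF _ chart_overlap_open[OF X]])
    show "crd c x \<in> crd c ` (cdom c \<inter> cdom c')" using x by blast
    fix y assume "y \<in> crd c ` (cdom c \<inter> cdom c')"
    then obtain s where s: "s \<in> cdom c" "s \<in> cdom c'" "y = crd c s" by blast
    show "((\<lambda>y. cjac c' c (cinv c' y) $ b $ f) \<circ> (crd c' \<circ> cinv c)) y = cjac c' c (cinv c y) $ b $ f"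
      by (simp add: s(3) diff_atlas_cinv[OF atl X(2) s(1)] diff_atlas_cinv[OF atl X(3) s(2)])
  qed
  then show ?thesis using differentiable_def by blast
qed

section \<open>Jets and their coordinates\<close>

locale manifold_pair =
  fixes T :: "'t topology" and A :: "('t, real^'m) chart set"
    and M :: "'x topology" and B :: "('x, real^'n) chart set"
  assumes T: "smooth_manifold T A" and M: "smooth_manifold M B"
begin

lemma atl_A: "diff_atlas A" and atl_B: "diff_atlas B"
  using T M smooth_manifold_diff_atlas by blast+

text \<open>Smoothness near \<open>t\<close> is witnessed by a single pair of charts. By continuity \<open>f\<close> stays, near \<open>t\<close>, in the
  overlap of the witnessing chart of the target with any other one, where the chain rule applies.\<close>

lemma smooth_near_chain:
  assumes "smooth_near A B t f"
  obtains c0 d0 K where "c0 \<in> A" "t \<in> cdom c0" "d0 \<in> B" "f t \<in> cdom d0"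
    "\<And>d. d \<in> B \<Longrightarrow> f t \<in> cdom d \<Longrightarrow>
      ((crd d \<circ> f) \<circ> cinv c0 has_derivative (\<lambda>w. pd d0 (crd d) (f t) (K w))) (at (crd c0 t))"
proof -
  obtain c0 d0 W where c: "c0 \<in> A" "t \<in> cdom c0" and d: "d0 \<in> B"
    and W: "open W" "crd c0 t \<in> W" "W \<subseteq> cimg c0" "f ` cinv c0 ` W \<subseteq> cdom d0"
    and sm: "smooth_on W (crd d0 \<circ> f \<circ> cinv c0)"
    using assms unfolding smooth_near_def by blast
  define F where "F = crd d0 \<circ> f \<circ> cinv c0"
  define K where "K = frechet_derivative F (at (crd c0 t))"
  have t: "cinv c0 (crd c0 t) = t" by (rule diff_atlas_cinv[OF atl_A c])
  have ft: "f t \<in> cdom d0" using W(2,4) t by force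
  have Ft: "F (crd c0 t) = crd d0 (f t)" by (simp add: F_def t)
  have K: "(F has_derivative K) (at (crd c0 t))"
    unfolding K_def F_def using smooth_on_differentiable[OF sm W(2)] frechet_derivative_works by blast
  have contF: "continuous_on W F" unfolding F_def by (rule smooth_on_continuous[OF sm])
  have "((crd e \<circ> f) \<circ> cinv c0 has_derivative (\<lambda>w. pd d0 (crd e) (f t) (K w))) (at (crd c0 t))"
    if e: "e \<in> B" "f t \<in> cdom e" for e
  proof -
    \<comment> \<open>Continuity of \<open>F\<close> keeps \<open>f\<close> in the overlap of \<open>d0\<close> and \<open>e\<close> near \<open>t\<close>.\<close>
    define O' where "O' = crd d0 ` (cdom d0 \<inter> cdom e)"
    have "open O'" unfolding O'_def by (rule chart_overlap_open[OF M d e(1)])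
    then have op: "open (F -` O' \<inter> W)" using contF W(1) by (metis continuous_on_open_vimage)
    have "((crd e \<circ> cinv d0) has_derivative pd d0 (crd e) (f t)) (at (F (crd c0 t)))"
      unfolding Ft by (rule transition_has_derivative[OF atl_B d e(1) ft e(2)])
    from diff_chain_at[OF K this]
    have "((crd e \<circ> cinv d0) \<circ> F has_derivative (\<lambda>w. pd d0 (crd e) (f t) (K w))) (at (crd c0 t))"
      by (simp only: o_def)
    then show ?thesis
    proof (rule has_derivative_transform_within_open[OF _ op])
      show "crd c0 t \<in> F -` O' \<inter> W" using W(2) Ft ft e(2) unfolding O'_def by auto
      show "((crd e \<circ> cinv d0) \<circ> F) y = ((crd e \<circ> f) \<circ> cinv c0) y" if "y \<in> F -` O' \<inter> W" for y
      proof -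
        have "f (cinv c0 y) \<in> cdom d0" using that W(4) by blast
        then have "cinv d0 (crd d0 (f (cinv c0 y))) = f (cinv c0 y)"
          by (rule diff_atlas_cinv[OF atl_B d])
        then show ?thesis by (simp add: F_def)
      qed
    qed
  qed
  then show ?thesis using that c d ft by blast
qed

lemma smooth_near_derivative:
  assumes f: "smooth_near A B t f"
    and c: "c \<in> A" "t \<in> cdom c" and d: "d \<in> B" "f t \<in> cdom d"
  shows "(crd d \<circ> f) \<circ> cinv c differentiable (at (crd c t))"
    and "c' \<in> A \<Longrightarrow> t \<in> cdom c' \<Longrightarrow> d' \<in> B \<Longrightarrow> f t \<in> cdom d' \<Longrightarrow>
      pd c' (crd d' \<circ> f) t w = pd d (crd d') (f t) (pd c (crd d \<circ> f) t (pd c' (crd c) t w))"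
proof -
  obtain c0 d0 K where c0: "c0 \<in> A" "t \<in> cdom c0" and d0: "d0 \<in> B" "f t \<in> cdom d0"
    and K: "\<And>d. d \<in> B \<Longrightarrow> f t \<in> cdom d \<Longrightarrow>
      ((crd d \<circ> f) \<circ> cinv c0 has_derivative (\<lambda>w. pd d0 (crd d) (f t) (K w))) (at (crd c0 t))"
    using smooth_near_chain[OF f] by blast
  have D: "((crd e \<circ> f) \<circ> cinv b has_derivative (\<lambda>w. pd d0 (crd e) (f t) (K (pd b (crd c0) t w)))) (at (crd b t))"
    if "b \<in> A" "t \<in> cdom b" "e \<in> B" "f t \<in> cdom e" for b e
  proof -
    have "pd c0 (crd e \<circ> f) t = (\<lambda>w. pd d0 (crd e) (f t) (K w))"
      by (rule pd_eqI[OF K[OF that(3,4)]])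
    with change_chart_has_derivative[OF atl_A that(1) c0(1) that(2) c0(2), of "crd e \<circ> f"]
      K[OF that(3,4)] show ?thesis unfolding differentiable_def by auto
  qed
  show "(crd d \<circ> f) \<circ> cinv c differentiable (at (crd c t))"
    using D[OF c d] differentiable_def by blast
  assume c': "c' \<in> A" "t \<in> cdom c'" and d': "d' \<in> B" "f t \<in> cdom d'"
  have "pd c' (crd d' \<circ> f) t w = pd d0 (crd d') (f t) (K (pd c' (crd c0) t w))"
    by (simp only: pd_eqI[OF D[OF c' d']])
  also have "\<dots> = pd d (crd d') (f t) (pd d0 (crd d) (f t) (K (pd c (crd c0) t (pd c' (crd c) t w))))"
    using transition_cocycle[OF atl_B d0(1) d(1) d'(1) d0(2) d(2) d'(2)]
      transition_cocycle[OF atl_A c'(1) c(1) c0(1) c'(2) c(2) c0(2)] by metis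
  also have "\<dots> = pd d (crd d') (f t) (pd c (crd d \<circ> f) t (pd c' (crd c) t w))"
    by (simp only: pd_eqI[OF D[OF c d]])
  finally show "pd c' (crd d' \<circ> f) t w = \<dots>" .
qed

lemma map_jac_works:
  assumes "smooth_near A B t f" "c \<in> A" "t \<in> cdom c" "d \<in> B" "f t \<in> cdom d"
  shows "map_jac c d t f *v w = pd c (crd d \<circ> f) t w"
proof -
  have diff: "(crd d \<circ> f) \<circ> cinv c differentiable (at (crd c t))"
    by (rule smooth_near_derivative(1)[OF assms])
  have "pd c (\<lambda>s. crd d (f s) $ i) t v = pd c (crd d \<circ> f) t v $ i" for i v
    using pd_component[OF diff] by (simp only: o_def)
  then have "map_jac c d t f = matrix (pd c (crd d \<circ> f) t)"
    by (simp add: map_jac_def matrix_def)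
  moreover have "linear (pd c (crd d \<circ> f) t)"
    unfolding pd_def using linear_frechet_derivative[OF diff] .
  ultimately show ?thesis by (simp add: matrix_works)
qed

lemma map_jac_change:
  assumes f: "smooth_near A B t f"
    and c: "c \<in> A" "t \<in> cdom c" and d: "d \<in> B" "f t \<in> cdom d"
    and c': "c' \<in> A" "t \<in> cdom c'" and d': "d' \<in> B" "f t \<in> cdom d'"
  shows "map_jac c' d' t f = cjac d d' (f t) ** map_jac c d t f ** cjac c' c t"
proof -
  have "map_jac c' d' t f *v w = (cjac d d' (f t) ** map_jac c d t f ** cjac c' c t) *v w" for w
    unfolding matrix_vector_mul_assoc[symmetric] map_jac_works[OF f c d] map_jac_works[OF f c' d']
      cjac_works[OF atl_B d(1) d'(1) d(2) d'(2)] cjac_works[OF atl_A c'(1) c(1) c'(2) c(2)]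
    by (rule smooth_near_derivative(2)[OF f c d c' d'])
  then show ?thesis by (simp add: matrix_eq)
qed

text \<open>A map that is affine in the coordinates has any prescribed value and Jacobian matrix; outside of the
  chart it takes whatever values \<open>cinv\<close> gives.\<close>

lemma exists_map_with_jacobian:
  assumes c: "c \<in> A" "t \<in> cdom c" and d: "d \<in> B" "x \<in> cdom d"
  shows "\<exists>f. smooth_near A B t f \<and> f t = x \<and> map_jac c d t f = J"
proof -
  define L where "L = (\<lambda>y. J *v y + (crd d x - J *v crd c t))"
  define f where "f = (\<lambda>s. cinv d (L (crd c s)))"
  define W where "W = L -` cimg d \<inter> cimg c"
  have contL: "continuous_on S L" for S unfolding L_def by (intro continuous_intros)
  have Lt: "L (crd c t) = crd d x" by (simp add: L_def)
  have ft: "f t = x" unfolding f_def Lt by (rule diff_atlas_cinv[OF atl_B d])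
  have W: "open W" unfolding W_def
    using contL cimg_open[OF T c(1)] cimg_open[OF M d(1)] by (metis continuous_on_open_vimage)
  have tW: "crd c t \<in> W" unfolding W_def using Lt crd_in_cimg[OF c(2)] crd_in_cimg[OF d(2)] by simp
  have F: "(crd d \<circ> f \<circ> cinv c) y = L y" if "y \<in> W" for y
    using that unfolding W_def f_def by (simp add: crd_cinv)
  have "smooth_on W L" unfolding L_def
    by (intro smooth_on_add[OF W] smooth_on_const smooth_on_linear_fun[OF W] matrix_vector_mul_bounded_linear)
  then have "smooth_on W (crd d \<circ> f \<circ> cinv c)" by (subst smooth_on_cong[OF W F])
  moreover have "f ` cinv c ` W \<subseteq> cdom d"
    unfolding f_def W_def by (auto simp: crd_cinv cinv_in_cdom)
  ultimately have near: "smooth_near A B t f"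
    unfolding smooth_near_def using c d W tW unfolding W_def by blast
  have fd: "f t \<in> cdom d" using ft d(2) by simp
  have "(L has_derivative (\<lambda>w. J *v w)) (at (crd c t))"
    unfolding L_def using bounded_linear_imp_has_derivative[OF matrix_vector_mul_bounded_linear[of J]]
    by (auto intro!: derivative_eq_intros)
  then have "((crd d \<circ> f) \<circ> cinv c has_derivative (\<lambda>w. J *v w)) (at (crd c t))"
    by (rule has_derivative_transform_within_open[OF _ W tW]) (simp add: F[symmetric])
  then have "map_jac c d t f *v w = J *v w" for w
    unfolding map_jac_works[OF near c d(1) fd] by (simp add: pd_eqI)
  then have "map_jac c d t f = J" by (simp add: matrix_eq)
  then show ?thesis using near ft by blast
qed

text \<open>A representative picked by choice has the same Jacobian matrices as the given one.\<close>

lemma jet_coord_jet1: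
  assumes "smooth_near A B t f" "c \<in> A" "t \<in> cdom c" "d \<in> B" "f t \<in> cdom d"
  shows "jet_coord c d t (jet1 A B t f) = map_jac c d t f"
proof -
  have "f \<in> jet1 A B t f" using assms(1) unfolding jet1_def by blast
  then have "(SOME g. g \<in> jet1 A B t f) \<in> jet1 A B t f" by (rule someI[where P = "\<lambda>g. g \<in> jet1 A B t f"])
  then show ?thesis using assms unfolding jet_coord_def jet1_def by blast
qed

lemma jet_coord_change:
  assumes j: "j \<in> jet_fibre A B t x"
    and c: "c \<in> A" "t \<in> cdom c" and d: "d \<in> B" "x \<in> cdom d"
    and c': "c' \<in> A" "t \<in> cdom c'" and d': "d' \<in> B" "x \<in> cdom d'"
  shows "jet_coord c' d' t j = cjac d d' x ** jet_coord c d t j ** cjac c' c t"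
proof -
  obtain f where f: "j = jet1 A B t f" "smooth_near A B t f" "f t = x"
    using j unfolding jet_fibre_def by blast
  show ?thesis
    using map_jac_change[OF f(2) c d(1) _ c' d'(1)] jet_coord_jet1[OF f(2) c d(1)]
      jet_coord_jet1[OF f(2) c' d'(1)] d(2) d'(2) unfolding f(1) f(3) by simp
qed

lemma jet_coord_surj:
  assumes c: "c \<in> A" "t \<in> cdom c" and d: "d \<in> B" "x \<in> cdom d"
  obtains j where "j \<in> jet_fibre A B t x" "jet_coord c d t j = J"
proof -
  obtain f where f: "smooth_near A B t f" "f t = x" "map_jac c d t f = J"
    using exists_map_with_jacobian[OF c d] by blast
  have "jet1 A B t f \<in> jet_fibre A B t x" using f(1,2) unfolding jet_fibre_def by blast
  moreover have "jet_coord c d t (jet1 A B t f) = J"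
    using jet_coord_jet1[OF f(1) c d(1)] f(2,3) d(2) by simp
  ultimately show ?thesis using that by blast
qed

text \<open>The coordinates of a jet in different charts are linearly related, so a linear relation in one pair of
  charts holds in all of them.\<close>

lemma jet_lincombI:
  assumes c: "c \<in> A" "t \<in> cdom c" and d: "d \<in> B" "x \<in> cdom d"
    and jkl: "j \<in> jet_fibre A B t x" "k \<in> jet_fibre A B t x" "l \<in> jet_fibre A B t x"
    and eq: "jet_coord c d t l = a *\<^sub>R jet_coord c d t j + b *\<^sub>R jet_coord c d t k"
  shows "jet_lincomb A B t x a j b k l"
  unfolding jet_lincomb_def
proof (intro ballI impI; elim conjE)
  fix c' d' assume c': "c' \<in> A" and d': "d' \<in> B" and tx: "t \<in> cdom c'" "x \<in> cdom d'"
  note ch = jet_coord_change[OF _ c d c' tx(1) d' tx(2)]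
  show "jet_coord c' d' t l = a *\<^sub>R jet_coord c' d' t j + b *\<^sub>R jet_coord c' d' t k"
    unfolding ch[OF jkl(1)] ch[OF jkl(2)] ch[OF jkl(3)] eq
    by (rule matrix_mult_lincomb)
qed

text \<open>Every matrix is the coordinate matrix of some jet, so a functional has at most one coordinate matrix.\<close>

lemma p_coord_unique:
  assumes c: "c \<in> A" "t \<in> cdom c" and d: "d \<in> B" "x \<in> cdom d"
    and q: "\<And>j. j \<in> jet_fibre A B t x \<Longrightarrow> \<omega> j = q \<bullet> jet_coord c d t j"
  shows "p_coord A B c d (t, x, \<omega>) = q"
proof -
  have sum: "(\<Sum>i\<in>UNIV. \<Sum>a\<in>UNIV. p $ i $ a * J $ i $ a) = p \<bullet> J" for p J :: "real^'m^'n"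
    by (simp add: inner_vec_def)
  show ?thesis unfolding p_coord_def prod.case sum
  proof (rule the_equality)
    show "\<forall>j\<in>jet_fibre A B t x. \<omega> j = q \<bullet> jet_coord c d t j" using q by blast
    fix p assume p: "\<forall>j\<in>jet_fibre A B t x. \<omega> j = p \<bullet> jet_coord c d t j"
    have "p \<bullet> J = q \<bullet> J" for J
      using jet_coord_surj[OF c d, of J] p q by metis
    then show "p = q" by (metis vector_eq_rdot)
  qed
qed

text \<open>Choosing a jet for every coordinate matrix turns \<open>\<omega>\<close> into a linear functional on matrices, which is an
  inner product with a fixed matrix.\<close>

lemma dual_fibre_representation:
  assumes c: "c \<in> A" "t \<in> cdom c" and d: "d \<in> B" "x \<in> cdom d"
    and w: "\<omega> \<in> dual_fibre A B t x"
  obtains q where "\<And>j. j \<in> jet_fibre A B t x \<Longrightarrow> \<omega> j = q \<bullet> jet_coord c d t j"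
proof -
  have "\<forall>J. \<exists>j. j \<in> jet_fibre A B t x \<and> jet_coord c d t j = J"
    using jet_coord_surj[OF c d] by metis
  then obtain s where s: "\<And>J. s J \<in> jet_fibre A B t x" "\<And>J. jet_coord c d t (s J) = J" by metis
  \<comment> \<open>With \<open>a = 1\<close> and \<open>b = 0\<close> this also says that \<open>\<omega>\<close> only depends on the coordinates of a jet.\<close>
  have lin: "\<omega> l = a * \<omega> j + b * \<omega> k"
    if "j \<in> jet_fibre A B t x" "k \<in> jet_fibre A B t x" "l \<in> jet_fibre A B t x"
      "jet_coord c d t l = a *\<^sub>R jet_coord c d t j + b *\<^sub>R jet_coord c d t k" for j k l a b
    using w jet_lincombI[OF c d that] that(1-3) unfolding dual_fibre_def by blast
  define F where "F = (\<lambda>J. \<omega> (s J))"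
  have "linear F"
  proof (rule linearI)
    show "F (J + K) = F J + F K" for J K
      using lin[of "s J" "s K" "s (J + K)" 1 1] by (simp add: s F_def)
    show "F (a *\<^sub>R J) = a *\<^sub>R F J" for a J
      using lin[of "s J" "s J" "s (a *\<^sub>R J)" a 0] by (simp add: s F_def)
  qed
  define q where "q = (\<Sum>b\<in>Basis. F b *\<^sub>R b)"
  have "F J = q \<bullet> J" for J
  proof -
    have "F J = F (\<Sum>b\<in>Basis. (J \<bullet> b) *\<^sub>R b)" by (simp add: euclidean_representation)
    also have "\<dots> = (\<Sum>b\<in>Basis. (J \<bullet> b) * F b)"
      by (simp add: linear_sum[OF \<open>linear F\<close>] linear_scale[OF \<open>linear F\<close>])
    finally show ?thesis by (simp add: q_def inner_sum_left inner_commute[of J] mult.commute)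
  qed
  then have "\<omega> j = q \<bullet> jet_coord c d t j" if "j \<in> jet_fibre A B t x" for j
    using lin[of "s (jet_coord c d t j)" "s (jet_coord c d t j)" j 1 0] that
    by (simp add: s F_def)
  then show ?thesis using that by blast
qed

lemma p_coord_works:
  assumes c: "c \<in> A" "t \<in> cdom c" and d: "d \<in> B" "x \<in> cdom d"
    and w: "\<omega> \<in> dual_fibre A B t x" and j: "j \<in> jet_fibre A B t x"
  shows "\<omega> j = p_coord A B c d (t, x, \<omega>) \<bullet> jet_coord c d t j"
proof -
  obtain q where q: "\<And>j. j \<in> jet_fibre A B t x \<Longrightarrow> \<omega> j = q \<bullet> jet_coord c d t j"
    using dual_fibre_representation[OF c d w] by blast
  show ?thesis using q[OF j] p_coord_unique[OF c d q] by simp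
qed

text \<open>The inverse of the coordinate map on a fibre of the dual bundle.\<close>

definition covector :: "('t, real^'m) chart \<Rightarrow> ('x, real^'n) chart \<Rightarrow> 't \<Rightarrow> 'x \<Rightarrow> real^'m^'n
    \<Rightarrow> ('t \<Rightarrow> 'x) set \<Rightarrow> real" where
  "covector c d t x p = restrict (\<lambda>j. p \<bullet> jet_coord c d t j) (jet_fibre A B t x)"

lemma covector_dual_fibre:
  assumes c: "c \<in> A" "t \<in> cdom c" and d: "d \<in> B" "x \<in> cdom d"
  shows "covector c d t x p \<in> dual_fibre A B t x"
  unfolding dual_fibre_def
proof (intro CollectI conjI ballI allI impI)
  show "covector c d t x p \<in> extensional (jet_fibre A B t x)" by (simp add: covector_def)
  fix j k l a b
  assume jkl: "j \<in> jet_fibre A B t x" "k \<in> jet_fibre A B t x" "l \<in> jet_fibre A B t x"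
    and "jet_lincomb A B t x a j b k l"
  then have "jet_coord c d t l = a *\<^sub>R jet_coord c d t j + b *\<^sub>R jet_coord c d t k"
    using c d unfolding jet_lincomb_def by blast
  then show "covector c d t x p l = a * covector c d t x p j + b * covector c d t x p k"
    using jkl by (simp add: covector_def inner_add_right)
qed

lemma p_coord_covector:
  assumes c: "c \<in> A" "t \<in> cdom c" and d: "d \<in> B" "x \<in> cdom d"
  shows "p_coord A B c d (t, x, covector c d t x p) = p"
  by (rule p_coord_unique[OF c d]) (simp add: covector_def)

lemma covector_p_coord:
  assumes c: "c \<in> A" "t \<in> cdom c" and d: "d \<in> B" "x \<in> cdom d"
    and w: "\<omega> \<in> dual_fibre A B t x"
  shows "covector c d t x (p_coord A B c d (t, x, \<omega>)) = \<omega>"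
proof (rule extensionalityI)
  show "covector c d t x (p_coord A B c d (t, x, \<omega>)) \<in> extensional (jet_fibre A B t x)"
    by (simp add: covector_def)
  show "\<omega> \<in> extensional (jet_fibre A B t x)" using w by (simp add: dual_fibre_def)
  show "covector c d t x (p_coord A B c d (t, x, \<omega>)) j = \<omega> j" if "j \<in> jet_fibre A B t x" for j
    using p_coord_works[OF c d w that] that by (simp add: covector_def)
qed

text \<open>The rule \<open>p'\<^sub>i\<^sup>a = (\<partial>x\<^sup>j/\<partial>x'\<^sup>i) (\<partial>t'\<^sup>a/\<partial>t\<^sup>b) p\<^sub>j\<^sup>b\<close>, dual to the rule for jets.\<close>

lemma p_coord_change:
  assumes c: "c \<in> A" "t \<in> cdom c" and d: "d \<in> B" "x \<in> cdom d"
    and c': "c' \<in> A" "t \<in> cdom c'" and d': "d' \<in> B" "x \<in> cdom d'"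
    and w: "\<omega> \<in> dual_fibre A B t x"
  shows "p_coord A B c' d' (t, x, \<omega>) =
    transpose (cjac d' d x) ** p_coord A B c d (t, x, \<omega>) ** transpose (cjac c c' t)"
proof (rule p_coord_unique[OF c' d'])
  fix j assume j: "j \<in> jet_fibre A B t x"
  show "\<omega> j = (transpose (cjac d' d x) ** p_coord A B c d (t, x, \<omega>) ** transpose (cjac c c' t))
      \<bullet> jet_coord c' d' t j"
    unfolding p_coord_works[OF c d w j] jet_coord_change[OF j c' d' c d]
    
    by (subst inner_matrix_mult_right, subst inner_matrix_mult_left) (simp add: matrix_mul_assoc)
qed

end

section \<open>Induced charts\<close>

context manifold_pair
begin

abbreviation IC :: "('t, real^'m) chart \<Rightarrow> ('x, real^'n) chart \<Rightarrow> (('t, 'x) covjet, ('m, 'n) txp) chart"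
  where "IC \<equiv> induced_chart A B"

abbreviation pc :: "('t, real^'m) chart \<Rightarrow> ('x, real^'n) chart \<Rightarrow> ('t, 'x) covjet \<Rightarrow> real^'m^'n"
  where "pc \<equiv> p_coord A B"

abbreviation E :: "(('t, 'x) covjet, ('m, 'n) txp) chart set"
  where "E \<equiv> induced_atlas A B"

definition covjet_at :: "('t, real^'m) chart \<Rightarrow> ('x, real^'n) chart \<Rightarrow> 't \<Rightarrow> 'x \<Rightarrow> real^'m^'n \<Rightarrow> ('t, 'x) covjet"
  where "covjet_at c d t x p = (t, x, covector c d t x p)"

lemma covjet_at_simps [simp]: "fst (covjet_at c d t x p) = t" "fst (snd (covjet_at c d t x p)) = x"
  by (simp_all add: covjet_at_def)

lemma IC_in_E: "c \<in> A \<Longrightarrow> d \<in> B \<Longrightarrow> IC c d \<in> E"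
  unfolding induced_atlas_def by blast

lemma crd_IC: "crd (IC c d) e = (crd c (fst e), crd d (fst (snd e)), pc c d e)"
  by (simp add: induced_chart_def)

lemma cdom_IC: "e \<in> cdom (IC c d) \<longleftrightarrow>
    e \<in> dual_jet_bundle A B \<and> fst e \<in> cdom c \<and> fst (snd e) \<in> cdom d"
  by (simp add: induced_chart_def)

lemma IC_dom:
  assumes "e \<in> cdom (IC c d)"
  shows "fst e \<in> cdom c" "fst (snd e) \<in> cdom d" "snd (snd e) \<in> dual_fibre A B (fst e) (fst (snd e))"
  using assms unfolding cdom_IC dual_jet_bundle_def by auto

lemma covjet_at_in_cdom:
  assumes c: "c \<in> A" "t \<in> cdom c" and d: "d \<in> B" "x \<in> cdom d"
  shows "covjet_at c d t x p \<in> dual_jet_bundle A B" "covjet_at c d t x p \<in> cdom (IC c d)" "pc c d (covjet_at c d t x p) = p"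
  using c d covector_dual_fibre[OF c d] p_coord_covector[OF c d]
  by (auto simp: cdom_IC dual_jet_bundle_def carrier_of_def covjet_at_def)

lemma covjet_at_pc:
  assumes "c \<in> A" "d \<in> B" "e \<in> cdom (IC c d)"
  shows "covjet_at c d (fst e) (fst (snd e)) (pc c d e) = e"
  using covector_p_coord[OF assms(1) IC_dom(1)[OF assms(3)] assms(2) IC_dom(2,3)[OF assms(3)]]
  by (simp add: covjet_at_def)

lemma IC_inj:
  assumes "c \<in> A" "d \<in> B"
  shows "inj_on (crd (IC c d)) (cdom (IC c d))"
proof (rule inj_onI)
  fix e e' assume e: "e \<in> cdom (IC c d)" "e' \<in> cdom (IC c d)" "crd (IC c d) e = crd (IC c d) e'"
  have "fst e = fst e'"
    using diff_atlas_inj[OF atl_A assms(1)] IC_dom(1)[OF e(1)] IC_dom(1)[OF e(2)] e(3)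
    by (simp add: crd_IC inj_on_def)
  moreover have "fst (snd e) = fst (snd e')"
    using diff_atlas_inj[OF atl_B assms(2)] IC_dom(2)[OF e(1)] IC_dom(2)[OF e(2)] e(3)
    by (simp add: crd_IC inj_on_def)
  moreover have "pc c d e = pc c d e'" using e(3) by (simp add: crd_IC)
  ultimately show "e = e'" using covjet_at_pc[OF assms e(1)] covjet_at_pc[OF assms e(2)] by metis
qed

lemma cinv_IC:
  assumes "c \<in> A" "d \<in> B" "\<tau> \<in> cimg c" "\<xi> \<in> cimg d"
  shows "cinv (IC c d) (\<tau>, \<xi>, p) = covjet_at c d (cinv c \<tau>) (cinv d \<xi>) p"
proof -
  have "crd (IC c d) (covjet_at c d (cinv c \<tau>) (cinv d \<xi>) p) = (\<tau>, \<xi>, p)"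
    using assms by (simp add: crd_IC crd_cinv covjet_at_in_cdom cinv_in_cdom)
  then show ?thesis
    using cinv_crd[OF IC_inj[OF assms(1,2)] covjet_at_in_cdom(2)[OF assms(1) cinv_in_cdom[OF assms(3)] assms(2) cinv_in_cdom[OF assms(4)]]]
    by metis
qed

lemma overlap_IC:
  assumes "c \<in> A" "d \<in> B" "c' \<in> A" "d' \<in> B"
  shows "crd (IC c d) ` (cdom (IC c d) \<inter> cdom (IC c' d')) =
    (crd c ` (cdom c \<inter> cdom c')) \<times> (crd d ` (cdom d \<inter> cdom d')) \<times> UNIV" (is "?L = ?R")
proof
  show "?L \<subseteq> ?R" by (auto simp: cdom_IC crd_IC)
  show "?R \<subseteq> ?L"
  proof (clarify)
    fix t x p assume tx: "t \<in> cdom c" "t \<in> cdom c'" "x \<in> cdom d" "x \<in> cdom d'"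
    have "covjet_at c d t x p \<in> cdom (IC c d) \<inter> cdom (IC c' d')"
      using covjet_at_in_cdom(1)[OF assms(1) tx(1) assms(2) tx(3)] tx by (simp add: cdom_IC)
    moreover have "crd (IC c d) (covjet_at c d t x p) = (crd c t, crd d x, p)"
      using covjet_at_in_cdom(3)[OF assms(1) tx(1) assms(2) tx(3)] by (simp add: crd_IC)
    ultimately show "(crd c t, crd d x, p) \<in> ?L" by force
  qed
qed

lemma cimg_IC:
  assumes "c \<in> A" "d \<in> B"
  shows "cimg (IC c d) = cimg c \<times> cimg d \<times> UNIV"
  using overlap_IC[OF assms assms] by (simp add: cimg_def)

lemma overlap_IC_open:
  assumes "c \<in> A" "d \<in> B" "c' \<in> A" "d' \<in> B"
  shows "open (crd (IC c d) ` (cdom (IC c d) \<inter> cdom (IC c' d')))"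
  unfolding overlap_IC[OF assms]
  by (intro open_Times open_UNIV chart_overlap_open[OF T assms(1,3)] chart_overlap_open[OF M assms(2,4)])

lemma cimg_IC_open: "c \<in> A \<Longrightarrow> d \<in> B \<Longrightarrow> open (cimg (IC c d))"
  using overlap_IC_open[of c d c d] by (simp add: cimg_def)

lemma pc_change:
  assumes cd: "c \<in> A" "d \<in> B" "c' \<in> A" "d' \<in> B" and e: "e \<in> cdom (IC c d)" "e \<in> cdom (IC c' d')"
  shows "pc c' d' e = transpose (cjac d' d (fst (snd e))) ** pc c d e ** transpose (cjac c c' (fst e))"
  using p_coord_change[OF cd(1) IC_dom(1)[OF e(1)] cd(2) IC_dom(2)[OF e(1)] cd(3) IC_dom(1)[OF e(2)]
      cd(4) IC_dom(2)[OF e(2)] IC_dom(3)[OF e(1)]] by simp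

text \<open>The derivative of \<open>p'\<close> in the direction with components \<open>u\<close> along \<open>t\<close>, \<open>0\<close> along \<open>x\<close> and \<open>w\<close> along \<open>p\<close>. A semispray
  takes values in such directions, so the derivative of \<open>p'\<close> by \<open>x\<close> never has to be computed.\<close>

definition pderiv_pc where
  "pderiv_pc c d c' d' e u w = (\<chi> j b. \<Sum>k\<in>UNIV. \<Sum>f\<in>UNIV.
      cjac d' d (fst (snd e)) $ k $ j * w $ k $ f * cjac c c' (fst e) $ b $ f +
      cjac d' d (fst (snd e)) $ k $ j * pc c d e $ k $ f * (\<Sum>a\<in>UNIV. hess c c' (fst e) b a f * u $ a))"

text \<open>On an overlap the new \<open>p'\<close> is a sum of products of a function of \<open>x\<close>, a coordinate \<open>p\<close> and a function of
  \<open>t\<close>.\<close>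

lemma pc_has_derivative:
  assumes cd: "c \<in> A" "d \<in> B" "c' \<in> A" "d' \<in> B" and e: "e \<in> cdom (IC c d)" "e \<in> cdom (IC c' d')"
  shows "\<exists>D. (pc c' d' \<circ> cinv (IC c d) has_derivative D) (at (crd (IC c d) e)) \<and>
    (\<forall>u w. D (u, 0, w) = pderiv_pc c d c' d' e u w)"
proof -
  let ?t = "fst e" let ?x = "fst (snd e)" let ?p = "pc c d e"
  let ?S = "crd (IC c d) ` (cdom (IC c d) \<inter> cdom (IC c' d'))"
  define X where "X = (\<lambda>\<xi> k j. cjac d' d (cinv d \<xi>) $ k $ j)"
  define S where "S = (\<lambda>\<tau> b f. cjac c c' (cinv c \<tau>) $ b $ f)"
  define DX where "DX = (\<lambda>k j. frechet_derivative (\<lambda>\<xi>. X \<xi> k j) (at (crd d ?x)))"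
  define DS where "DS = (\<lambda>b f u. \<Sum>a\<in>UNIV. hess c c' ?t b a f * u $ a)"
  note dom = IC_dom(1)[OF e(1)] IC_dom(2)[OF e(1)] IC_dom(1)[OF e(2)] IC_dom(2)[OF e(2)]
  have DX: "((\<lambda>\<xi>. X \<xi> k j) has_derivative DX k j) (at (crd d ?x))" for k j
    unfolding DX_def using inverse_cjac_differentiable[OF M cd(2,4) dom(2,4)] frechet_derivative_works
    unfolding X_def by blast
  have DS: "((\<lambda>\<tau>. S \<tau> b f) has_derivative DS b f) (at (crd c ?t))" for b f
    unfolding DS_def S_def by (rule cjac_has_derivative[OF T cd(1,3) dom(1,3)])
  have X0: "X (crd d ?x) k j = cjac d' d ?x $ k $ j" for k j
    by (simp add: X_def diff_atlas_cinv[OF atl_B cd(2) dom(2)])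
  have S0: "S (crd c ?t) b f = cjac c c' ?t $ b $ f" for b f
    by (simp add: S_def diff_atlas_cinv[OF atl_A cd(1) dom(1)])
  define z0 where "z0 = crd (IC c d) e"
  have z0: "fst z0 = crd c ?t" "fst (snd z0) = crd d ?x" "snd (snd z0) = ?p"
    by (simp_all add: z0_def crd_IC)
  define D where "D = (\<lambda>h. \<chi> j b. \<Sum>k\<in>UNIV. \<Sum>f\<in>UNIV.
      X (fst (snd z0)) k j * snd (snd z0) $ k $ f * DS b f (fst h) +
      (X (fst (snd z0)) k j * snd (snd h) $ k $ f +
        DX k j (fst (snd h)) * snd (snd z0) $ k $ f) * S (fst z0) b f)"
  have "((\<lambda>z. \<chi> j b. \<Sum>k\<in>UNIV. \<Sum>f\<in>UNIV. X (fst (snd z)) k j * snd (snd z) $ k $ f * S (fst z) b f)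
      has_derivative D) (at z0)"
  proof (rule has_derivative_matrixI)
    fix j b
    have 1: "((\<lambda>z. X (fst (snd z)) k j) has_derivative (\<lambda>h. DX k j (fst (snd h)))) (at z0)" for k
    proof -
      have "((\<lambda>z. fst (snd z)) has_derivative (\<lambda>h. fst (snd h))) (at z0)"
        by (intro derivative_intros)
      from diff_chain_at[OF this, of "\<lambda>\<xi>. X \<xi> k j" "DX k j"] DX show ?thesis
        by (simp add: z0 o_def)
    qed
    have 2: "((\<lambda>z. S (fst z) b f) has_derivative (\<lambda>h. DS b f (fst h))) (at z0)" for f
    proof -
      have "(fst has_derivative fst) (at z0)"
        by (rule bounded_linear_imp_has_derivative[OF bounded_linear_fst])
      from diff_chain_at[OF this, of "\<lambda>\<xi>. S \<xi> b f" "DS b f"] DS show ?thesis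
        by (simp add: z0 o_def)
    qed
    have 3: "((\<lambda>z. snd (snd z) $ k $ f) has_derivative (\<lambda>h. snd (snd h) $ k $ f)) (at z0)" for k f
      by (intro bounded_linear.has_derivative[OF bounded_linear_vec_nth] derivative_intros)
    show "((\<lambda>z. (\<chi> j b. \<Sum>k\<in>UNIV. \<Sum>f\<in>UNIV. X (fst (snd z)) k j * snd (snd z) $ k $ f * S (fst z) b f) $ j $ b)
      has_derivative (\<lambda>h. D h $ j $ b)) (at z0)"
      unfolding D_def vec_lambda_beta by (intro has_derivative_sum has_derivative_mult 1 2 3)
  qed
  then have "(pc c' d' \<circ> cinv (IC c d) has_derivative D) (at z0)"
  proof (rule has_derivative_transform_within_open[OF _ overlap_IC_open[OF cd]])
    show "z0 \<in> ?S" unfolding z0_def using e by blast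
    fix z assume "z \<in> ?S"
    then obtain e' where e': "e' \<in> cdom (IC c d)" "e' \<in> cdom (IC c' d')" "z = crd (IC c d) e'" by blast
    have "cinv (IC c d) z = e'" using cinv_crd[OF IC_inj[OF cd(1,2)] e'(1)] e'(3) by simp
    then show "(\<chi> j b. \<Sum>k\<in>UNIV. \<Sum>f\<in>UNIV. X (fst (snd z)) k j * snd (snd z) $ k $ f * S (fst z) b f) =
      (pc c' d' \<circ> cinv (IC c d)) z"
      by (simp add: vec_eq_iff pc_change[OF cd e'(1,2)] sandwich_component)
        (simp add: e'(3) crd_IC X_def S_def diff_atlas_cinv[OF atl_A cd(1) IC_dom(1)[OF e'(1)]]
          diff_atlas_cinv[OF atl_B cd(2) IC_dom(2)[OF e'(1)]])
  qed
  moreover have "D (u, 0, w) = pderiv_pc c d c' d' e u w" for u w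
  proof -
    have "DX k j 0 = 0" for k j using DX has_derivative_linear linear_0 by blast
    then show ?thesis
      by (simp add: D_def pderiv_pc_def z0 X0 S0 DS_def add.commute)
  qed
  ultimately show ?thesis unfolding z0_def by blast
qed

lemma IC_transition:
  assumes cd: "c \<in> A" "d \<in> B" "c' \<in> A" "d' \<in> B" and e: "e \<in> cdom (IC c d)" "e \<in> cdom (IC c' d')"
  shows "(crd (IC c' d') \<circ> cinv (IC c d)) differentiable (at (crd (IC c d) e))"
    and "fst (snd (pd (IC c d) (crd (IC c' d')) e h)) = cjac d d' (fst (snd e)) *v fst (snd h)"
    and "pd (IC c d) (crd (IC c' d')) e (u, 0, w) =
      (cjac c c' (fst e) *v u, 0, pderiv_pc c d c' d' e u w)"
    and "pd (IC c d) (\<lambda>e. pc c' d' e $ j $ b) e (u, 0, w) = pderiv_pc c d c' d' e u w $ j $ b"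
proof -
  let ?t = "fst e" let ?x = "fst (snd e)" let ?z = "crd (IC c d) e"
  note dom = IC_dom(1)[OF e(1)] IC_dom(2)[OF e(1)] IC_dom(1)[OF e(2)] IC_dom(2)[OF e(2)]
  obtain D where D: "(pc c' d' \<circ> cinv (IC c d) has_derivative D) (at ?z)"
    and Duw: "\<And>u w. D (u, 0, w) = pderiv_pc c d c' d' e u w"
    using pc_has_derivative[OF cd e] by blast
  have 1: "((\<lambda>z. (crd c' \<circ> cinv c) (fst z)) has_derivative (\<lambda>h. pd c (crd c') ?t (fst h))) (at ?z)"
  proof -
    have "(fst has_derivative fst) (at ?z)"
      by (rule bounded_linear_imp_has_derivative[OF bounded_linear_fst])
    from diff_chain_at[OF this, of "crd c' \<circ> cinv c" "pd c (crd c') ?t"]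
      transition_has_derivative[OF atl_A cd(1,3) dom(1,3)] show ?thesis
      by (simp add: crd_IC o_def)
  qed
  have 2: "((\<lambda>z. (crd d' \<circ> cinv d) (fst (snd z))) has_derivative (\<lambda>h. pd d (crd d') ?x (fst (snd h)))) (at ?z)"
  proof -
    have "((\<lambda>z. fst (snd z)) has_derivative (\<lambda>h. fst (snd h))) (at ?z)"
      by (intro derivative_intros)
    from diff_chain_at[OF this, of "crd d' \<circ> cinv d" "pd d (crd d') ?x"]
      transition_has_derivative[OF atl_B cd(2,4) dom(2,4)] show ?thesis
      by (simp add: crd_IC o_def)
  qed
  let ?D = "\<lambda>h. (pd c (crd c') ?t (fst h), pd d (crd d') ?x (fst (snd h)), D h)"
  have "((\<lambda>z. ((crd c' \<circ> cinv c) (fst z), (crd d' \<circ> cinv d) (fst (snd z)), (pc c' d' \<circ> cinv (IC c d)) z))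
      has_derivative ?D) (at ?z)"
    by (intro has_derivative_Pair 1 2 D)
  then have tr: "(crd (IC c' d') \<circ> cinv (IC c d) has_derivative ?D) (at ?z)"
  proof (rule has_derivative_transform_within_open[OF _ overlap_IC_open[OF cd]])
    show "?z \<in> crd (IC c d) ` (cdom (IC c d) \<inter> cdom (IC c' d'))" using e by blast
    fix z assume "z \<in> crd (IC c d) ` (cdom (IC c d) \<inter> cdom (IC c' d'))"
    then obtain e' where e': "e' \<in> cdom (IC c d)" "e' \<in> cdom (IC c' d')" "z = crd (IC c d) e'" by blast
    have "cinv (IC c d) z = e'" using cinv_crd[OF IC_inj[OF cd(1,2)] e'(1)] e'(3) by simp
    then show "((crd c' \<circ> cinv c) (fst z), (crd d' \<circ> cinv d) (fst (snd z)), (pc c' d' \<circ> cinv (IC c d)) z) =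
      (crd (IC c' d') \<circ> cinv (IC c d)) z"
      by (simp add: e'(3) crd_IC diff_atlas_cinv[OF atl_A cd(1) IC_dom(1)[OF e'(1)]]
          diff_atlas_cinv[OF atl_B cd(2) IC_dom(2)[OF e'(1)]])
  qed
  then show "(crd (IC c' d') \<circ> cinv (IC c d)) differentiable (at ?z)"
    using differentiable_def by blast
  note pd = pd_eqI[OF tr]
  show "fst (snd (pd (IC c d) (crd (IC c' d')) e h)) = cjac d d' (fst (snd e)) *v fst (snd h)"
    unfolding pd cjac_works[OF atl_B cd(2,4) dom(2,4)] by simp
  have "pd d (crd d') ?x 0 = 0"
    using transition_linear[OF atl_B cd(2,4) dom(2,4)] linear_0 by blast
  then show "pd (IC c d) (crd (IC c' d')) e (u, 0, w) =
      (cjac c c' (fst e) *v u, 0, pderiv_pc c d c' d' e u w)"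
    unfolding pd cjac_works[OF atl_A cd(1,3) dom(1,3)] by (simp add: Duw)
  have "((\<lambda>e. pc c' d' e $ j $ b) \<circ> cinv (IC c d) has_derivative (\<lambda>h. D h $ j $ b)) (at ?z)"
    using bounded_linear.has_derivative[OF bounded_linear_vec_nth
        bounded_linear.has_derivative[OF bounded_linear_vec_nth D]] by (simp add: o_def)
  from pd_eqI[OF this]
  show "pd (IC c d) (\<lambda>e. pc c' d' e $ j $ b) e (u, 0, w) = pderiv_pc c d c' d' e u w $ j $ b"
    by (simp add: Duw)
qed

lemma atl_E: "diff_atlas E"
proof -
  have "inj_on (crd C) (cdom C)" if "C \<in> E" for C
    using that IC_inj by (auto simp: induced_atlas_def)
  moreover have "open (crd C ` (cdom C \<inter> cdom C')) \<and>
      (\<forall>e\<in>cdom C \<inter> cdom C'. (crd C' \<circ> cinv C) differentiable (at (crd C e)))"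
    if C: "C \<in> E" "C' \<in> E" for C C'
  proof -
    obtain c d c' d' where cd: "c \<in> A" "d \<in> B" "c' \<in> A" "d' \<in> B" and C: "C = IC c d" "C' = IC c' d'"
      using C by (auto simp: induced_atlas_def)
    show ?thesis unfolding C using overlap_IC_open[OF cd] IC_transition(1)[OF cd] by blast
  qed
  ultimately show ?thesis unfolding diff_atlas_def by blast
qed

end

section \<open>Semisprays and connections in coordinates\<close>

text \<open>The coordinate vector of the value of a semispray with components \<open>g\<close>, at a point with coordinates \<open>p\<close>, on a
  tangent vector with spatial part \<open>u\<close>.\<close>

definition spray_vec :: "real^'m^'n \<Rightarrow> ('m \<Rightarrow> 'n \<Rightarrow> 'n \<Rightarrow> real) \<Rightarrow> real^'n \<Rightarrow> ('m::finite, 'n::finite) txp" where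
  "spray_vec p g u = (transpose p *v u, 0, \<chi> j b. - 2 * (\<Sum>i\<in>UNIV. g b j i * u $ i))"

lemma axis_matrix_nth: "(axis j (axis b (1::real)) :: real^'m^'n) $ k $ a = (if k = j \<and> a = b then 1 else 0)"
  by (simp add: axis_def)

lemma spray_vec_expansion:
  "spray_vec p g u = (\<Sum>i\<in>UNIV. \<Sum>a\<in>UNIV. (p $ i $ a * u $ i) *\<^sub>R t_dir a) -
     2 *\<^sub>R (\<Sum>i\<in>UNIV. \<Sum>j\<in>UNIV. \<Sum>b\<in>UNIV. (g b j i * u $ i) *\<^sub>R p_dir j b)" (is "_ = ?t - 2 *\<^sub>R ?p")
proof -
  have "fst (spray_vec p g u) = fst (?t - 2 *\<^sub>R ?p)"
    by (simp add: spray_vec_def fst_sum vec_eq_iff matrix_vector_mult_def transpose_def axis_def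
        if_distrib cong: if_cong)
  moreover have "fst (snd (spray_vec p g u)) = fst (snd (?t - 2 *\<^sub>R ?p))"
    by (simp add: spray_vec_def fst_sum snd_sum)
  moreover have "snd (snd (spray_vec p g u)) = snd (snd (?t - 2 *\<^sub>R ?p))"
  proof -
    have "(\<Sum>i\<in>UNIV. \<Sum>j\<in>UNIV. \<Sum>b\<in>UNIV. g b j i * u $ i * (axis j (axis b 1) :: real^_^_) $ k $ a) =
        (\<Sum>i\<in>UNIV. g a k i * u $ i)" for k a
    proof (rule sum.cong[OF refl])
      fix i
      have "(\<Sum>j\<in>UNIV. \<Sum>b\<in>UNIV. g b j i * u $ i * (axis j (axis b 1) :: real^_^_) $ k $ a) =
        (\<Sum>j\<in>UNIV. if j = k then (\<Sum>b\<in>UNIV. if b = a then g b j i * u $ i else 0) else 0)"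
        unfolding axis_matrix_nth by (intro sum.cong refl) (auto simp: mult_delta_right)
      then show "(\<Sum>j\<in>UNIV. \<Sum>b\<in>UNIV. g b j i * u $ i * (axis j (axis b 1) :: real^_^_) $ k $ a) = g a k i * u $ i"
        by simp
    qed
    then show ?thesis by (simp add: spray_vec_def snd_sum vec_eq_iff)
  qed
  ultimately show ?thesis by (simp add: prod_eq_iff)
qed

lemma spray_vec_linear: "spray_vec p g (a *\<^sub>R u + b *\<^sub>R v) = a *\<^sub>R spray_vec p g u + b *\<^sub>R spray_vec p g v"
  by (simp add: spray_vec_def vec_eq_iff matrix_vector_mult_def sum.distrib sum_distrib_left algebra_simps)

context manifold_pair
begin

abbreviation cv :: "('t, real^'m) chart \<Rightarrow> ('x, real^'n) chart \<Rightarrow> ('t, 'x) covjet \<Rightarrow> ('m, 'n) txp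
    \<Rightarrow> (('t, 'x) covjet, ('m, 'n) txp) tangent"
  where "cv c d \<equiv> coord_vec E (IC c d)"

lemma IC_cv_linear:
  assumes "c \<in> A" "d \<in> B" "e \<in> cdom (IC c d)"
  shows "linear (\<lambda>w. cv c d e w D)"
  by (rule coord_vec_linear[OF atl_E IC_in_E[OF assms(1,2)] assms(3)])

lemma spray_field_expansion:
  assumes "c \<in> A" "d \<in> B" "e \<in> cdom (IC c d)"
  shows "(\<lambda>D. (\<Sum>i\<in>UNIV. \<Sum>a\<in>UNIV. (p $ i $ a * u $ i) *\<^sub>R cv c d e (t_dir a) D) -
     2 *\<^sub>R (\<Sum>i\<in>UNIV. \<Sum>j\<in>UNIV. \<Sum>b\<in>UNIV. (g b j i * u $ i) *\<^sub>R cv c d e (p_dir j b) D)) =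
    cv c d e (spray_vec p g u)"
proof
  fix D
  note lin = IC_cv_linear[OF assms, of D]
  show "(\<Sum>i\<in>UNIV. \<Sum>a\<in>UNIV. (p $ i $ a * u $ i) *\<^sub>R cv c d e (t_dir a) D) -
     2 *\<^sub>R (\<Sum>i\<in>UNIV. \<Sum>j\<in>UNIV. \<Sum>b\<in>UNIV. (g b j i * u $ i) *\<^sub>R cv c d e (p_dir j b) D) =
    cv c d e (spray_vec p g u) D"
    unfolding spray_vec_expansion linear_diff[OF lin] linear_scale[OF lin] linear_sum[OF lin] ..
qed

lemma temporal_semispray_iff:
  "temporal_semispray A B GG G \<longleftrightarrow> tensor_field_11 E GG \<and>
     (\<forall>c\<in>A. \<forall>d\<in>B. \<forall>e\<in>cdom (IC c d). \<forall>v\<in>tangent_space E e.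
        GG e v = cv c d e (spray_vec (pc c d e) (\<lambda>b j i. G c d b j i e) (fst (snd (v (IC c d))))))"
  unfolding temporal_semispray_def Let_def
  by (intro conj_cong refl ball_cong) (simp only: spray_field_expansion)

text \<open>The part \<open>p\<^sub>i\<^sup>a dx\<^sup>i \<otimes> \<partial>/\<partial>t\<^sup>a\<close> is invariant up to its component along \<open>\<partial>/\<partial>p\<close>.\<close>

lemma transposed_pc_change:
  assumes cd: "c \<in> A" "d \<in> B" "c' \<in> A" "d' \<in> B" and e: "e \<in> cdom (IC c d)" "e \<in> cdom (IC c' d')"
  shows "transpose (pc c' d' e) *v (cjac d d' (fst (snd e)) *v u) = cjac c c' (fst e) *v (transpose (pc c d e) *v u)"
proof -
  have XY: "cjac d' d (fst (snd e)) ** cjac d d' (fst (snd e)) = mat 1"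
    by (rule cjac_inverse[OF atl_B cd(2,4) IC_dom(2)[OF e(1)] IC_dom(2)[OF e(2)]])
  have "transpose (pc c' d' e) = cjac c c' (fst e) ** transpose (pc c d e) ** cjac d' d (fst (snd e))"
    by (simp add: pc_change[OF cd e] matrix_transpose_mul matrix_mul_assoc)
  then have "transpose (pc c' d' e) ** cjac d d' (fst (snd e)) = cjac c c' (fst e) ** transpose (pc c d e)"
    by (simp add: matrix_mul_assoc[symmetric] XY)
  then show ?thesis by (simp add: matrix_vector_mul_assoc del: transpose_matrix_vector)
qed

text \<open>The transformation law of semispray components, for each vector \<open>u\<close> in place of \<open>dx\<close>: the two local
  expressions define the same tangent vector if and only if their components along \<open>\<partial>/\<partial>p\<close> match, and the inhomogeneous term
  comes from the dependence of \<open>p'\<close> on \<open>t\<close>.\<close>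

lemma spray_eq_iff:
  assumes cd: "c \<in> A" "d \<in> B" "c' \<in> A" "d' \<in> B" and e: "e \<in> cdom (IC c d)" "e \<in> cdom (IC c' d')"
  shows "cv c d e (spray_vec (pc c d e) g u) = cv c' d' e (spray_vec (pc c' d' e) g' (cjac d d' (fst (snd e)) *v u)) \<longleftrightarrow>
    (\<forall>j b. (\<Sum>i\<in>UNIV. g' b j i * (cjac d d' (fst (snd e)) *v u) $ i) =
      (\<Sum>k\<in>UNIV. \<Sum>f\<in>UNIV. cjac d' d (fst (snd e)) $ k $ j * (\<Sum>i\<in>UNIV. g f k i * u $ i) * cjac c c' (fst e) $ b $ f) -
      1 / 2 * (\<Sum>k\<in>UNIV. \<Sum>f\<in>UNIV. cjac d' d (fst (snd e)) $ k $ j * pc c d e $ k $ f *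
         (\<Sum>a\<in>UNIV. hess c c' (fst e) b a f * (transpose (pc c d e) *v u) $ a)))"
    (is "?eq \<longleftrightarrow> (\<forall>j b. ?L j b = ?P j b - 1 / 2 * ?Q j b)")
proof -
  let ?w = "spray_vec (pc c' d' e) g' (cjac d d' (fst (snd e)) *v u)"
  let ?z = "transpose (pc c d e) *v u"
  let ?y = "\<chi> j b. - 2 * (\<Sum>i\<in>UNIV. g b j i * u $ i)"
  note C = IC_in_E[OF cd(1,2)] and C' = IC_in_E[OF cd(3,4)]
  have s: "spray_vec (pc c d e) g u = (?z, 0, ?y)" by (simp add: spray_vec_def)
  have "cv c d e (spray_vec (pc c d e) g u) = cv c' d' e (cjac c c' (fst e) *v ?z, 0, pderiv_pc c d c' d' e ?z ?y)"
    unfolding s IC_transition(3)[OF cd e, symmetric] by (rule coord_vec_change[OF atl_E C C' e])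
  moreover have "cv c' d' e w = cv c' d' e w' \<longleftrightarrow> w = w'" for w w'
    using coord_vec_at[OF atl_E C' e(2)] by metis
  ultimately have "?eq \<longleftrightarrow> (cjac c c' (fst e) *v ?z, 0, pderiv_pc c d c' d' e ?z ?y) = ?w" by simp
  also have "\<dots> \<longleftrightarrow> (\<forall>j b. pderiv_pc c d c' d' e ?z ?y $ j $ b = - 2 * ?L j b)"
    by (simp add: spray_vec_def transposed_pc_change[OF cd e] vec_eq_iff del: transpose_matrix_vector)
  also have "\<dots> \<longleftrightarrow> (\<forall>j b. ?L j b = ?P j b - 1 / 2 * ?Q j b)"
  proof -
    have "pderiv_pc c d c' d' e ?z ?y $ j $ b = - 2 * ?P j b + ?Q j b" for j b
      by (simp add: pderiv_pc_def sum.distrib sum_subtractf sum_distrib_left mult_ac sum_negf)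
    then have "pderiv_pc c d c' d' e ?z ?y $ j $ b = - 2 * ?L j b \<longleftrightarrow> ?L j b = ?P j b - 1 / 2 * ?Q j b" for j b
      by (simp only:) (rule iffI; linarith)
    then show ?thesis by (simp only:)
  qed
  finally show ?thesis .
qed

text \<open>The temporal rule with all partial derivatives replaced by Jacobian and Hessian matrices, and with the
  common factor \<open>\<partial>t/\<partial>t'\<close> taken out.\<close>

lemma temporal_components_iff:
  "temporal_components A B N \<longleftrightarrow>
    (\<forall>c\<in>A. \<forall>d\<in>B. \<forall>b j a. smooth_in (IC c d) (N c d b j a)) \<and>
    (\<forall>c\<in>A. \<forall>d\<in>B. \<forall>c'\<in>A. \<forall>d'\<in>B. \<forall>e\<in>cdom (IC c d) \<inter> cdom (IC c' d'). \<forall>b j r.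
       N c' d' b j r e = (\<Sum>a\<in>UNIV. cjac c' c (fst e) $ a $ r *
         ((\<Sum>k\<in>UNIV. \<Sum>f\<in>UNIV. cjac d' d (fst (snd e)) $ k $ j * N c d f k a e * cjac c c' (fst e) $ b $ f) -
          (\<Sum>k\<in>UNIV. \<Sum>f\<in>UNIV. cjac d' d (fst (snd e)) $ k $ j * pc c d e $ k $ f * hess c c' (fst e) b a f))))"
  unfolding temporal_components_def Let_def
proof (intro conj_cong refl ball_cong all_cong1)
  fix c d c' d' e b j r
  assume cd: "c \<in> A" "d \<in> B" "c' \<in> A" "d' \<in> B" and "e \<in> cdom (IC c d) \<inter> cdom (IC c' d')"
  then have e: "e \<in> cdom (IC c d)" "e \<in> cdom (IC c' d')" by auto
  note dom = IC_dom(1)[OF e(1)] IC_dom(2)[OF e(1)] IC_dom(1)[OF e(2)] IC_dom(2)[OF e(2)]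
  have 1: "pd c (\<lambda>s. crd c' s $ b) (fst e) (axis f 1) = cjac c c' (fst e) $ b $ f" for f
    by (rule cjac_component[OF atl_A cd(1,3) dom(1,3)])
  have 2: "pd c' (\<lambda>s. crd c s $ a) (fst e) (axis r 1) = cjac c' c (fst e) $ a $ r" for a
    by (rule cjac_component[OF atl_A cd(3,1) dom(3,1)])
  have 3: "pd d' (\<lambda>y. crd d y $ k) (fst (snd e)) (axis j 1) = cjac d' d (fst (snd e)) $ k $ j" for k
    by (rule cjac_component[OF atl_B cd(4,2) dom(4,2)])
  have 4: "pd (IC c d) (\<lambda>e. pc c' d' e $ j $ b) e (t_dir a) =
      (\<Sum>k\<in>UNIV. \<Sum>f\<in>UNIV. cjac d' d (fst (snd e)) $ k $ j * pc c d e $ k $ f * hess c c' (fst e) b a f)" for a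
    unfolding IC_transition(4)[OF cd e]
    by (simp add: pderiv_pc_def axis_def if_distrib cong: if_cong)
  have "(\<Sum>k\<in>UNIV. \<Sum>a\<in>UNIV. \<Sum>f\<in>UNIV. N c d f k a e * cjac c c' (fst e) $ b $ f *
        cjac d' d (fst (snd e)) $ k $ j * cjac c' c (fst e) $ a $ r) =
      (\<Sum>a\<in>UNIV. \<Sum>k\<in>UNIV. \<Sum>f\<in>UNIV. N c d f k a e * cjac c c' (fst e) $ b $ f *
        cjac d' d (fst (snd e)) $ k $ j * cjac c' c (fst e) $ a $ r)"
    by (rule sum.swap)
  also have "\<dots> = (\<Sum>a\<in>UNIV. cjac c' c (fst e) $ a $ r *
         (\<Sum>k\<in>UNIV. \<Sum>f\<in>UNIV. cjac d' d (fst (snd e)) $ k $ j * N c d f k a e * cjac c c' (fst e) $ b $ f))"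
    by (simp add: sum_distrib_left mult_ac)
  finally have 5: "(\<Sum>k\<in>UNIV. \<Sum>a\<in>UNIV. \<Sum>f\<in>UNIV. N c d f k a e * cjac c c' (fst e) $ b $ f *
        cjac d' d (fst (snd e)) $ k $ j * cjac c' c (fst e) $ a $ r) = \<dots>" .
  show "(N c' d' b j r e = (\<Sum>k\<in>UNIV. \<Sum>a\<in>UNIV. \<Sum>f\<in>UNIV. N c d f k a e *
            pd c (\<lambda>s. crd c' s $ b) (fst e) (axis f 1) *
            pd d' (\<lambda>y. crd d y $ k) (fst (snd e)) (axis j 1) *
            pd c' (\<lambda>s. crd c s $ a) (fst e) (axis r 1)) -
          (\<Sum>a\<in>UNIV. pd c' (\<lambda>s. crd c s $ a) (fst e) (axis r 1) *
            pd (IC c d) (\<lambda>e. pc c' d' e $ j $ b) e (t_dir a))) =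
       (N c' d' b j r e = (\<Sum>a\<in>UNIV. cjac c' c (fst e) $ a $ r *
         ((\<Sum>k\<in>UNIV. \<Sum>f\<in>UNIV. cjac d' d (fst (snd e)) $ k $ j * N c d f k a e * cjac c c' (fst e) $ b $ f) -
          (\<Sum>k\<in>UNIV. \<Sum>f\<in>UNIV. cjac d' d (fst (snd e)) $ k $ j * pc c d e $ k $ f * hess c c' (fst e) b a f))))"
    unfolding 1 2 3 4 5 right_diff_distrib sum_subtractf ..
qed

lemma smooth_in_IC_cong:
  assumes "c \<in> A" "d \<in> B" "\<And>z. z \<in> cimg (IC c d) \<Longrightarrow> f (cinv (IC c d) z) = F z"
  shows "smooth_in (IC c d) f \<longleftrightarrow> smooth_on (cimg (IC c d)) F"
  unfolding smooth_in_def by (rule smooth_on_cong[OF cimg_IC_open[OF assms(1,2)]]) (simp add: assms(3))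

lemma pc_cinv:
  assumes "c \<in> A" "d \<in> B" "z \<in> cimg (IC c d)"
  shows "pc c d (cinv (IC c d) z) = snd (snd z)" "fst (snd (cinv (IC c d) z)) = cinv d (fst (snd z))"
proof -
  obtain \<tau> \<xi> p where z: "z = (\<tau>, \<xi>, p)" by (metis surj_pair)
  have "\<tau> \<in> cimg c" "\<xi> \<in> cimg d" using assms(3) unfolding cimg_IC[OF assms(1,2)] z by auto
  then show "pc c d (cinv (IC c d) z) = snd (snd z)" "fst (snd (cinv (IC c d) z)) = cinv d (fst (snd z))"
    using assms by (simp_all add: z cinv_IC covjet_at_in_cdom(3) cinv_in_cdom)
qed

subsection \<open>The semispray of a nonlinear connection\<close>

text \<open>Contracting the temporal rule with \<open>p'\<^sub>i\<^sup>d dx'\<^sup>i\<close> cancels the factor \<open>\<partial>t/\<partial>t'\<close>, because \<open>p'\<^sub>i\<^sup>d dx'\<^sup>i = (\<partial>t'\<^sup>d/\<partial>t\<^sup>a) p\<^sub>i\<^sup>a dx\<^sup>i\<close>,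
  and leaves the law of semispray components; the factor \<open>1/2\<close> matches the \<open>2\<close> in the local form of a semispray.\<close>

lemma connection_spray_invariant:
  assumes N: "temporal_components A B N"
    and cd: "c \<in> A" "d \<in> B" "c' \<in> A" "d' \<in> B" and e: "e \<in> cdom (IC c d)" "e \<in> cdom (IC c' d')"
    and G: "\<And>c d b j i e. G c d b j i e = 1 / 2 * (\<Sum>a\<in>UNIV. N c d b j a e * pc c d e $ i $ a)"
  shows "cv c d e (spray_vec (pc c d e) (\<lambda>b j i. G c d b j i e) u) =
    cv c' d' e (spray_vec (pc c' d' e) (\<lambda>b j i. G c' d' b j i e) (cjac d d' (fst (snd e)) *v u))"
proof -
  define X where "X = cjac d' d (fst (snd e))"
  define S where "S = cjac c c' (fst e)"
  define R where "R = cjac c' c (fst e)"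
  define z where "z = transpose (pc c d e) *v u"
  define y where "y = cjac d d' (fst (snd e)) *v u"
  have RS: "R ** S = mat 1" unfolding R_def S_def
    by (rule cjac_inverse[OF atl_A cd(1,3) IC_dom(1)[OF e(1)] IC_dom(1)[OF e(2)]])
  have G_sum: "(\<Sum>i\<in>UNIV. G c d b j i e * v $ i) = 1 / 2 * (\<Sum>a\<in>UNIV. N c d b j a e * (transpose (pc c d e) *v v) $ a)"
    for c d b j v
  proof -
    have "(\<Sum>i\<in>UNIV. G c d b j i e * v $ i) =
        (\<Sum>i\<in>UNIV. \<Sum>a\<in>UNIV. 1 / 2 * (N c d b j a e * pc c d e $ i $ a * v $ i))"
      by (simp add: G sum_distrib_left sum_distrib_right mult_ac)
    also have "\<dots> = (\<Sum>a\<in>UNIV. \<Sum>i\<in>UNIV. 1 / 2 * (N c d b j a e * pc c d e $ i $ a * v $ i))"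
      by (rule sum.swap)
    also have "\<dots> = 1 / 2 * (\<Sum>a\<in>UNIV. N c d b j a e * (transpose (pc c d e) *v v) $ a)"
      by (simp add: matrix_vector_mult_def transpose_def sum_distrib_left mult_ac)
    finally show ?thesis .
  qed
  have law: "(\<Sum>i\<in>UNIV. G c' d' b j i e * y $ i) =
      (\<Sum>k\<in>UNIV. \<Sum>f\<in>UNIV. X $ k $ j * (\<Sum>i\<in>UNIV. G c d f k i e * u $ i) * S $ b $ f) -
      1 / 2 * (\<Sum>k\<in>UNIV. \<Sum>f\<in>UNIV. X $ k $ j * pc c d e $ k $ f * (\<Sum>a\<in>UNIV. hess c c' (fst e) b a f * z $ a))"
    for b j
  proof -
    define m where "m = (\<lambda>a. (\<Sum>k\<in>UNIV. \<Sum>f\<in>UNIV. X $ k $ j * N c d f k a e * S $ b $ f) -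
        (\<Sum>k\<in>UNIV. \<Sum>f\<in>UNIV. X $ k $ j * pc c d e $ k $ f * hess c c' (fst e) b a f))"
    have N': "N c' d' b j r e = (\<Sum>a\<in>UNIV. R $ a $ r * m a)" for r
      unfolding R_def S_def X_def m_def
      by (rule N[unfolded temporal_components_iff, THEN conjunct2, rule_format, OF cd]) (simp add: e)
    have "(\<Sum>r\<in>UNIV. N c' d' b j r e * (S *v z) $ r) = (\<Sum>a\<in>UNIV. m a * z $ a)"
    proof -
      have "(\<Sum>r\<in>UNIV. N c' d' b j r e * (S *v z) $ r) =
          (\<Sum>r\<in>UNIV. \<Sum>a\<in>UNIV. m a * (R $ a $ r * (S *v z) $ r))"
        unfolding N' by (simp add: sum_distrib_left sum_distrib_right mult_ac)
      also have "\<dots> = (\<Sum>a\<in>UNIV. \<Sum>r\<in>UNIV. m a * (R $ a $ r * (S *v z) $ r))" by (rule sum.swap)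
      also have "\<dots> = (\<Sum>a\<in>UNIV. m a * (R *v (S *v z)) $ a)"
        by (simp only: sum_distrib_left[symmetric] matrix_vector_mult_def[of R] vec_lambda_beta)
      finally show ?thesis by (simp add: matrix_vector_mul_assoc RS)
    qed
    moreover have "(\<Sum>a\<in>UNIV. m a * z $ a) =
      (\<Sum>k\<in>UNIV. \<Sum>f\<in>UNIV. X $ k $ j * (\<Sum>a\<in>UNIV. N c d f k a e * z $ a) * S $ b $ f) -
      (\<Sum>k\<in>UNIV. \<Sum>f\<in>UNIV. X $ k $ j * pc c d e $ k $ f * (\<Sum>a\<in>UNIV. hess c c' (fst e) b a f * z $ a))"
    proof -
      have swap: "(\<Sum>a\<in>UNIV. (\<Sum>k\<in>UNIV. \<Sum>f\<in>UNIV. Z k f a) * z $ a) =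
          (\<Sum>k\<in>UNIV. \<Sum>f\<in>UNIV. \<Sum>a\<in>UNIV. Z k f a * z $ a)" for Z :: "'n \<Rightarrow> 'm \<Rightarrow> 'm \<Rightarrow> real"
      proof -
        have "(\<Sum>a\<in>UNIV. (\<Sum>k\<in>UNIV. \<Sum>f\<in>UNIV. Z k f a) * z $ a) =
            (\<Sum>a\<in>UNIV. \<Sum>k\<in>UNIV. \<Sum>f\<in>UNIV. Z k f a * z $ a)" by (simp add: sum_distrib_right)
        also have "\<dots> = (\<Sum>k\<in>UNIV. \<Sum>a\<in>UNIV. \<Sum>f\<in>UNIV. Z k f a * z $ a)" by (rule sum.swap)
        also have "\<dots> = (\<Sum>k\<in>UNIV. \<Sum>f\<in>UNIV. \<Sum>a\<in>UNIV. Z k f a * z $ a)"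
          by (intro sum.cong refl sum.swap)
        finally show ?thesis .
      qed
      show ?thesis unfolding m_def left_diff_distrib sum_subtractf swap
        by (simp add: sum_distrib_left sum_distrib_right mult_ac)
    qed
    moreover have "(\<Sum>i\<in>UNIV. G c' d' b j i e * y $ i) = 1 / 2 * (\<Sum>r\<in>UNIV. N c' d' b j r e * (S *v z) $ r)"
      unfolding G_sum y_def transposed_pc_change[OF cd e] S_def z_def ..
    ultimately show ?thesis unfolding G_sum z_def[symmetric]
      by (simp add: sum_distrib_left right_diff_distrib mult_ac)
  qed
  show ?thesis unfolding spray_eq_iff[OF cd e] by (intro allI law[unfolded X_def S_def y_def z_def])
qed

lemma tangent_lincomb:
  assumes C: "C \<in> E" "e \<in> cdom C" and u: "u \<in> tangent_space E e" and v: "v \<in> tangent_space E e"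
  shows "(\<lambda>D. a *\<^sub>R u D + b *\<^sub>R v D) \<in> tangent_space E e"
proof -
  have "(\<lambda>D. a *\<^sub>R u D + b *\<^sub>R v D) = coord_vec E C e (a *\<^sub>R u C + b *\<^sub>R v C)"
  proof
    fix D
    note lin = coord_vec_linear[OF atl_E C, of D]
    show "a *\<^sub>R u D + b *\<^sub>R v D = coord_vec E C e (a *\<^sub>R u C + b *\<^sub>R v C) D"
      unfolding linear_add[OF lin] linear_scale[OF lin]
        fun_cong[OF tangent_eq_coord_vec[OF u C], of D, symmetric]
        fun_cong[OF tangent_eq_coord_vec[OF v C], of D, symmetric] ..
  qed
  then show ?thesis by (simp only: coord_vec_tangent[OF atl_E C])
qed

text \<open>The local expressions agree on overlaps, so they glue: the field is evaluated in any chart around the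
  point.\<close>

lemma connection_semispray:
  assumes N: "temporal_components A B N"
    and G: "\<And>c d b j i e. G c d b j i e = 1 / 2 * (\<Sum>a\<in>UNIV. N c d b j a e * pc c d e $ i $ a)"
  shows "\<exists>GG. temporal_semispray A B GG G"
proof -
  define F where "F = (\<lambda>c d e (v :: (('t, 'x) covjet, ('m, 'n) txp) tangent). cv c d e (spray_vec (pc c d e) (\<lambda>b j i. G c d b j i e) (fst (snd (v (IC c d))))))"
  \<comment> \<open>On tangent vectors every choice of the charts gives the same value, by \<open>F_eq\<close> below.\<close>
  define GG where "GG = (\<lambda>e v. SOME y. \<exists>c\<in>A. \<exists>d\<in>B. e \<in> cdom (IC c d) \<and> y = F c d e v)"
  have F_eq: "F c d e v = F c' d' e v"
    if cd: "c \<in> A" "d \<in> B" "c' \<in> A" "d' \<in> B" and e: "e \<in> cdom (IC c d)" "e \<in> cdom (IC c' d')"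
      and v: "v \<in> tangent_space E e" for c d c' d' e v
  proof -
    have "v (IC c' d') = pd (IC c d) (crd (IC c' d')) e (v (IC c d))"
      using v IC_in_E[OF cd(1,2)] IC_in_E[OF cd(3,4)] e unfolding tangent_space_def by blast
    then have "fst (snd (v (IC c' d'))) = cjac d d' (fst (snd e)) *v fst (snd (v (IC c d)))"
      using IC_transition(2)[OF cd e] by metis
    then show ?thesis unfolding F_def using connection_spray_invariant[OF N cd e G] by metis
  qed
  have GG: "GG e v = F c d e v"
    if "c \<in> A" "d \<in> B" "e \<in> cdom (IC c d)" "v \<in> tangent_space E e" for c d e v
    unfolding GG_def by (rule some_equality) (use that F_eq in blast)+
  have "tensor_field_11 E GG" unfolding tensor_field_11_def
  proof (intro conjI ballI allI)
    fix e assume "e \<in> carrier_of E"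
    then obtain c d where cd: "c \<in> A" "d \<in> B" and e: "e \<in> cdom (IC c d)"
      unfolding carrier_of_def induced_atlas_def by blast
    note C = IC_in_E[OF cd]
    show "GG e v \<in> tangent_space E e" if "v \<in> tangent_space E e" for v
      unfolding GG[OF cd e that] F_def by (rule coord_vec_tangent[OF atl_E C e])
    fix u v a b assume uv: "u \<in> tangent_space E e" "v \<in> tangent_space E e"
    show "GG e (\<lambda>D. a *\<^sub>R u D + b *\<^sub>R v D) = (\<lambda>D. a *\<^sub>R GG e u D + b *\<^sub>R GG e v D)"
      unfolding GG[OF cd e tangent_lincomb[OF C e uv]] GG[OF cd e uv(1)] GG[OF cd e uv(2)] F_def
      by (rule ext) (simp add: spray_vec_linear linear_add[OF IC_cv_linear[OF cd e]] linear_scale[OF IC_cv_linear[OF cd e]])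
  next
    fix C and w :: "('m, 'n) txp" assume "C \<in> E"
    then obtain c d where cd: "c \<in> A" "d \<in> B" and C: "C = IC c d" unfolding induced_atlas_def by blast
    note O = cimg_IC_open[OF cd]
    let ?u = "fst (snd w)"
    let ?F = "\<lambda>z. (\<Sum>i\<in>UNIV. \<Sum>a\<in>UNIV. (snd (snd z) $ i $ a * ?u $ i) *\<^sub>R t_dir a) -
     2 *\<^sub>R (\<Sum>i\<in>UNIV. \<Sum>j\<in>UNIV. \<Sum>b\<in>UNIV.
       ((1 / 2 * (\<Sum>a\<in>UNIV. N c d b j a (cinv C z) * snd (snd z) $ i $ a)) * ?u $ i) *\<^sub>R p_dir j b)"
    have sp: "smooth_on (cimg (IC c d)) (\<lambda>z. snd (snd z) $ i $ a)" for i a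
      by (intro smooth_on_linear_fun[OF O] bounded_linear_compose[OF bounded_linear_vec_nth]
          bounded_linear_compose[OF bounded_linear_snd bounded_linear_snd])
    have sN: "smooth_on (cimg (IC c d)) (\<lambda>z. N c d b j a (cinv C z))" for b j a
      using N cd unfolding temporal_components_def smooth_in_def C o_def by blast
    have sF: "smooth_on (cimg (IC c d)) ?F"
      unfolding diff_conv_add_uminus scaleR_minus_left[symmetric]
      by (intro smooth_on_add[OF O] smooth_on_scaleR[OF O] smooth_on_sum[OF O] smooth_on_mult[OF O]
          smooth_on_const sp sN)
    have "smooth_in (IC c d) (\<lambda>e. GG e (cv c d e w) (IC c d)) \<longleftrightarrow> smooth_on (cimg (IC c d)) ?F"
    proof (rule smooth_in_IC_cong[OF cd])
      fix z assume z: "z \<in> cimg (IC c d)"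
      note e = cinv_in_cdom[OF z]
      note E' = atl_E IC_in_E[OF cd] e
      show "GG (cinv (IC c d) z) (cv c d (cinv (IC c d) z) w) (IC c d) = ?F z"
        unfolding GG[OF cd e coord_vec_tangent[OF E']] F_def coord_vec_at[OF E'] spray_vec_expansion
          pc_cinv(1)[OF cd z] G C ..
    qed
    with sF show "smooth_in C (\<lambda>e. GG e (coord_vec E C e w) C)" unfolding C by blast
  qed
  then show ?thesis unfolding temporal_semispray_iff using GG unfolding F_def by blast
qed

end

section \<open>The metric in coordinates\<close>

lemma metric_bilinear:
  fixes \<phi> :: "'a \<Rightarrow> ('a, real^'n) tangent \<Rightarrow> ('a, real^'n) tangent \<Rightarrow> real"
  assumes atl: "diff_atlas B" and \<phi>: "tensor_field_02 B \<phi>" and d: "d \<in> B" "x \<in> cdom d"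
  shows "\<phi> x (coord_vec B d x u) (coord_vec B d x v) = u \<bullet> (metric_comp B \<phi> d x *v v)"
proof -
  let ?cv = "coord_vec B d x"
  have x: "x \<in> carrier_of B" using d unfolding carrier_of_def by blast
  note tan = coord_vec_tangent[OF atl d]
  have cvl: "?cv (a *\<^sub>R u + b *\<^sub>R v) = (\<lambda>c. a *\<^sub>R ?cv u c + b *\<^sub>R ?cv v c)" for a b u v
    by (rule ext) (simp add: linear_add[OF coord_vec_linear[OF atl d]] linear_scale[OF coord_vec_linear[OF atl d]])
  have bil: "\<phi> x (?cv (a *\<^sub>R u + b *\<^sub>R v)) (?cv w) = a * \<phi> x (?cv u) (?cv w) + b * \<phi> x (?cv v) (?cv w)"
    "\<phi> x (?cv w) (?cv (a *\<^sub>R u + b *\<^sub>R v)) = a * \<phi> x (?cv w) (?cv u) + b * \<phi> x (?cv w) (?cv v)" for a b u v w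
    unfolding cvl using \<phi> x tan unfolding tensor_field_02_def by blast+
  have lin1: "linear (\<lambda>u. \<phi> x (?cv u) (?cv w))" for w
  proof (rule linearI)
    show "\<phi> x (?cv (u + v)) (?cv w) = \<phi> x (?cv u) (?cv w) + \<phi> x (?cv v) (?cv w)" for u v
      using bil(1)[of 1 u 1 v w] by simp
    show "\<phi> x (?cv (a *\<^sub>R u)) (?cv w) = a *\<^sub>R \<phi> x (?cv u) (?cv w)" for a u
      using bil(1)[of a u 0 u w] by simp
  qed
  have lin2: "linear (\<lambda>u. \<phi> x (?cv w) (?cv u))" for w
  proof (rule linearI)
    show "\<phi> x (?cv w) (?cv (u + v)) = \<phi> x (?cv w) (?cv u) + \<phi> x (?cv w) (?cv v)" for u v
      using bil(2)[of w 1 u 1 v] by simp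
    show "\<phi> x (?cv w) (?cv (a *\<^sub>R u)) = a *\<^sub>R \<phi> x (?cv w) (?cv u)" for a u
      using bil(2)[of w a u 0 u] by simp
  qed
  have "\<phi> x (?cv u) (?cv v) = (\<Sum>i\<in>UNIV. u $ i *\<^sub>R \<phi> x (?cv (axis i 1)) (?cv v))"
    by (rule linear_axis_expansion[OF lin1])
  also have "\<dots> = (\<Sum>i\<in>UNIV. u $ i *\<^sub>R (\<Sum>j\<in>UNIV. v $ j *\<^sub>R \<phi> x (?cv (axis i 1)) (?cv (axis j 1))))"
    by (rule sum.cong[OF refl], rule arg_cong[where f = "\<lambda>r. _ *\<^sub>R r"], rule linear_axis_expansion[OF lin2])
  also have "\<dots> = u \<bullet> (metric_comp B \<phi> d x *v v)"
    by (simp add: inner_vec_def matrix_vector_mult_def metric_comp_def mult.commute)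
  finally show ?thesis .
qed

lemma metric_change:
  fixes \<phi> :: "'a \<Rightarrow> ('a, real^'n) tangent \<Rightarrow> ('a, real^'n) tangent \<Rightarrow> real"
  assumes atl: "diff_atlas B" and \<phi>: "tensor_field_02 B \<phi>"
    and d: "d \<in> B" "x \<in> cdom d" and d': "d' \<in> B" "x \<in> cdom d'"
  shows "metric_comp B \<phi> d x = transpose (cjac d d' x) ** metric_comp B \<phi> d' x ** cjac d d' x"
proof -
  let ?Y = "cjac d d' x" let ?g' = "metric_comp B \<phi> d' x"
  have "metric_comp B \<phi> d x $ i $ j = (transpose ?Y ** ?g' ** ?Y) $ i $ j" for i j
  proof -
    have cv: "coord_vec B d x u = coord_vec B d' x (?Y *v u)" for u
      unfolding cjac_works[OF atl d(1) d'(1) d(2) d'(2)]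
      by (rule coord_vec_change[OF atl d(1) d'(1) d(2) d'(2)])
    have "metric_comp B \<phi> d x $ i $ j = \<phi> x (coord_vec B d x (axis i 1)) (coord_vec B d x (axis j 1))"
      by (simp add: metric_comp_def)
    also have "\<dots> = (?Y *v axis i 1) \<bullet> (?g' *v (?Y *v axis j 1))"
      unfolding cv by (rule metric_bilinear[OF atl \<phi> d'])
    also have "\<dots> = axis i 1 \<bullet> ((transpose ?Y ** ?g' ** ?Y) *v axis j 1)"
      unfolding matrix_vector_mul_assoc[symmetric] transpose_matrix_vector inner_commute[of "axis i 1"] dot_lmul_matrix
      by (rule inner_commute)
    finally show ?thesis by (simp only: matrix_entry[symmetric])
  qed
  then show ?thesis by (simp add: vec_eq_iff)
qed

lemma metric_symmetric:
  fixes \<phi> :: "'a \<Rightarrow> ('a, real^'n) tangent \<Rightarrow> ('a, real^'n) tangent \<Rightarrow> real"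
  assumes atl: "diff_atlas B" and \<phi>: "semi_riemannian_metric B \<phi>" and d: "d \<in> B" "x \<in> cdom d"
  shows "transpose (metric_comp B \<phi> d x) = metric_comp B \<phi> d x"
proof -
  have x: "x \<in> carrier_of B" using d unfolding carrier_of_def by blast
  have "\<phi> x (coord_vec B d x u) (coord_vec B d x v) = \<phi> x (coord_vec B d x v) (coord_vec B d x u)" for u v
    using \<phi> x coord_vec_tangent[OF atl d] unfolding semi_riemannian_metric_def by blast
  then show ?thesis by (simp add: metric_comp_def transpose_def)
qed

text \<open>A vector in the kernel of the component matrix would be orthogonal to every tangent vector.\<close>

lemma metric_invertible:
  fixes \<phi> :: "'a \<Rightarrow> ('a, real^'n) tangent \<Rightarrow> ('a, real^'n) tangent \<Rightarrow> real"
  assumes atl: "diff_atlas B" and \<phi>: "semi_riemannian_metric B \<phi>" and d: "d \<in> B" "x \<in> cdom d"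
  shows "invertible (metric_comp B \<phi> d x)"
proof -
  let ?cv = "coord_vec B d x" let ?g = "metric_comp B \<phi> d x"
  have x: "x \<in> carrier_of B" using d unfolding carrier_of_def by blast
  have \<phi>': "tensor_field_02 B \<phi>" using \<phi> unfolding semi_riemannian_metric_def by blast
  have "v = 0" if v: "?g *v v = 0" for v
  proof -
    have "\<phi> x (?cv v) w = 0" if w: "w \<in> tangent_space B x" for w
    proof -
      have "\<phi> x (?cv v) w = \<phi> x w (?cv v)"
        using \<phi> x coord_vec_tangent[OF atl d] w unfolding semi_riemannian_metric_def by blast
      also have "\<dots> = \<phi> x (?cv (w d)) (?cv v)"
        by (rule arg_cong[where f = "\<lambda>u. \<phi> x u (?cv v)"]) (rule tangent_eq_coord_vec[OF w d])
      also have "\<dots> = 0" unfolding metric_bilinear[OF atl \<phi>' d] v by simp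
      finally show ?thesis .
    qed
    then have "?cv v = (\<lambda>_. 0)"
      using \<phi> x coord_vec_tangent[OF atl d, of v] unfolding semi_riemannian_metric_def by blast
    then show "v = 0" using coord_vec_at[OF atl d, of v] by simp
  qed
  then show ?thesis by (simp add: invertible_left_inverse matrix_left_invertible_ker)
qed

lemma metric_smooth:
  assumes "tensor_field_02 B \<phi>" "d \<in> B"
  shows "smooth_on (cimg d) (\<lambda>y. metric_comp B \<phi> d (cinv d y) $ i $ j)"
  using assms unfolding tensor_field_02_def smooth_in_def metric_comp_def by (simp add: o_def)

section \<open>The nonlinear connection of a semispray\<close>

context manifold_pair
begin

text \<open>The semispray components restricted to the fibre over \<open>(t, x)\<close>, for a fixed upper index \<open>b\<close>, as a matrix in the two
  lower indices. Partial derivatives by \<open>p\<close> only see this restriction, on which a change of charts is linear.\<close>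

definition spray_matrix :: "('t, 'x, 'm, 'n, 'n) local_family \<Rightarrow> ('t, real^'m) chart \<Rightarrow> ('x, real^'n) chart \<Rightarrow> 't \<Rightarrow> 'x \<Rightarrow> 'm
    \<Rightarrow> real^'m^'n \<Rightarrow> real^'n^'n" where
  "spray_matrix G c d t x b p = (\<chi> j i. G c d b j i (covjet_at c d t x p))"

definition hess_matrix :: "('t, real^'m) chart \<Rightarrow> ('t, real^'m) chart \<Rightarrow> 't \<Rightarrow> 'm \<Rightarrow> real^'m^'m" where
  "hess_matrix c c' t b = (\<chi> f a. hess c c' t b a f)"

text \<open>Evaluating the semispray on a tangent vector in two charts gives the law \<open>spray_eq_iff\<close> for every \<open>u\<close>; in
  matrix form the correction is quadratic in \<open>p\<close>, with the Hessian of the time change as its middle factor.\<close>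

lemma semispray_law:
  assumes G: "temporal_semispray A B GG G"
    and cd: "c \<in> A" "d \<in> B" "c' \<in> A" "d' \<in> B" and t: "t \<in> cdom c" "t \<in> cdom c'" and x: "x \<in> cdom d" "x \<in> cdom d'"
  shows "spray_matrix G c' d' t x b (transpose (cjac d' d x) ** p ** transpose (cjac c c' t)) ** cjac d d' x =
    transpose (cjac d' d x) ** ((\<Sum>f\<in>UNIV. cjac c c' t $ b $ f *\<^sub>R spray_matrix G c d t x f p) -
       (1 / 2) *\<^sub>R (p ** hess_matrix c c' t b ** transpose p))"
proof -
  define e where "e = covjet_at c d t x p"
  have e: "e \<in> cdom (IC c d)" "e \<in> cdom (IC c' d')" and te: "fst e = t" "fst (snd e) = x" and pe: "pc c d e = p"
    using covjet_at_in_cdom[OF cd(1) t(1) cd(2) x(1), of p] t x unfolding e_def by (simp_all add: cdom_IC)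
  let ?X = "cjac d' d x" let ?Y = "cjac d d' x" let ?S = "cjac c c' t"
  have e': "covjet_at c' d' t x (transpose ?X ** p ** transpose ?S) = e"
    using covjet_at_pc[OF cd(3,4) e(2)] pc_change[OF cd e] by (simp add: te pe)
  have law: "cv c d e (spray_vec (pc c d e) (\<lambda>b j i. G c d b j i e) u) =
      cv c' d' e (spray_vec (pc c' d' e) (\<lambda>b j i. G c' d' b j i e) (cjac d d' (fst (snd e)) *v u))" for u
  proof -
    \<comment> \<open>A test vector with spatial part \<open>u\<close> at which the field is evaluated in both charts.\<close>
    define v where "v = cv c d e (0, u, 0)"
    have v: "v \<in> tangent_space E e"
      unfolding v_def by (rule coord_vec_tangent[OF atl_E IC_in_E[OF cd(1,2)] e(1)])
    have vC: "v (IC c d) = (0, u, 0)"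
      unfolding v_def by (rule coord_vec_at[OF atl_E IC_in_E[OF cd(1,2)] e(1)])
    have "v (IC c' d') = pd (IC c d) (crd (IC c' d')) e (v (IC c d))"
      using v IC_in_E[OF cd(1,2)] IC_in_E[OF cd(3,4)] e unfolding tangent_space_def by blast
    then have vC': "fst (snd (v (IC c' d'))) = cjac d d' (fst (snd e)) *v u"
      by (simp only: IC_transition(2)[OF cd e] vC fst_conv snd_conv)
    have "GG e v = cv c d e (spray_vec (pc c d e) (\<lambda>b j i. G c d b j i e) (fst (snd (v (IC c d)))))"
      using G cd e(1) v unfolding temporal_semispray_iff by blast
    moreover have "GG e v = cv c' d' e (spray_vec (pc c' d' e) (\<lambda>b j i. G c' d' b j i e) (fst (snd (v (IC c' d')))))"
      using G cd e(2) v unfolding temporal_semispray_iff by blast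
    ultimately show ?thesis unfolding vC vC' fst_conv snd_conv by (rule trans[OF sym])
  qed
  show ?thesis
  proof (subst vec_eq_iff, rule allI, subst vec_eq_iff, rule allI)
    fix j l
    have Yl: "(?Y *v axis l 1) $ i = ?Y $ i $ l" for i
      by (simp add: matrix_vector_mult_basis column_def)
    have pl: "(transpose p *v axis l 1) $ a = p $ l $ a" for a
      by (simp add: matrix_vector_mult_basis column_def transpose_def del: transpose_matrix_vector)
    have ax: "(\<Sum>i\<in>UNIV. g i * (axis l 1 :: real^'n) $ i) = g l" for g :: "'n \<Rightarrow> real"
      by (simp add: axis_def if_distrib cong: if_cong)
    have "(\<Sum>i\<in>UNIV. G c' d' b j i e * ?Y $ i $ l) =
      (\<Sum>k\<in>UNIV. \<Sum>f\<in>UNIV. ?X $ k $ j * G c d f k l e * ?S $ b $ f) -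
      1 / 2 * (\<Sum>k\<in>UNIV. \<Sum>f\<in>UNIV. ?X $ k $ j * p $ k $ f * (\<Sum>a\<in>UNIV. hess c c' t b a f * p $ l $ a))"
      using law[of "axis l 1", unfolded spray_eq_iff[OF cd e], rule_format, of b j]
      unfolding te pe Yl pl ax .
    moreover have "(spray_matrix G c' d' t x b (transpose ?X ** p ** transpose ?S) ** ?Y) $ j $ l =
        (\<Sum>i\<in>UNIV. G c' d' b j i e * ?Y $ i $ l)"
    proof -
      have "spray_matrix G c' d' t x b (transpose ?X ** p ** transpose ?S) = (\<chi> j i. G c' d' b j i e)"
        by (simp only: spray_matrix_def e')
      then show ?thesis by (simp add: matrix_matrix_mult_def[of _ ?Y])
    qed
    moreover have "(transpose ?X ** ((\<Sum>f\<in>UNIV. ?S $ b $ f *\<^sub>R spray_matrix G c d t x f p) -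
       (1 / 2) *\<^sub>R (p ** hess_matrix c c' t b ** transpose p))) $ j $ l =
      (\<Sum>k\<in>UNIV. \<Sum>f\<in>UNIV. ?X $ k $ j * G c d f k l e * ?S $ b $ f) -
      1 / 2 * (\<Sum>k\<in>UNIV. \<Sum>f\<in>UNIV. ?X $ k $ j * p $ k $ f * (\<Sum>a\<in>UNIV. hess c c' t b a f * p $ l $ a))"
    proof -
      have "(p ** hess_matrix c c' t b ** transpose p) $ k $ l =
          (\<Sum>f\<in>UNIV. p $ k $ f * (\<Sum>a\<in>UNIV. hess c c' t b a f * p $ l $ a))" for k
        unfolding matrix_mul_assoc[symmetric]
        by (simp add: matrix_matrix_mult_def transpose_def hess_matrix_def)
      then show ?thesis
        unfolding transpose_mult_component
        by (simp add: spray_matrix_def e_def[symmetric] right_diff_distrib sum_subtractf sum_distrib_left mult_ac)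
    qed
    ultimately show "(spray_matrix G c' d' t x b (transpose ?X ** p ** transpose ?S) ** ?Y) $ j $ l =
      (transpose ?X ** ((\<Sum>f\<in>UNIV. ?S $ b $ f *\<^sub>R spray_matrix G c d t x f p) -
       (1 / 2) *\<^sub>R (p ** hess_matrix c c' t b ** transpose p))) $ j $ l" by simp
  qed
qed

text \<open>The components are read off the smooth field \<open>e \<mapsto> GG e (\<partial>/\<partial>x\<^sup>i)\<close> by a linear functional.\<close>

lemma semispray_smooth:
  assumes G: "temporal_semispray A B GG G" and cd: "c \<in> A" "d \<in> B"
  shows "smooth_in (IC c d) (G c d b j i)"
proof -
  define w :: "('m, 'n) txp" where "w = (0, axis i 1, 0)"
  define L :: "('m, 'n) txp \<Rightarrow> real" where "L = (\<lambda>z. (- 1 / 2) *\<^sub>R (snd (snd z) $ j $ b))"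
  have L: "bounded_linear L" unfolding L_def
    by (intro bounded_linear_compose[OF bounded_linear_scaleR_right] bounded_linear_compose[OF bounded_linear_vec_nth]
        bounded_linear_compose[OF bounded_linear_snd bounded_linear_snd])
  have L_spray: "L (spray_vec q g (axis i 1)) = g b j i" for q and g :: "'m \<Rightarrow> 'n \<Rightarrow> 'n \<Rightarrow> real"
    by (simp add: L_def spray_vec_def axis_def mult_delta_right)
  have "smooth_in (IC c d) (\<lambda>e. GG e (cv c d e w) (IC c d))"
    using G IC_in_E[OF cd] unfolding temporal_semispray_iff tensor_field_11_def by blast
  then have "smooth_on (cimg (IC c d)) (\<lambda>z. L (GG (cinv (IC c d) z) (cv c d (cinv (IC c d) z) w) (IC c d)))"
    unfolding smooth_in_def o_def by (rule smooth_on_bounded_linear[OF cimg_IC_open[OF cd] L])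
  moreover have "G c d b j i (cinv (IC c d) z) = L (GG (cinv (IC c d) z) (cv c d (cinv (IC c d) z) w) (IC c d))"
    if z: "z \<in> cimg (IC c d)" for z
  proof -
    note e = cinv_in_cdom[OF z]
    note E' = atl_E IC_in_E[OF cd] e
    let ?e = "cinv (IC c d) z"
    have "GG ?e (cv c d ?e w) = cv c d ?e (spray_vec (pc c d ?e) (\<lambda>b j i. G c d b j i ?e)
        (fst (snd (cv c d ?e w (IC c d)))))"
      using G cd e coord_vec_tangent[OF E', of w] unfolding temporal_semispray_iff by blast
    then have "GG ?e (cv c d ?e w) (IC c d) = spray_vec (pc c d ?e) (\<lambda>b j i. G c d b j i ?e) (axis i 1)"
      by (simp only: coord_vec_at[OF E'] w_def fst_conv snd_conv)
    then show ?thesis by (simp only: L_spray)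
  qed
  ultimately show ?thesis by (subst smooth_in_IC_cong[OF cd])
qed

definition spray_matrix_deriv :: "('t, 'x, 'm, 'n, 'n) local_family \<Rightarrow> ('t, real^'m) chart \<Rightarrow> ('x, real^'n) chart
    \<Rightarrow> ('t, 'x) covjet \<Rightarrow> 'm \<Rightarrow> real^'m^'n \<Rightarrow> real^'n^'n" where
  "spray_matrix_deriv G c d e b w = (\<chi> j i. pd (IC c d) (G c d b j i) e (0, 0, w))"

lemma spray_matrix_has_derivative:
  assumes G: "\<And>j i. smooth_in (IC c d) (G c d b j i)"
    and cd: "c \<in> A" "d \<in> B" and t: "t \<in> cdom c" and x: "x \<in> cdom d"
  shows "(spray_matrix G c d t x b has_derivative spray_matrix_deriv G c d (covjet_at c d t x p) b) (at p)"
proof (rule has_derivative_matrixI)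
  fix j i
  define e where "e = covjet_at c d t x p"
  define F where "F = G c d b j i \<circ> cinv (IC c d)"
  note covjet_at = covjet_at_in_cdom[OF cd(1) t cd(2) x]
  have Fpt: "F (crd c t, crd d x, q) = G c d b j i (covjet_at c d t x q)" for q
    using cinv_IC[OF cd crd_in_cimg[OF t] crd_in_cimg[OF x], of q]
    by (simp add: F_def diff_atlas_cinv[OF atl_A cd(1) t] diff_atlas_cinv[OF atl_B cd(2) x])
  have crd: "crd (IC c d) e = (crd c t, crd d x, p)" by (simp add: crd_IC e_def covjet_at)
  have "crd (IC c d) e \<in> cimg (IC c d)" unfolding e_def by (rule crd_in_cimg[OF covjet_at(2)])
  then have "F differentiable (at (crd (IC c d) e))"
    using G[of j i] smooth_on_differentiable unfolding smooth_in_def F_def by blast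
  then have F: "(F has_derivative pd (IC c d) (G c d b j i) e) (at (crd c t, crd d x, p))"
    unfolding pd_def F_def crd using frechet_derivative_works by blast
  have "((\<lambda>q. (crd c t, crd d x, q)) has_derivative (\<lambda>w. (0, 0, w))) (at p)"
    by (intro derivative_intros)
  from diff_chain_at[OF this F]
  show "((\<lambda>q. spray_matrix G c d t x b q $ j $ i) has_derivative (\<lambda>w. spray_matrix_deriv G c d (covjet_at c d t x p) b w $ j $ i)) (at p)"
    by (simp add: spray_matrix_def spray_matrix_deriv_def o_def Fpt e_def)
qed

definition spray_conn :: "('x \<Rightarrow> ('x, real^'n) tangent \<Rightarrow> ('x, real^'n) tangent \<Rightarrow> real)
    \<Rightarrow> ('t, 'x, 'm, 'n, 'n) local_family \<Rightarrow> ('t, 'x, 'm, 'n, 'm) local_family" where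
  "spray_conn \<phi> G = (\<lambda>c d a r b e.
     let C = induced_chart A B c d;
         g = metric_comp B \<phi> d (fst (snd e));
         h = matrix_inv g
     in \<Sum>j\<in>UNIV. \<Sum>k\<in>UNIV. \<Sum>i\<in>UNIV.
          h $ j $ k * pd C (G c d a j k) e (p_dir i b) * g $ i $ r)"

text \<open>The defining sum is the derivative of the contraction \<open>h\<^sup>j\<^sup>k G\<^sub>j\<^sub>k\<close> in a single direction.\<close>

lemma spray_conn_eq:
  assumes G: "\<And>j i. smooth_in (IC c d) (G c d b j i)"
    and cd: "c \<in> A" "d \<in> B" and e: "e \<in> cdom (IC c d)"
  shows "linear (spray_matrix_deriv G c d e b)"
    and "spray_conn \<phi> G c d b r a e = matrix_inv (metric_comp B \<phi> d (fst (snd e))) \<bullet>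
      spray_matrix_deriv G c d e b (column_matrix (metric_comp B \<phi> d (fst (snd e))) r a)"
proof -
  have "(spray_matrix G c d (fst e) (fst (snd e)) b has_derivative spray_matrix_deriv G c d e b) (at (pc c d e))"
    using spray_matrix_has_derivative[where G = G and b = b and p = "pc c d e", OF G cd IC_dom(1,2)[OF e]]
    unfolding covjet_at_pc[OF cd e] .
  then show lin: "linear (spray_matrix_deriv G c d e b)" by (rule has_derivative_linear)
  let ?g = "metric_comp B \<phi> d (fst (snd e))" let ?h = "matrix_inv ?g"
  have "column_matrix ?g r a = (\<Sum>i\<in>UNIV. ?g $ i $ r *\<^sub>R axis i (axis a 1))"
  proof -
    have "(\<Sum>i\<in>UNIV. ?g $ i $ r * (axis i (axis a 1) :: real^'m^'n) $ l $ f) = ?g $ l $ r * axis a 1 $ f" for l f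
    proof -
      have "(\<Sum>i\<in>UNIV. ?g $ i $ r * (axis i (axis a 1) :: real^'m^'n) $ l $ f) =
          (\<Sum>i\<in>UNIV. if l = i then ?g $ i $ r * axis a 1 $ f else 0)"
        by (intro sum.cong refl) (auto simp: axis_def)
      then show ?thesis by simp
    qed
    then show ?thesis by (simp add: vec_eq_iff column_matrix_def)
  qed
  then have "spray_matrix_deriv G c d e b (column_matrix ?g r a) = (\<Sum>i\<in>UNIV. ?g $ i $ r *\<^sub>R spray_matrix_deriv G c d e b (axis i (axis a 1)))"
    by (simp only: linear_sum[OF lin] linear_scale[OF lin])
  then have "?h \<bullet> spray_matrix_deriv G c d e b (column_matrix ?g r a) =
      (\<Sum>i\<in>UNIV. ?g $ i $ r * (?h \<bullet> spray_matrix_deriv G c d e b (axis i (axis a 1))))"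
    by (simp only: inner_sum_right inner_scaleR_right)
  also have "\<dots> = (\<Sum>i\<in>UNIV. \<Sum>j\<in>UNIV. \<Sum>k\<in>UNIV. ?h $ j $ k * pd (IC c d) (G c d b j k) e (p_dir i a) * ?g $ i $ r)"
    by (simp add: inner_vec_def spray_matrix_deriv_def sum_distrib_left mult_ac)
  also have "\<dots> = (\<Sum>j\<in>UNIV. \<Sum>i\<in>UNIV. \<Sum>k\<in>UNIV. ?h $ j $ k * pd (IC c d) (G c d b j k) e (p_dir i a) * ?g $ i $ r)"
    by (rule sum.swap)
  also have "\<dots> = (\<Sum>j\<in>UNIV. \<Sum>k\<in>UNIV. \<Sum>i\<in>UNIV. ?h $ j $ k * pd (IC c d) (G c d b j k) e (p_dir i a) * ?g $ i $ r)"
    by (intro sum.cong refl sum.swap)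
  finally show "spray_conn \<phi> G c d b r a e = ?h \<bullet> spray_matrix_deriv G c d e b (column_matrix ?g r a)"
    unfolding spray_conn_def Let_def by (rule sym)
qed

lemma spray_conn_smooth:
  assumes G: "\<And>b j i. smooth_in (IC c d) (G c d b j i)" and \<phi>: "semi_riemannian_metric B \<phi>"
    and cd: "c \<in> A" "d \<in> B"
  shows "smooth_in (IC c d) (spray_conn \<phi> G c d a r b)"
proof -
  note O = cimg_IC_open[OF cd] and Od = cimg_open[OF M cd(2)]
  have \<phi>': "tensor_field_02 B \<phi>" using \<phi> unfolding semi_riemannian_metric_def by blast
  let ?g = "\<lambda>y. metric_comp B \<phi> d (cinv d y)"
  have inv: "invertible (?g y)" if "y \<in> cimg d" for y
    by (rule metric_invertible[OF atl_B \<phi> cd(2) cinv_in_cdom[OF that]])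
  have base: "smooth_on (cimg (IC c d)) (\<lambda>z. f (fst (snd z)))" if "smooth_on (cimg d) f" for f :: "real^'n \<Rightarrow> real"
    by (rule smooth_on_compose[OF O Od _ smooth_on_linear_fun[OF O bounded_linear_compose[OF bounded_linear_fst bounded_linear_snd]] that])
      (auto simp: cimg_IC[OF cd])
  have g: "smooth_on (cimg (IC c d)) (\<lambda>z. ?g (fst (snd z)) $ i $ j)" for i j
    by (rule base[OF metric_smooth[OF \<phi>' cd(2)]])
  have h: "smooth_on (cimg (IC c d)) (\<lambda>z. matrix_inv (?g (fst (snd z))) $ i $ j)" for i j
    by (rule base[OF smooth_on_matrix_inv[OF Od inv metric_smooth[OF \<phi>' cd(2)]]])
  have dG: "smooth_on (cimg (IC c d)) (\<lambda>z. frechet_derivative (G c d a j k \<circ> cinv (IC c d)) (at z) w)" for j k w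
    using smooth_on_frechet G unfolding smooth_in_def by blast
  have "smooth_on (cimg (IC c d)) (\<lambda>z. \<Sum>j\<in>UNIV. \<Sum>k\<in>UNIV. \<Sum>i\<in>UNIV. matrix_inv (?g (fst (snd z))) $ j $ k *
      frechet_derivative (G c d a j k \<circ> cinv (IC c d)) (at z) (p_dir i b) * ?g (fst (snd z)) $ i $ r)"
    by (intro smooth_on_sum[OF O] smooth_on_mult[OF O] g h dG)
  moreover have "spray_conn \<phi> G c d a r b (cinv (IC c d) z) =
    (\<Sum>j\<in>UNIV. \<Sum>k\<in>UNIV. \<Sum>i\<in>UNIV. matrix_inv (?g (fst (snd z))) $ j $ k *
      frechet_derivative (G c d a j k \<circ> cinv (IC c d)) (at z) (p_dir i b) * ?g (fst (snd z)) $ i $ r)"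
    if z: "z \<in> cimg (IC c d)" for z
    unfolding spray_conn_def Let_def pd_def crd_cinv[OF z] pc_cinv(2)[OF cd z] ..
  ultimately show ?thesis by (subst smooth_in_IC_cong[OF cd])
qed

text \<open>The contraction \<open>S = h\<^sup>j\<^sup>k G\<^sub>j\<^sub>k\<close> transforms linearly up to the correction \<open>- Q p p / 2\<close>, where \<open>Q\<close> is the symmetric
  bilinear form built from the inverse metric and the Hessian of the time change. Differentiating this
  identity along the preimage \<open>W\<close> of the direction \<open>g'\<^sub>i\<^sub>r \<partial>/\<partial>p'\<^sub>i\<^sup>q\<close> turns the correction into \<open>- Q p W\<close>. In it the metric
  contained in \<open>W\<close> cancels the inverse metric contained in \<open>Q\<close>, and what remains is the inhomogeneous term of the temporal
  rule.\<close>

lemma spray_conn_law: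
  assumes G: "temporal_semispray A B GG G" and \<phi>: "semi_riemannian_metric B \<phi>"
    and cd: "c \<in> A" "d \<in> B" "c' \<in> A" "d' \<in> B" and e: "e \<in> cdom (IC c d)" "e \<in> cdom (IC c' d')"
  shows "spray_conn \<phi> G c' d' b r q e = (\<Sum>a\<in>UNIV. cjac c' c (fst e) $ a $ q *
         ((\<Sum>k\<in>UNIV. \<Sum>f\<in>UNIV. cjac d' d (fst (snd e)) $ k $ r * spray_conn \<phi> G c d f k a e * cjac c c' (fst e) $ b $ f) -
          (\<Sum>k\<in>UNIV. \<Sum>f\<in>UNIV. cjac d' d (fst (snd e)) $ k $ r * pc c d e $ k $ f * hess c c' (fst e) b a f)))"
proof -
  define t where "t = fst e"
  define x where "x = fst (snd e)"
  define p where "p = pc c d e"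
  define X where "X = cjac d' d x"
  define Y where "Y = cjac d d' x"
  define S where "S = cjac c c' t"
  define R where "R = cjac c' c t"
  define H where "H = hess_matrix c c' t b"
  define g where "g = metric_comp B \<phi> d x"
  define h where "h = matrix_inv g"
  define g' where "g' = metric_comp B \<phi> d' x"
  define h' where "h' = matrix_inv g'"
  define N where "N = spray_conn \<phi> G c d"
  note dom = IC_dom(1)[OF e(1), folded t_def] IC_dom(2)[OF e(1), folded x_def]
    IC_dom(1)[OF e(2), folded t_def] IC_dom(2)[OF e(2), folded x_def]
  have \<phi>': "tensor_field_02 B \<phi>" using \<phi> unfolding semi_riemannian_metric_def by blast
  have YX: "Y ** X = mat 1" unfolding X_def Y_def by (rule cjac_inverse[OF atl_B cd(4,2) dom(4,2)])
  have XY: "X ** Y = mat 1" unfolding X_def Y_def by (rule cjac_inverse[OF atl_B cd(2,4) dom(2,4)])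
  have SR: "S ** R = mat 1" unfolding S_def R_def by (rule cjac_inverse[OF atl_A cd(3,1) dom(3,1)])
  have g'_eq: "g' = transpose X ** g ** X"
    unfolding g'_def g_def X_def by (rule metric_change[OF atl_B \<phi>' cd(4) dom(4) cd(2) dom(2)])
  have gh: "g ** h = mat 1" "h ** g = mat 1"
    unfolding h_def g_def by (rule matrix_inv_inverse[OF metric_invertible[OF atl_B \<phi> cd(2) dom(2)]])+
  have h'_eq: "h' = Y ** h ** transpose Y"
    unfolding h'_def
  proof (rule matrix_inv_unique_left)
    have "g' ** (Y ** h ** transpose Y) = transpose X ** (g ** (X ** Y) ** h) ** transpose Y"
      unfolding g'_eq by (simp add: matrix_mul_assoc)
    also have "\<dots> = mat 1" by (simp add: XY gh transpose_inverse[OF YX])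
    finally show "g' ** (Y ** h ** transpose Y) = mat 1" .
  qed
  have h_sym: "transpose h = h"
  proof -
    have g_sym: "transpose g = g" unfolding g_def by (rule metric_symmetric[OF atl_B \<phi> cd(2) dom(2)])
    have "g ** transpose h = mat 1" using transpose_inverse[OF gh(2)] unfolding g_sym .
    then have "h ** (g ** transpose h) = h" by simp
    then show ?thesis by (simp add: matrix_mul_assoc gh)
  qed
  have H_sym: "transpose H = H"
    unfolding H_def hess_matrix_def transpose_def
    by (simp add: vec_eq_iff hess_sym[OF T cd(1,3) dom(1,3), of b])
  define Q where "Q = (\<lambda>u w. h \<bullet> (u ** H ** transpose w))"
  have Q_sym: "Q u w = Q w u" for u w unfolding Q_def by (rule trace_form_symmetric[OF h_sym H_sym])
  have Q_alt: "Q u w = (h ** w ** mat 1) \<bullet> (u ** H)" for u w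
    unfolding Q_def by (simp add: inner_matrix_mult_right transpose_transpose)
  have Q_lin: "linear (Q u)" for u
  proof (rule linearI)
    show "Q u (v + w) = Q u v + Q u w" for v w
      using matrix_mult_lincomb[of h 1 v 1 w "mat 1"] by (simp add: Q_alt inner_add_left)
    show "Q u (r *\<^sub>R v) = r *\<^sub>R Q u v" for r v
      using matrix_mult_lincomb[of h r v 0 v "mat 1"] by (simp add: Q_alt)
  qed
  have "(\<lambda>u. Q u w) = Q w" for w by (rule ext) (rule Q_sym)
  then have "bilinear Q" unfolding bilinear_def using Q_lin by simp
  then have Q_bl: "bounded_bilinear Q" by (simp add: bilinear_conv_bounded_bilinear)
  define L where "L = (\<lambda>u. transpose X ** u ** transpose S)"
  have lin_L: "linear L" unfolding L_def
    by (rule linearI) (simp_all add: vec_eq_iff sandwich_component sum.distrib sum_distrib_left algebra_simps)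
  \<comment> \<open>Contraction with the inverse metric removes the spatial Jacobian matrices from the semispray law.\<close>
  have contracted: "h' \<bullet> spray_matrix G c' d' t x b (L u) =
      (\<Sum>f\<in>UNIV. S $ b $ f * (h \<bullet> spray_matrix G c d t x f u)) - 1 / 2 * Q u u" for u
  proof -
    let ?Z = "(\<Sum>f\<in>UNIV. S $ b $ f *\<^sub>R spray_matrix G c d t x f u) - (1 / 2) *\<^sub>R (u ** H ** transpose u)"
    have "h' \<bullet> spray_matrix G c' d' t x b (L u) = h \<bullet> (transpose Y ** (spray_matrix G c' d' t x b (L u) ** Y))"
      unfolding h'_eq inner_congruence by (simp add: matrix_mul_assoc)
    also have "spray_matrix G c' d' t x b (L u) ** Y = transpose X ** ?Z"
      unfolding L_def X_def Y_def S_def H_def by (rule semispray_law[OF G cd dom(1,3,2,4)])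
    also have "transpose Y ** (transpose X ** ?Z) = ?Z"
      by (simp add: matrix_mul_assoc transpose_inverse[OF XY])
    finally show ?thesis by (simp add: Q_def inner_diff_right inner_sum_right)
  qed
  note smG = semispray_smooth[OF G]
  have ept: "covjet_at c d t x p = e" "covjet_at c' d' t x (L p) = e"
    unfolding t_def x_def p_def L_def X_def S_def using covjet_at_pc[OF cd(1,2) e(1)] covjet_at_pc[OF cd(3,4) e(2)]
    unfolding pc_change[OF cd e] by simp_all
  have d1: "((\<lambda>u. h' \<bullet> spray_matrix G c' d' t x b (L u)) has_derivative (\<lambda>w. h' \<bullet> spray_matrix_deriv G c' d' e b (L w))) (at p)"
  proof -
    have "(L has_derivative L) (at p)"
      using lin_L by (simp add: linear_conv_bounded_linear bounded_linear_imp_has_derivative)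
    from diff_chain_at[OF this spray_matrix_has_derivative[where G = G and b = b and p = "L p", OF smG[OF cd(3,4)] cd(3,4) dom(3,4)]]
    show ?thesis unfolding ept o_def by (rule bounded_linear.has_derivative[OF bounded_linear_inner_right])
  qed
  have d2: "((\<lambda>u. (\<Sum>f\<in>UNIV. S $ b $ f * (h \<bullet> spray_matrix G c d t x f u)) - 1 / 2 * Q u u) has_derivative
      (\<lambda>w. (\<Sum>f\<in>UNIV. S $ b $ f * (h \<bullet> spray_matrix_deriv G c d e f w)) - 1 / 2 * (Q p w + Q w p))) (at p)"
  proof (intro has_derivative_diff has_derivative_sum has_derivative_mult_right)
    show "((\<lambda>u. h \<bullet> spray_matrix G c d t x f u) has_derivative (\<lambda>w. h \<bullet> spray_matrix_deriv G c d e f w)) (at p)" for f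
      using spray_matrix_has_derivative[where G = G and b = f and p = p, OF smG[OF cd(1,2)] cd(1,2) dom(1,2)]
      unfolding ept by (rule bounded_linear.has_derivative[OF bounded_linear_inner_right])
    show "((\<lambda>u. Q u u) has_derivative (\<lambda>w. Q p w + Q w p)) (at p)"
      by (rule bounded_bilinear.FDERIV[OF Q_bl has_derivative_ident has_derivative_ident])
  qed
  \<comment> \<open>Both sides of the contracted law are differentiated at \<open>p\<close>; symmetry of \<open>Q\<close> absorbs the factor \<open>1/2\<close>.\<close>
  have key: "h' \<bullet> spray_matrix_deriv G c' d' e b (L w) = (\<Sum>f\<in>UNIV. S $ b $ f * (h \<bullet> spray_matrix_deriv G c d e f w)) - Q p w" for w
    using fun_cong[OF has_derivative_unique[OF d1[unfolded contracted] d2], of w] Q_sym[of w p] by simp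
  \<comment> \<open>The vector that \<open>L\<close> maps to the direction in which the new connection components differentiate.\<close>
  define W where "W = (\<chi> l a. (g ** X) $ l $ r * R $ a $ q)"
  note W = column_matrix_change[OF g'_eq SR, of r q, folded W_def]
  have hD: "h \<bullet> spray_matrix_deriv G c d e f W = (\<Sum>k\<in>UNIV. \<Sum>a\<in>UNIV. X $ k $ r * R $ a $ q * N f k a e)" for f
  proof -
    have sm: "\<And>j i. smooth_in (IC c d) (G c d f j i)" by (rule smG[OF cd(1,2)])
    note lin = spray_conn_eq(1)[where G = G and b = f, OF sm cd(1,2) e(1)]
    have "N f k a e = h \<bullet> spray_matrix_deriv G c d e f (column_matrix g k a)" for k a
      unfolding N_def h_def g_def x_def by (rule spray_conn_eq(2)[where G = G and b = f, OF sm cd(1,2) e(1)])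
    then show ?thesis
      unfolding W(2) linear_sum[OF lin] linear_scale[OF lin] by (simp add: inner_sum_right)
  qed
  \<comment> \<open>Here \<open>h ** g = mat 1\<close> removes the metric.\<close>
  have QW: "Q p W = (\<Sum>k\<in>UNIV. \<Sum>a\<in>UNIV. X $ k $ r * R $ a $ q * (\<Sum>f\<in>UNIV. p $ k $ f * hess c c' t b a f))"
  proof -
    have "Q p W = (h ** W) \<bullet> (p ** H)"
      unfolding Q_def by (simp add: inner_matrix_mult_right transpose_transpose)
    moreover have "(h ** W) $ k $ a = X $ k $ r * R $ a $ q" for k a
    proof -
      have "(h ** W) $ k $ a = (h ** (g ** X)) $ k $ r * R $ a $ q"
        by (simp add: W_def matrix_matrix_mult_def[of h] sum_distrib_left sum_distrib_right mult_ac)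
      then show ?thesis by (simp add: matrix_mul_assoc gh)
    qed
    ultimately show ?thesis
      by (simp add: inner_vec_def matrix_matrix_mult_def[of p] H_def hess_matrix_def)
  qed
  have "spray_conn \<phi> G c' d' b r q e = h' \<bullet> spray_matrix_deriv G c' d' e b (column_matrix g' r q)"
    unfolding h'_def g'_def x_def by (rule spray_conn_eq(2)[where G = G and b = b, OF smG[OF cd(3,4)] cd(3,4) e(2)])
  also have "\<dots> = (\<Sum>f\<in>UNIV. S $ b $ f * (\<Sum>k\<in>UNIV. \<Sum>a\<in>UNIV. X $ k $ r * R $ a $ q * N f k a e)) -
      (\<Sum>k\<in>UNIV. \<Sum>a\<in>UNIV. X $ k $ r * R $ a $ q * (\<Sum>f\<in>UNIV. p $ k $ f * hess c c' t b a f))"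
    unfolding W(1)[symmetric] L_def[symmetric] key[unfolded L_def] hD QW ..
  also have "(\<Sum>f\<in>UNIV. S $ b $ f * (\<Sum>k\<in>UNIV. \<Sum>a\<in>UNIV. X $ k $ r * R $ a $ q * N f k a e)) =
      (\<Sum>a\<in>UNIV. \<Sum>k\<in>UNIV. \<Sum>f\<in>UNIV. R $ a $ q * (X $ k $ r * N f k a e * S $ b $ f))"
  proof -
    have "(\<Sum>f\<in>UNIV. S $ b $ f * (\<Sum>k\<in>UNIV. \<Sum>a\<in>UNIV. X $ k $ r * R $ a $ q * N f k a e)) =
      (\<Sum>f\<in>UNIV. \<Sum>k\<in>UNIV. \<Sum>a\<in>UNIV. R $ a $ q * (X $ k $ r * N f k a e * S $ b $ f))"
      by (simp add: sum_distrib_left mult_ac)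
    also have "\<dots> = (\<Sum>k\<in>UNIV. \<Sum>f\<in>UNIV. \<Sum>a\<in>UNIV. R $ a $ q * (X $ k $ r * N f k a e * S $ b $ f))"
      by (rule sum.swap)
    also have "\<dots> = (\<Sum>k\<in>UNIV. \<Sum>a\<in>UNIV. \<Sum>f\<in>UNIV. R $ a $ q * (X $ k $ r * N f k a e * S $ b $ f))"
      by (intro sum.cong refl sum.swap)
    also have "\<dots> = (\<Sum>a\<in>UNIV. \<Sum>k\<in>UNIV. \<Sum>f\<in>UNIV. R $ a $ q * (X $ k $ r * N f k a e * S $ b $ f))"
      by (rule sum.swap)
    finally show ?thesis .
  qed
  also have "(\<Sum>k\<in>UNIV. \<Sum>a\<in>UNIV. X $ k $ r * R $ a $ q * (\<Sum>f\<in>UNIV. p $ k $ f * hess c c' t b a f)) =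
      (\<Sum>a\<in>UNIV. \<Sum>k\<in>UNIV. \<Sum>f\<in>UNIV. R $ a $ q * (X $ k $ r * p $ k $ f * hess c c' t b a f))"
    by (subst sum.swap) (simp add: sum_distrib_left mult_ac)
  finally show ?thesis
    unfolding X_def S_def R_def N_def p_def t_def x_def
    by (simp only: right_diff_distrib sum_subtractf sum_distrib_left)
qed

lemma semispray_connection:
  assumes "temporal_semispray A B GG G" "semi_riemannian_metric B \<phi>"
  shows "temporal_components A B (spray_conn \<phi> G)"
  unfolding temporal_components_iff
proof (intro conjI ballI allI)
  show "smooth_in (IC c d) (spray_conn \<phi> G c d b j a)" if "c \<in> A" "d \<in> B" for c d b j a
    by (rule spray_conn_smooth[where G = G, OF semispray_smooth[OF assms(1) that] assms(2) that])
qed (rule spray_conn_law[OF assms]; blast)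

end

theorem proposition3p19:
  fixes T :: "'t topology" and A :: "('t, real^'m) chart set"
    and M :: "'x topology" and B :: "('x, real^'n) chart set"
  assumes "smooth_manifold T A" and "smooth_manifold M B"
  shows
    "(\<forall>GG (G :: ('t, 'x, 'm, 'n, 'n) local_family) \<phi>.
        temporal_semispray A B GG G \<and> semi_riemannian_metric B \<phi> \<longrightarrow>
        temporal_components A B
          (\<lambda>c d a r b e.
             let C = induced_chart A B c d;
                 g = metric_comp B \<phi> d (fst (snd e));
                 h = matrix_inv g
             in \<Sum>j\<in>UNIV. \<Sum>k\<in>UNIV. \<Sum>i\<in>UNIV.
                  h $ j $ k * pd C (G c d a j k) e (p_dir i b) * g $ i $ r)) \<and>
     (\<forall>N :: ('t, 'x, 'm, 'n, 'm) local_family.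
        temporal_components A B N \<longrightarrow>
        (\<exists>GG. temporal_semispray A B GG
          (\<lambda>c d a i j e. 1 / 2 * (\<Sum>b\<in>UNIV. N c d a i b e * p_coord A B c d e $ j $ b))))"
proof -
  interpret manifold_pair T A M B using assms by unfold_locales
  show ?thesis
  proof (intro conjI allI impI)
    fix GG and G :: "('t, 'x, 'm, 'n, 'n) local_family" and \<phi>
    assume "temporal_semispray A B GG G \<and> semi_riemannian_metric B \<phi>"
    then have "temporal_components A B (spray_conn \<phi> G)" using semispray_connection by blast
    then show "temporal_components A B
          (\<lambda>c d a r b e.
             let C = induced_chart A B c d;
                 g = metric_comp B \<phi> d (fst (snd e));
                 h = matrix_inv g
             in \<Sum>j\<in>UNIV. \<Sum>k\<in>UNIV. \<Sum>i\<in>UNIV.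
                  h $ j $ k * pd C (G c d a j k) e (p_dir i b) * g $ i $ r)"
      unfolding spray_conn_def .
  qed (rule connection_semispray; simp)
qed

end
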